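(* Let $V$ be a finite-dimensional $\mathbb{R}$-vector space, let $K\subseteq\mathbb{R}$ be a subfield, and let $W$ be a $K$-structure on $V$. Every $W$-fan in $V$ has a strong $W$-completion.
   Context: Let $n=\dim V$; $V$ carries its canonical topology, and for a subspace $U\subseteq V$ and $A\subseteq U$, $\mathrm{fr}_U(A)$ denotes the topological frontier of $A$ in $U$, and $\mathrm{in}(A)$ the interior of $A$ in $V$. $\langle A\rangle$ is the linear span of $A$. A $K$-structure on $V$ is a sub-$K$-vector space $W\subseteq V$ such that the canonical map $\mathbb{R}\otimes_K W\to V$ is an isomorphism. A subspace of $V$ is $W$-rational if it has a basis contained in $W$. A $W$-polycone is the intersection of finitely many closed linear halfspaces bounded by $W$-rational linear hyperplanes; it is sharp if it contains no line, and simplicial if it is the conic hull of a linearly independent set; its dimension is that of its linear span. A face of a $W$-polycone $\sigma$ is a set $\sigma\cap\ker(u)$ with $u\in V^*$, $u(\sigma)\subseteq\mathbb{R}_{\geq 0}$. A $W$-semifan is a finite set $\Sigma$ of $W$-polycones, closed under taking faces, such that $\sigma\cap\tau$ is a face of $\sigma$ for all $\sigma,\tau\in\Sigma$; it is a $W$-fan if all its elements are sharp. $|\Sigma|=\bigcup\Sigma$; $\Sigma$ is complete if $|\Sigma|=V$; $\Sigma_k$ is the set of $k$-dimensional elements of $\Sigma$; $\Sigma$ is equifulldimensional if $\Sigma_n\neq\emptyset$ and $\Sigma_n$ is the set of maximal elements of $\Sigma$ (with respect to the relation "is a face of"). A $W$-extension of $\Sigma$ is a $W$-semifan containing $\Sigma$;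 a $W$-completion of $\Sigma$ is a complete $W$-extension of $\Sigma$. Let $\Sigma$ be a $W$-fan. A $W$-polycone $\sigma$ is free over $\Sigma$ if $\sigma\cap\tau=\{0\}$ for every $\tau\in\Sigma$. A $W$-extension $\Sigma'$ of $\Sigma$ is relatively simplicial over $\Sigma$ if every cone in $\Sigma'$ that is free over $\Sigma$ is simplicial. A sum $\tau+\tau'$ of $W$-polycones is direct (written $\tau\oplus\tau'$) if the sum of subspaces $\langle\tau\rangle+\langle\tau'\rangle$ is direct. A $W$-polycone $\sigma$ is separable over $\Sigma$ if $\sigma=\tau\oplus\tau'$ with $\tau\in\Sigma\cup\{0\}$ (where $0$ denotes the zero cone) and $\tau'$ a $W$-polycone that is sharp and free over $\Sigma$; such a pair is unique, and one writes $\mathrm{ex}_\Sigma(\sigma)=\tau'$. A $W$-extension $\Sigma'$ of $\Sigma$ is separable over $\Sigma$ if all its cones are separable over $\Sigma$, and tightly separable if moreover $\mathrm{ex}_\Sigma(\sigma)\setminus\{0\}\subseteq\mathrm{fr}_{\langle|\Sigma'|\rangle}(|\Sigma'|)$ for every $\sigma\in\Sigma'$. A $W$-quasipacking of $\Sigma$ is a $W$-extension $\Sigma'$ of $\Sigma$ with $|\Sigma|\setminus\{0\}\subseteq\mathrm{in}(|\Sigma'|)$. A $W$-packing of $\Sigma$ is a relatively simplicial, tightly separable $W$-quasipacking $\Sigma'$ of $\Sigma$ such that $\Sigma'_1=\emptyset$ or $\Sigma'$ is equifulldimensional. A strong $W$-completion of $\Sigma$ is a pair $(\overline{\Sigma},\widehat{\Sigma})$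 such that $\overline{\Sigma}$ is a $W$-packing of $\Sigma$ and $\widehat{\Sigma}$ is a $W$-completion of $\overline{\Sigma}$ that is relatively simplicial over $\Sigma$. *)

theory Defs
  imports "HOL-Analysis.Analysis" "HOL-Algebra.Free_Abelian_Groups"
begin

text \<open>
  The finite-dimensional real vector space \<open>V\<close> is a linear subspace of a Euclidean space.
  Every finite-dimensional real vector space, including the zero space (which is not an
  instance of class \<^class>\<open>euclidean_space\<close>), is isomorphic to one of this kind.  Its canonical
  topology is the subspace topology \<open>top_of_set V\<close>.  Every linear form on \<open>V\<close> is the restriction
  of a linear form on the ambient space, so elements of the dual of \<open>V\<close> are represented by
  linear maps on the ambient type, of which only the values on \<open>V\<close> are used.
\<close>

section \<open>\<open>K\<close>-structures\<close>

definition real_subfield :: "real set \<Rightarrow> bool" where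
  "real_subfield K \<longleftrightarrow>
     0 \<in> K \<and> 1 \<in> K \<and>
     (\<forall>x\<in>K. \<forall>y\<in>K. x + y \<in> K \<and> x * y \<in> K) \<and>
     (\<forall>x\<in>K. - x \<in> K \<and> inverse x \<in> K)"

definition scalar_subspace :: "real set \<Rightarrow> 'a::real_vector set \<Rightarrow> bool" where
  "scalar_subspace K W \<longleftrightarrow>
     0 \<in> W \<and> (\<forall>x\<in>W. \<forall>y\<in>W. x + y \<in> W) \<and> (\<forall>k\<in>K. \<forall>x\<in>W. k *\<^sub>R x \<in> W)"

text \<open>
  The tensor product of \<open>\<real>\<close> and \<open>W\<close> over \<open>K\<close>, as the free abelian group on \<open>\<real> \<times> W\<close> modulo the
  subgroup generated by the bilinearity relations; the generator \<open>(r, w)\<close> represents the pure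
  tensor of \<open>r\<close> and \<open>w\<close>.
\<close>

definition tensor_relations :: "real set \<Rightarrow> 'a::real_vector set \<Rightarrow> (real \<times> 'a \<Rightarrow>\<^sub>0 int) set" where
  "tensor_relations K W =
     {frag_of (r + s, w) - frag_of (r, w) - frag_of (s, w) | r s w. w \<in> W} \<union>
     {frag_of (r, w + w') - frag_of (r, w) - frag_of (r, w') | r w w'. w \<in> W \<and> w' \<in> W} \<union>
     {frag_of (r * k, w) - frag_of (r, k *\<^sub>R w) | r k w. k \<in> K \<and> w \<in> W}"

definition real_tensor :: "real set \<Rightarrow> 'a::real_vector set \<Rightarrow> (real \<times> 'a \<Rightarrow>\<^sub>0 int) set monoid" where
  "real_tensor K W =
     free_Abelian_group (UNIV \<times> W) Mod
       generate (free_Abelian_group (UNIV \<times> W)) (tensor_relations K W)"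

definition tensor_eval :: "(real \<times> 'a::real_vector \<Rightarrow>\<^sub>0 int) \<Rightarrow> 'a" where
  "tensor_eval c =
     (\<Sum>p\<in>Poly_Mapping.keys c. (of_int (Poly_Mapping.lookup c p) * fst p) *\<^sub>R snd p)"

text \<open>
  The map induced by \<^const>\<open>tensor_eval\<close> on the quotient, sending the tensor of \<open>r\<close> and \<open>w\<close> to
  \<open>r *\<^sub>R w\<close>.  It is linear, hence an isomorphism iff it is bijective.
\<close>

definition tensor_canonical :: "(real \<times> 'a::real_vector \<Rightarrow>\<^sub>0 int) set \<Rightarrow> 'a" where
  "tensor_canonical C = the_elem (tensor_eval ` C)"

definition K_structure :: "real set \<Rightarrow> 'a::real_vector set \<Rightarrow> 'a set \<Rightarrow> bool" where
  "K_structure K V W \<longleftrightarrow>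
     W \<subseteq> V \<and> scalar_subspace K W \<and>
     bij_betw tensor_canonical (carrier (real_tensor K W)) V"

section \<open>Polycones\<close>

definition rational_subspace :: "'a::real_vector set \<Rightarrow> 'a set \<Rightarrow> bool" where
  "rational_subspace W U \<longleftrightarrow> (\<exists>B. B \<subseteq> W \<and> independent B \<and> span B = U)"

definition rational_hyperplane :: "'a::euclidean_space set \<Rightarrow> 'a set \<Rightarrow> 'a set \<Rightarrow> bool" where
  "rational_hyperplane V W H \<longleftrightarrow>
     subspace H \<and> H \<subseteq> V \<and> dim H + 1 = dim V \<and> rational_subspace W H"

definition rational_halfspace :: "'a::euclidean_space set \<Rightarrow> 'a set \<Rightarrow> 'a set \<Rightarrow> bool" where
  "rational_halfspace V W S \<longleftrightarrow>
     (\<exists>u :: 'a \<Rightarrow> real. linear u \<and> rational_hyperplane V W {x \<in> V. u x = 0} \<and>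
        S = {x \<in> V. 0 \<le> u x})"

text \<open>The empty intersection is \<open>V\<close>.\<close>

definition polycone :: "'a::euclidean_space set \<Rightarrow> 'a set \<Rightarrow> 'a set \<Rightarrow> bool" where
  "polycone V W \<sigma> \<longleftrightarrow>
     (\<exists>F. finite F \<and> (\<forall>S\<in>F. rational_halfspace V W S) \<and> \<sigma> = V \<inter> \<Inter>F)"

definition sharp :: "'a::euclidean_space set \<Rightarrow> bool" where
  "sharp \<sigma> \<longleftrightarrow> \<not> (\<exists>L. subspace L \<and> dim L = 1 \<and> L \<subseteq> \<sigma>)"

text \<open>
  The set of nonnegative linear combinations of \<open>B\<close> is \<open>convex_cone hull B\<close>, which is \<open>{0}\<close> for
  empty \<open>B\<close>; the library's \<open>conic hull B\<close> is not convex in general.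
\<close>

definition simplicial_cone :: "'a::euclidean_space set \<Rightarrow> bool" where
  "simplicial_cone \<sigma> \<longleftrightarrow> (\<exists>B. independent B \<and> \<sigma> = convex_cone hull B)"

definition cone_face :: "'a::euclidean_space set \<Rightarrow> 'a set \<Rightarrow> bool" where
  "cone_face \<tau> \<sigma> \<longleftrightarrow>
     (\<exists>u :: 'a \<Rightarrow> real. linear u \<and> (\<forall>x\<in>\<sigma>. 0 \<le> u x) \<and> \<tau> = {x \<in> \<sigma>. u x = 0})"

section \<open>Fans\<close>

definition semifan :: "'a::euclidean_space set \<Rightarrow> 'a set \<Rightarrow> 'a set set \<Rightarrow> bool" where
  "semifan V W \<Sigma> \<longleftrightarrow>
     finite \<Sigma> \<and> (\<forall>\<sigma>\<in>\<Sigma>. polycone V W \<sigma>) \<and>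
     (\<forall>\<sigma>\<in>\<Sigma>. \<forall>\<tau>. cone_face \<tau> \<sigma> \<longrightarrow> \<tau> \<in> \<Sigma>) \<and>
     (\<forall>\<sigma>\<in>\<Sigma>. \<forall>\<tau>\<in>\<Sigma>. cone_face (\<sigma> \<inter> \<tau>) \<sigma>)"

definition fan :: "'a::euclidean_space set \<Rightarrow> 'a set \<Rightarrow> 'a set set \<Rightarrow> bool" where
  "fan V W \<Sigma> \<longleftrightarrow> semifan V W \<Sigma> \<and> (\<forall>\<sigma>\<in>\<Sigma>. sharp \<sigma>)"

definition cones_of_dim :: "nat \<Rightarrow> 'a::euclidean_space set set \<Rightarrow> 'a set set" where
  "cones_of_dim k \<Sigma> = {\<sigma> \<in> \<Sigma>. dim \<sigma> = k}"

definition maximal_cones :: "'a::euclidean_space set set \<Rightarrow> 'a set set" where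
  "maximal_cones \<Sigma> = {\<sigma> \<in> \<Sigma>. \<forall>\<tau>\<in>\<Sigma>. cone_face \<sigma> \<tau> \<longrightarrow> \<tau> = \<sigma>}"

definition equifulldimensional :: "'a::euclidean_space set \<Rightarrow> 'a set set \<Rightarrow> bool" where
  "equifulldimensional V \<Sigma> \<longleftrightarrow>
     cones_of_dim (dim V) \<Sigma> \<noteq> {} \<and> cones_of_dim (dim V) \<Sigma> = maximal_cones \<Sigma>"

definition fan_extension ::
    "'a::euclidean_space set \<Rightarrow> 'a set \<Rightarrow> 'a set set \<Rightarrow> 'a set set \<Rightarrow> bool" where
  "fan_extension V W \<Sigma> \<Sigma>' \<longleftrightarrow> semifan V W \<Sigma>' \<and> \<Sigma> \<subseteq> \<Sigma>'"

definition fan_completion ::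
    "'a::euclidean_space set \<Rightarrow> 'a set \<Rightarrow> 'a set set \<Rightarrow> 'a set set \<Rightarrow> bool" where
  "fan_completion V W \<Sigma> \<Sigma>' \<longleftrightarrow> fan_extension V W \<Sigma> \<Sigma>' \<and> \<Union>\<Sigma>' = V"

definition free_over :: "'a::euclidean_space set set \<Rightarrow> 'a set \<Rightarrow> bool" where
  "free_over \<Sigma> \<sigma> \<longleftrightarrow> (\<forall>\<tau>\<in>\<Sigma>. \<sigma> \<inter> \<tau> = {0})"

definition relatively_simplicial :: "'a::euclidean_space set set \<Rightarrow> 'a set set \<Rightarrow> bool" where
  "relatively_simplicial \<Sigma> \<Sigma>' \<longleftrightarrow> (\<forall>\<sigma>\<in>\<Sigma>'. free_over \<Sigma> \<sigma> \<longrightarrow> simplicial_cone \<sigma>)"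

definition direct_sum_of :: "'a::euclidean_space set \<Rightarrow> 'a set \<Rightarrow> 'a set \<Rightarrow> bool" where
  "direct_sum_of \<sigma> \<tau> \<tau>' \<longleftrightarrow>
     \<sigma> = {x + y | x y. x \<in> \<tau> \<and> y \<in> \<tau>'} \<and> span \<tau> \<inter> span \<tau>' = {0}"

definition separation ::
    "'a::euclidean_space set \<Rightarrow> 'a set \<Rightarrow> 'a set set \<Rightarrow> 'a set \<Rightarrow> 'a set \<Rightarrow> 'a set \<Rightarrow> bool" where
  "separation V W \<Sigma> \<sigma> \<tau> \<tau>' \<longleftrightarrow>
     \<tau> \<in> \<Sigma> \<union> {{0}} \<and> polycone V W \<tau>' \<and> sharp \<tau>' \<and> free_over \<Sigma> \<tau>' \<and> direct_sum_of \<sigma> \<tau> \<tau>'"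

definition separable_cone ::
    "'a::euclidean_space set \<Rightarrow> 'a set \<Rightarrow> 'a set set \<Rightarrow> 'a set \<Rightarrow> bool" where
  "separable_cone V W \<Sigma> \<sigma> \<longleftrightarrow> (\<exists>\<tau> \<tau>'. separation V W \<Sigma> \<sigma> \<tau> \<tau>')"

text \<open>For a fan \<open>\<Sigma>\<close> and a cone separable over \<open>\<Sigma>\<close> the separation is unique.\<close>

definition ex_part ::
    "'a::euclidean_space set \<Rightarrow> 'a set \<Rightarrow> 'a set set \<Rightarrow> 'a set \<Rightarrow> 'a set" where
  "ex_part V W \<Sigma> \<sigma> = (THE \<tau>'. \<exists>\<tau>. separation V W \<Sigma> \<sigma> \<tau> \<tau>')"

definition separable_over ::
    "'a::euclidean_space set \<Rightarrow> 'a set \<Rightarrow> 'a set set \<Rightarrow> 'a set set \<Rightarrow> bool" where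
  "separable_over V W \<Sigma> \<Sigma>' \<longleftrightarrow> (\<forall>\<sigma>\<in>\<Sigma>'. separable_cone V W \<Sigma> \<sigma>)"

definition tightly_separable ::
    "'a::euclidean_space set \<Rightarrow> 'a set \<Rightarrow> 'a set set \<Rightarrow> 'a set set \<Rightarrow> bool" where
  "tightly_separable V W \<Sigma> \<Sigma>' \<longleftrightarrow>
     separable_over V W \<Sigma> \<Sigma>' \<and>
     (\<forall>\<sigma>\<in>\<Sigma>'. ex_part V W \<Sigma> \<sigma> - {0} \<subseteq> top_of_set (span (\<Union>\<Sigma>')) frontier_of (\<Union>\<Sigma>'))"

section \<open>Packings and strong completions\<close>

definition quasipacking ::
    "'a::euclidean_space set \<Rightarrow> 'a set \<Rightarrow> 'a set set \<Rightarrow> 'a set set \<Rightarrow> bool" where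
  "quasipacking V W \<Sigma> \<Sigma>' \<longleftrightarrow>
     fan_extension V W \<Sigma> \<Sigma>' \<and> \<Union>\<Sigma> - {0} \<subseteq> top_of_set V interior_of (\<Union>\<Sigma>')"

definition packing ::
    "'a::euclidean_space set \<Rightarrow> 'a set \<Rightarrow> 'a set set \<Rightarrow> 'a set set \<Rightarrow> bool" where
  "packing V W \<Sigma> \<Sigma>' \<longleftrightarrow>
     quasipacking V W \<Sigma> \<Sigma>' \<and> relatively_simplicial \<Sigma> \<Sigma>' \<and> tightly_separable V W \<Sigma> \<Sigma>' \<and>
     (cones_of_dim 1 \<Sigma>' = {} \<or> equifulldimensional V \<Sigma>')"

definition strong_completion ::
    "'a::euclidean_space set \<Rightarrow> 'a set \<Rightarrow> 'a set set \<Rightarrow> 'a set set \<times> 'a set set \<Rightarrow> bool" where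
  "strong_completion V W \<Sigma> P \<longleftrightarrow>
     packing V W \<Sigma> (fst P) \<and> fan_completion V W (fst P) (snd P) \<and>
     relatively_simplicial \<Sigma> (snd P)"

end

theory Submission
  imports Defs
begin

text \<open>
  Proof idea.  Fans are extended by joins \<open>\<kappa> + cone E\<close> of a cone \<open>\<kappa>\<close> of the fan with a simplicial
  cone spanned by new vectors.  To make a cone \<open>\<tau>\<close> interior, the cones containing it are
  projected along \<open>\<langle>\<tau>\<rangle>\<close> and completed there by induction on the codimension; each new vector
  \<open>f\<close> is then lifted to \<open>b + \<epsilon> f\<close> with \<open>b\<close> in the relative interior of \<open>\<tau>\<close>.  Modulo \<open>\<langle>\<tau>\<rangle>\<close> the
  lift changes nothing, so the lifted cells fit together; for small \<open>\<epsilon>\<close> a linear form that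
  separates a cone containing \<open>\<tau>\<close> from one that does not is positive on the lifted vectors, so
  the new cells meet the old ones only in old faces.  Doing this for every \<open>\<tau> \<noteq> 0\<close> gives a
  neighbourhood of the support.

  The complement of this neighbourhood is filled by the barycentric subdivision of the
  hyperplane arrangement generated by all the cells.  The arrangement subdivides the simplicial
  parts of the joins on the frontier, but a subdivision of \<open>cone E\<close> extends to \<open>\<kappa> + cone E\<close>
  without touching \<open>\<kappa>\<close>, so refining the joins accordingly repairs the mismatch.

  Instead of passing to the quotient by a subspace \<open>L\<close>, all cones are taken to contain \<open>L\<close>.
\<close>

section \<open>Cones and their faces\<close>

text \<open>Face lattices of the new cones are never examined directly. A point
  \<open>s + vs a\<close> of a join determines the pair \<open>(s, a)\<close>, uniformly over all
  cells, and this one uniqueness statement yields common faces, independence of \<open>E\<close>,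
  and separability with cone \<open>E\<close> as the free part. Two invariants travel with the
  joins. \<open>tight\<close> records for each nonempty \<open>E\<close> a direction that leaves the
  support along cone \<open>E\<close>; otherwise successive star completions could swallow points of
  cone \<open>E\<close>, and tight separability would fail. \<open>based\<close> keeps each nonempty
  \<open>E\<close> attached to a base cone larger than \<open>L\<close>, whose core points end up
  interior to the support; this gives equifulldimensionality. The complement is filled with
  simplices containing no interior point of the support. As the points of the fan outside
  \<open>L\<close> are interior, such a simplex meets a cell only over \<open>L\<close>, so no cone
  of the fan is subdivided. The parameter \<epsilon> has the form \<open>1 / real (Suc n)\<close>
  because it must become small and lie in every subfield of the reals.\<close>

lemma convex_coneI:
  assumes "0 \<in> S" "\<And>x y. x \<in> S \<Longrightarrow> y \<in> S \<Longrightarrow> x + y \<in> S"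
    "\<And>x c. x \<in> S \<Longrightarrow> 0 \<le> c \<Longrightarrow> c *\<^sub>R x \<in> S"
  shows "convex_cone S"
  using assms by (simp add: convex_cone_iff)

lemma convex_cone_hull_insert_iff:
  fixes g :: "'a::real_vector"
  shows "y \<in> convex_cone hull (insert g G) \<longleftrightarrow> (\<exists>t\<ge>0. y - t *\<^sub>R g \<in> convex_cone hull G)"
proof -
  let ?C = "{y. \<exists>t\<ge>0. y - t *\<^sub>R g \<in> convex_cone hull G}"
  have "convex_cone ?C"
  proof (rule convex_coneI)
    show "0 \<in> ?C" using convex_cone_hull_contains_0[of G] by force
  next
    fix x y assume "x \<in> ?C" "y \<in> ?C"
    then obtain s t where "s \<ge> 0" "t \<ge> 0" "x - s *\<^sub>R g \<in> convex_cone hull G" "y - t *\<^sub>R g \<in> convex_cone hull G"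
      by blast
    then have "(x - s *\<^sub>R g) + (y - t *\<^sub>R g) \<in> convex_cone hull G" "s + t \<ge> 0"
      using convex_cone_hull_add by auto
    moreover have "(x - s *\<^sub>R g) + (y - t *\<^sub>R g) = (x + y) - (s + t) *\<^sub>R g"
      by (simp add: algebra_simps)
    ultimately show "x + y \<in> ?C" by auto
  next
    fix x c assume "x \<in> ?C" and c: "0 \<le> (c::real)"
    then obtain s where "s \<ge> 0" "x - s *\<^sub>R g \<in> convex_cone hull G" by blast
    then have "c *\<^sub>R (x - s *\<^sub>R g) \<in> convex_cone hull G" "c * s \<ge> 0"
      using convex_cone_hull_mul c by auto
    then show "c *\<^sub>R x \<in> ?C" by (auto simp: algebra_simps)
  qed
  moreover have "insert g G \<subseteq> ?C"
  proof
    fix x assume "x \<in> insert g G"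
    then have "x - 1 *\<^sub>R g \<in> convex_cone hull G \<or> x - 0 *\<^sub>R g \<in> convex_cone hull G"
      by (auto simp: convex_cone_hull_contains_0 hull_inc)
    then show "x \<in> ?C" using zero_le_one by blast
  qed
  ultimately have "convex_cone hull (insert g G) \<subseteq> ?C"
    by (rule hull_minimal[rotated])
  moreover have "y \<in> convex_cone hull (insert g G)" if "t \<ge> 0" "y - t *\<^sub>R g \<in> convex_cone hull G" for t
  proof -
    have "y - t *\<^sub>R g \<in> convex_cone hull (insert g G)" "t *\<^sub>R g \<in> convex_cone hull (insert g G)"
      using subsetD[OF hull_mono[OF subset_insertI] that(2)]
        convex_cone_hull_mul[OF hull_inc[OF insertI1] that(1)] by simp_all
    from convex_cone_hull_add[OF this] show ?thesis by simp
  qed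
  ultimately show ?thesis by blast
qed

text \<open>For finitely generated cones, \<open>cface\<close> describes the exposed faces, and \<open>core b \<tau>\<close> says that
  \<open>b\<close> lies in the relative interior of \<open>\<tau>\<close>.\<close>

definition cface :: "'a::real_vector set \<Rightarrow> 'a set \<Rightarrow> bool" where
  "cface \<tau> \<sigma> \<longleftrightarrow> convex_cone \<tau> \<and> \<tau> \<subseteq> \<sigma> \<and> (\<forall>x\<in>\<sigma>. \<forall>y\<in>\<sigma>. x + y \<in> \<tau> \<longrightarrow> x \<in> \<tau>)"

definition core :: "'a::real_vector \<Rightarrow> 'a set \<Rightarrow> bool" where
  "core b \<tau> \<longleftrightarrow> b \<in> \<tau> \<and> (\<forall>z\<in>span \<tau>. \<exists>M\<ge>0. z + M *\<^sub>R b \<in> \<tau>)"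

text \<open>Nonnegative combinations are given by coefficient functions on the whole space, so that
  uniqueness of representations is an equality of functions.\<close>

definition coef :: "'a set \<Rightarrow> ('a \<Rightarrow> real) set" where
  "coef E = {a. (\<forall>v. 0 \<le> a v) \<and> (\<forall>v. v \<notin> E \<longrightarrow> a v = 0)}"

definition vs :: "('a::real_vector \<Rightarrow> real) \<Rightarrow> 'a" where
  "vs a = (\<Sum>v | a v \<noteq> 0. a v *\<^sub>R v)"

lemma vs_eq: "finite E \<Longrightarrow> (\<And>v. v \<notin> E \<Longrightarrow> a v = 0) \<Longrightarrow> vs a = (\<Sum>v\<in>E. a v *\<^sub>R v)"
  unfolding vs_def by (rule sum.mono_neutral_left) auto

lemma vs_coef: "finite E \<Longrightarrow> a \<in> coef E \<Longrightarrow> vs a = (\<Sum>v\<in>E. a v *\<^sub>R v)"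
  by (rule vs_eq) (auto simp: coef_def)

lemma vs_zero [simp]: "vs (\<lambda>v. 0) = 0"
  by (simp add: vs_def)

lemma vs_add:
  assumes "finite {v. a v \<noteq> 0}" "finite {v. c v \<noteq> 0}"
  shows "vs (\<lambda>v. a v + c v) = vs a + vs c"
proof -
  define E where "E = {v. a v \<noteq> 0} \<union> {v. c v \<noteq> 0}"
  have E: "finite E" "\<And>v. v \<notin> E \<Longrightarrow> a v = 0" "\<And>v. v \<notin> E \<Longrightarrow> c v = 0" using assms by (auto simp: E_def)
  have "vs (\<lambda>v. a v + c v) = (\<Sum>v\<in>E. (a v + c v) *\<^sub>R v)"
    by (rule vs_eq) (simp_all add: E)
  also have "\<dots> = (\<Sum>v\<in>E. a v *\<^sub>R v) + (\<Sum>v\<in>E. c v *\<^sub>R v)"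
    by (simp add: scaleR_add_left sum.distrib)
  also have "\<dots> = vs a + vs c"
    using vs_eq[OF E(1) E(2)] vs_eq[OF E(1) E(3)] by simp
  finally show ?thesis .
qed

lemma vs_scale:
  assumes "finite {v. a v \<noteq> 0}"
  shows "vs (\<lambda>v. t * a v) = t *\<^sub>R vs a"
proof -
  have "vs (\<lambda>v. t * a v) = (\<Sum>v | a v \<noteq> 0. (t * a v) *\<^sub>R v)"
    by (rule vs_eq) (use assms in auto)
  then show ?thesis by (simp add: vs_def scaleR_sum_right)
qed

lemma coef_finite: "finite E \<Longrightarrow> a \<in> coef E \<Longrightarrow> finite {v. a v \<noteq> 0}"
  by (rule finite_subset[of _ E]) (auto simp: coef_def)

lemma coef_nonneg: "a \<in> coef E \<Longrightarrow> 0 \<le> a v"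
  by (simp add: coef_def)

lemma coef_outside: "a \<in> coef E \<Longrightarrow> v \<notin> E \<Longrightarrow> a v = 0"
  by (simp add: coef_def)

lemma coef_mono: "E \<subseteq> F \<Longrightarrow> coef E \<subseteq> coef F"
  by (auto simp: coef_def)

lemma coef_Int: "a \<in> coef E \<Longrightarrow> a \<in> coef F \<Longrightarrow> a \<in> coef (E \<inter> F)"
  by (auto simp: coef_def)

lemma coef_zero [simp]: "(\<lambda>v. 0) \<in> coef E"
  by (simp add: coef_def)

lemma coef_empty: "a \<in> coef {} \<Longrightarrow> a = (\<lambda>v. 0)"
  by (auto simp: coef_def)

lemma coef_add: "a \<in> coef E \<Longrightarrow> c \<in> coef E \<Longrightarrow> (\<lambda>v. a v + c v) \<in> coef E"
  by (auto simp: coef_def)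

lemma coef_scale: "a \<in> coef E \<Longrightarrow> 0 \<le> t \<Longrightarrow> (\<lambda>v. t * a v) \<in> coef E"
  by (auto simp: coef_def)

definition ucoef :: "'a \<Rightarrow> 'a \<Rightarrow> real" where
  "ucoef e = (\<lambda>v. if v = e then 1 else 0)"

lemma ucoef_in: "e \<in> E \<Longrightarrow> ucoef e \<in> coef E"
  by (auto simp: coef_def ucoef_def)

lemma vs_ucoef [simp]: "vs (ucoef e) = e"
  using vs_eq[of "{e}" "ucoef e"] by (auto simp: ucoef_def)

lemma vs_mem_convex_cone:
  assumes "convex_cone C" "E \<subseteq> C" "finite E" "a \<in> coef E"
  shows "vs a \<in> C"
proof -
  have "(\<Sum>v\<in>F. a v *\<^sub>R v) \<in> C" if "finite F" "F \<subseteq> E" for F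
    using that
  proof (induction F rule: finite_induct)
    case empty
    then show ?case by (simp add: convex_cone_contains_0 assms(1))
  next
    case (insert x F)
    then show ?case using assms
      by (auto intro!: convex_cone_add convex_cone_scaleR simp: coef_def)
  qed
  then show ?thesis using vs_coef[OF assms(3,4)] assms(3) by simp
qed

lemma convex_cone_hull_finite:
  assumes "finite E"
  shows "convex_cone hull E = vs ` coef E"
proof
  have "convex_cone (vs ` coef E)"
  proof (rule convex_coneI)
    show "0 \<in> vs ` coef E" by (rule image_eqI[of _ _ "\<lambda>v. 0"]) auto
  next
    fix x y assume "x \<in> vs ` coef E" "y \<in> vs ` coef E"
    then obtain a c where "a \<in> coef E" "c \<in> coef E" "x = vs a" "y = vs c" by blast
    then have "x + y = vs (\<lambda>v. a v + c v)" "(\<lambda>v. a v + c v) \<in> coef E"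
      using coef_finite[OF assms] by (simp_all add: vs_add coef_add)
    then show "x + y \<in> vs ` coef E" by (rule image_eqI)
  next
    fix x t assume "x \<in> vs ` coef E" "0 \<le> (t::real)"
    then obtain a where "a \<in> coef E" "x = vs a" by blast
    then have "t *\<^sub>R x = vs (\<lambda>v. t * a v)" "(\<lambda>v. t * a v) \<in> coef E"
      using coef_finite[OF assms] \<open>0 \<le> t\<close> by (simp_all add: vs_scale coef_scale)
    then show "t *\<^sub>R x \<in> vs ` coef E" by (rule image_eqI)
  qed
  moreover have "E \<subseteq> vs ` coef E"
  proof
    fix e assume "e \<in> E"
    then show "e \<in> vs ` coef E" by (intro image_eqI[of _ _ "ucoef e"] ucoef_in) simp_all
  qed
  ultimately show "convex_cone hull E \<subseteq> vs ` coef E"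
    by (rule hull_minimal[rotated])
  show "vs ` coef E \<subseteq> convex_cone hull E"
    using vs_mem_convex_cone[OF convex_cone_convex_cone_hull hull_subset assms] by blast
qed

lemma cface_convex_cone: "cface \<tau> \<sigma> \<Longrightarrow> convex_cone \<tau>"
  by (simp add: cface_def)

lemma cface_subset: "cface \<tau> \<sigma> \<Longrightarrow> \<tau> \<subseteq> \<sigma>"
  by (simp add: cface_def)

lemma cface_left: "cface \<tau> \<sigma> \<Longrightarrow> x \<in> \<sigma> \<Longrightarrow> y \<in> \<sigma> \<Longrightarrow> x + y \<in> \<tau> \<Longrightarrow> x \<in> \<tau>"
  by (auto simp: cface_def)

lemma cface_right: "cface \<tau> \<sigma> \<Longrightarrow> x \<in> \<sigma> \<Longrightarrow> y \<in> \<sigma> \<Longrightarrow> x + y \<in> \<tau> \<Longrightarrow> y \<in> \<tau>"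
  by (metis add.commute cface_left)

lemma cface_refl: "convex_cone \<sigma> \<Longrightarrow> cface \<sigma> \<sigma>"
  by (simp add: cface_def)

lemma convex_cone_Int: "convex_cone A \<Longrightarrow> convex_cone C \<Longrightarrow> convex_cone (A \<inter> C)"
  by (auto simp: convex_cone_iff)

lemma cface_trans: "cface \<rho> \<tau> \<Longrightarrow> cface \<tau> \<sigma> \<Longrightarrow> cface \<rho> \<sigma>"
proof -
  assume a: "cface \<rho> \<tau>" "cface \<tau> \<sigma>"
  have "x \<in> \<rho>" if "x \<in> \<sigma>" "y \<in> \<sigma>" "x + y \<in> \<rho>" for x y
  proof -
    have "x + y \<in> \<tau>" using that a cface_subset by blast
    then have "x \<in> \<tau>" "y \<in> \<tau>" using cface_left[OF a(2)] cface_right[OF a(2)] that by blast+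
    then show ?thesis using cface_left[OF a(1)] that by blast
  qed
  then show ?thesis using a by (auto simp: cface_def)
qed

lemma cface_pos:
  assumes "cface \<tau> \<sigma>" "x \<in> \<sigma>" "c *\<^sub>R x \<in> \<tau>" "0 < c"
  shows "x \<in> \<tau>"
  using convex_cone_scaleR[OF cface_convex_cone[OF assms(1)], of "inverse c" "c *\<^sub>R x"] assms by simp

text \<open>For \<open>x\<close> in \<rho> the core property gives \<open>M\<close> with
  \<open>M *\<^sub>R b - x\<close> in \<rho>, so a multiple of \<open>b\<close> is the sum of
  \<open>x\<close> and another element of \<sigma>, and the face property applies to
  \<open>x\<close>. In this way a single relative interior point decides incidence of a whole
  cone.\<close>

lemma cface_core_subset:
  assumes "cface \<tau> \<sigma>" "core b \<rho>" "b \<in> \<tau>" "\<rho> \<subseteq> \<sigma>" "convex_cone \<rho>"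
  shows "\<rho> \<subseteq> \<tau>"
proof
  fix x assume x: "x \<in> \<rho>"
  then have "- x \<in> span \<rho>" by (simp add: span_base span_neg)
  then obtain M where M: "M \<ge> 0" "- x + M *\<^sub>R b \<in> \<rho>"
    using assms(2) unfolding core_def by blast
  have "x + (- x + M *\<^sub>R b) = M *\<^sub>R b" by simp
  also have "\<dots> \<in> \<tau>" using assms M cface_convex_cone convex_cone_scaleR by blast
  finally show "x \<in> \<tau>" using cface_left[OF assms(1)] x M assms(4) by blast
qed

text \<open>Taking out one term \<open>a v *\<^sub>R v\<close> leaves a combination that is still in
  \<sigma>, so the face property can be applied to each generator separately.\<close>

lemma cface_vs:
  assumes "cface \<tau> \<sigma>" "convex_cone \<sigma>" "finite E" "E \<subseteq> \<sigma>" "a \<in> coef E" "s \<in> \<sigma>" "s + vs a \<in> \<tau>"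
  shows "s \<in> \<tau>" "a \<in> coef (E \<inter> \<tau>)"
proof -
  have va: "vs a \<in> \<sigma>" using vs_mem_convex_cone assms by blast
  show "s \<in> \<tau>" using cface_left[OF assms(1,6) va assms(7)] .
  have vt: "vs a \<in> \<tau>" using cface_right[OF assms(1,6) va assms(7)] .
  have "v \<in> \<tau>" if v: "v \<in> E" "a v \<noteq> 0" for v
  proof -
    let ?c = "\<lambda>w. if w = v then 0 else a w"
    have "?c \<in> coef E" using assms(5) by (auto simp: coef_def)
    then have c: "vs ?c \<in> \<sigma>" "vs ?c = (\<Sum>w\<in>E. ?c w *\<^sub>R w)"
      using vs_mem_convex_cone assms vs_coef by blast+
    have "vs a = (\<Sum>w\<in>E. a w *\<^sub>R w)" using vs_coef assms by blast
    also have "\<dots> = a v *\<^sub>R v + (\<Sum>w\<in>E-{v}. a w *\<^sub>R w)" using v assms(3) by (simp add: sum.remove)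
    also have "(\<Sum>w\<in>E-{v}. a w *\<^sub>R w) = vs ?c"
      unfolding c(2) by (rule sum.mono_neutral_cong_left) (auto simp: assms(3))
    finally have "a v *\<^sub>R v + vs ?c \<in> \<tau>" using vt by simp
    moreover have "a v *\<^sub>R v \<in> \<sigma>" "0 < a v"
      using v assms coef_nonneg[OF assms(5), of v] by (auto intro: convex_cone_scaleR)
    ultimately show ?thesis using cface_left[OF assms(1) _ c(1)] cface_pos[OF assms(1)] v(1) assms(4)
      by blast
  qed
  then show "a \<in> coef (E \<inter> \<tau>)" using assms(5) by (auto simp: coef_def)
qed

lemma cface_hull:
  assumes "finite G" "cface \<tau> (convex_cone hull G)"
  shows "\<tau> = convex_cone hull (G \<inter> \<tau>)"
proof
  show "convex_cone hull (G \<inter> \<tau>) \<subseteq> \<tau>"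
    by (rule hull_minimal) (auto simp: cface_convex_cone[OF assms(2)])
  show "\<tau> \<subseteq> convex_cone hull (G \<inter> \<tau>)"
  proof
    fix x assume x: "x \<in> \<tau>"
    then obtain a where a: "a \<in> coef G" "x = vs a"
      using cface_subset[OF assms(2)] convex_cone_hull_finite[OF assms(1)] by blast
    have "a \<in> coef (G \<inter> \<tau>)"
      by (rule cface_vs(2)[OF assms(2) convex_cone_convex_cone_hull assms(1) hull_subset a(1), of 0])
        (use a x in \<open>auto simp: convex_cone_hull_contains_0\<close>)
    then show "x \<in> convex_cone hull (G \<inter> \<tau>)"
      using a assms(1) by (simp add: convex_cone_hull_finite)
  qed
qed

lemma convex_cone_span_diff:
  assumes "convex_cone \<tau>" "z \<in> span \<tau>"
  shows "\<exists>x\<in>\<tau>. \<exists>y\<in>\<tau>. z = x - y"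
proof -
  let ?S = "{x - y | x y. x \<in> \<tau> \<and> y \<in> \<tau>}"
  have "subspace ?S"
    unfolding subspace_def
  proof (intro conjI ballI allI)
    show "0 \<in> ?S" using convex_cone_contains_0[OF assms(1)] by force
  next
    fix a c assume "a \<in> ?S" "c \<in> ?S"
    then obtain x y x' y' where *: "a = x - y" "c = x' - y'" "x \<in> \<tau>" "y \<in> \<tau>" "x' \<in> \<tau>" "y' \<in> \<tau>" by blast
    then have "a + c = (x + x') - (y + y')" "x + x' \<in> \<tau>" "y + y' \<in> \<tau>"
      using convex_cone_add[OF assms(1)] by auto
    then show "a + c \<in> ?S" by blast
  next
    fix c a assume "a \<in> ?S"
    then obtain x y where *: "a = x - y" "x \<in> \<tau>" "y \<in> \<tau>" by blast
    show "c *\<^sub>R a \<in> ?S"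
    proof (cases "c \<ge> 0")
      case True
      then have "c *\<^sub>R a = c *\<^sub>R x - c *\<^sub>R y" "c *\<^sub>R x \<in> \<tau>" "c *\<^sub>R y \<in> \<tau>"
        using * convex_cone_scaleR[OF assms(1)] by (auto simp: algebra_simps)
      then show ?thesis by blast
    next
      case False
      then have c: "0 \<le> - c" by simp
      have "c *\<^sub>R a = (-c) *\<^sub>R y - (-c) *\<^sub>R x" by (simp add: * algebra_simps)
      then show ?thesis using convex_cone_scaleR[OF assms(1) c] *(2,3) by blast
    qed
  qed
  moreover have "\<tau> \<subseteq> ?S"
  proof
    fix x assume "x \<in> \<tau>"
    then show "x \<in> ?S" using convex_cone_contains_0[OF assms(1)] by (metis (mono_tags, lifting) diff_zero mem_Collect_eq)
  qed
  ultimately have "span \<tau> \<subseteq> ?S" by (rule span_minimal[rotated])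
  then show ?thesis using assms(2) by blast
qed

text \<open>The span of a convex cone consists of differences \<open>x - y\<close>, and only the
  subtracted part \<open>y\<close> has to be compensated by a multiple of \<open>b\<close>.\<close>

lemma coreI:
  assumes "convex_cone \<tau>" "b \<in> \<tau>" "\<And>z. z \<in> \<tau> \<Longrightarrow> \<exists>M\<ge>0. M *\<^sub>R b - z \<in> \<tau>"
  shows "core b \<tau>"
  unfolding core_def
proof (intro conjI ballI)
  fix z assume "z \<in> span \<tau>"
  then obtain x y where "x \<in> \<tau>" "y \<in> \<tau>" "z = x - y" using convex_cone_span_diff[OF assms(1)] by blast
  moreover obtain M where "M \<ge> 0" "M *\<^sub>R b - y \<in> \<tau>" using assms(3) \<open>y \<in> \<tau>\<close> by blast
  moreover from calculation have "x + (M *\<^sub>R b - y) \<in> \<tau>" using convex_cone_add[OF assms(1)] by blast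
  moreover have "z + M *\<^sub>R b = x + (M *\<^sub>R b - y)" using \<open>z = x - y\<close> by simp
  ultimately have "z + M *\<^sub>R b \<in> \<tau>" by metis
  then show "\<exists>M\<ge>0. z + M *\<^sub>R b \<in> \<tau>" using \<open>M \<ge> 0\<close> by blast
qed (fact assms(2))

lemma core_sum_hull:
  assumes "finite G"
  shows "core (\<Sum>g\<in>G. g) (convex_cone hull G)"
proof (rule coreI)
  let ?C = "convex_cone hull G"
  show "convex_cone ?C" by (rule convex_cone_convex_cone_hull)
  have sm: "(\<Sum>g\<in>G. c g *\<^sub>R g) \<in> ?C" if "\<And>g. g \<in> G \<Longrightarrow> 0 \<le> c g" for c
  proof -
    have "(\<lambda>g. if g \<in> G then c g else 0) \<in> coef G" using that by (auto simp: coef_def)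
    moreover from vs_coef[OF assms this]
    have "(\<Sum>g\<in>G. c g *\<^sub>R g) = vs (\<lambda>g. if g \<in> G then c g else 0)" by simp
    ultimately show ?thesis unfolding convex_cone_hull_finite[OF assms] by (simp add: image_eqI)
  qed
  from sm[of "\<lambda>_. 1"] show "(\<Sum>g\<in>G. g) \<in> ?C" by simp
  fix z assume "z \<in> ?C"
  then obtain a where a: "a \<in> coef G" "z = vs a" unfolding convex_cone_hull_finite[OF assms] by blast
  \<comment> \<open>The sum of all coefficients bounds each of them, so \<open>?M\<close> times the
    sum of \<open>G\<close> minus \<open>z\<close> has nonnegative coefficients.\<close>
  let ?M = "\<Sum>g\<in>G. a g"
  have le: "a g \<le> ?M" if "g \<in> G" for g
    using that assms coef_nonneg[OF a(1)] by (simp add: member_le_sum)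
  have "?M *\<^sub>R (\<Sum>g\<in>G. g) - z = (\<Sum>g\<in>G. (?M - a g) *\<^sub>R g)"
    using vs_coef[OF assms a(1)] a(2) by (simp add: scaleR_sum_right scaleR_left_diff_distrib sum_subtractf)
  also have "\<dots> \<in> ?C" by (rule sm) (use le in auto)
  finally show "\<exists>M\<ge>0. M *\<^sub>R (\<Sum>g\<in>G. g) - z \<in> ?C"
    using sum_nonneg[of G a] coef_nonneg[OF a(1)] by blast
qed

lemma exists_core_face:
  assumes "convex_cone \<sigma>" "x \<in> \<sigma>"
  shows "\<exists>\<tau>. cface \<tau> \<sigma> \<and> core x \<tau>"
proof -
  \<comment> \<open>The smallest face through \<open>x\<close>: the elements of \<sigma> dominated
    by a multiple of \<open>x\<close>.\<close>
  let ?T = "{z\<in>\<sigma>. \<exists>M\<ge>0. M *\<^sub>R x - z \<in> \<sigma>}"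
  have T: "convex_cone ?T"
  proof (rule convex_coneI)
    show "0 \<in> ?T" using convex_cone_contains_0[OF assms(1)] by (auto intro: exI[of _ 0])
  next
    fix y z assume yz: "y \<in> ?T" "z \<in> ?T"
    then obtain M N where "M \<ge> 0" "N \<ge> 0" "M *\<^sub>R x - y \<in> \<sigma>" "N *\<^sub>R x - z \<in> \<sigma>" by blast
    then have "M + N \<ge> 0" "(M + N) *\<^sub>R x - (y + z) \<in> \<sigma>"
      using convex_cone_add[OF assms(1), of "M *\<^sub>R x - y" "N *\<^sub>R x - z"] by (auto simp: algebra_simps)
    then show "y + z \<in> ?T" using yz convex_cone_add[OF assms(1)] by blast
  next
    fix y c assume y: "y \<in> ?T" and c: "0 \<le> (c::real)"
    then obtain M where "M \<ge> 0" "M *\<^sub>R x - y \<in> \<sigma>" by blast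
    then have "c * M \<ge> 0" "(c * M) *\<^sub>R x - c *\<^sub>R y \<in> \<sigma>"
      using convex_cone_scaleR[OF assms(1) c, of "M *\<^sub>R x - y"] c by (auto simp: algebra_simps)
    then show "c *\<^sub>R y \<in> ?T" using y c convex_cone_scaleR[OF assms(1)] by blast
  qed
  have "cface ?T \<sigma>"
    unfolding cface_def
  proof (intro conjI T ballI impI)
    fix y z assume yz: "y \<in> \<sigma>" "z \<in> \<sigma>" "y + z \<in> ?T"
    then obtain M where M: "M \<ge> 0" "M *\<^sub>R x - (y + z) \<in> \<sigma>" by blast
    then have "M *\<^sub>R x - y \<in> \<sigma>" using convex_cone_add[OF assms(1) yz(2) M(2)] by (simp add: algebra_simps)
    then show "y \<in> ?T" using yz M by blast
  qed auto
  moreover have "core x ?T"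
  proof (rule coreI[OF T])
    show "x \<in> ?T" using assms convex_cone_contains_0[OF assms(1)] by (auto intro!: exI[of _ 1])
    fix z assume z: "z \<in> ?T"
    then obtain M where M: "M \<ge> 0" "M *\<^sub>R x - z \<in> \<sigma>" by blast
    have "M *\<^sub>R x - (M *\<^sub>R x - z) \<in> \<sigma>" using z by simp
    then show "\<exists>M\<ge>0. M *\<^sub>R x - z \<in> ?T" using M by blast
  qed
  ultimately show ?thesis by blast
qed

section \<open>Rational polyhedral cones\<close>

text \<open>A basis \<open>B\<close> stands in for the K-structure: its real span is
  \<open>V\<close> and its K-span is \<open>W\<close>. \<open>K_structure_basis\<close> shows that
  every K-structure arises in this way.\<close>

locale rational_space =
  fixes K :: "real set" and B :: "'a::euclidean_space set"
  assumes K: "real_subfield K" and B: "independent B"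
begin

definition V :: "'a set" where "V = span B"

definition W :: "'a set" where "W = {x \<in> V. \<forall>b. representation B x b \<in> K}"

text \<open>Forms defined over K. Every rational halfspace is given by one of them
  (\<open>rational_halfspace_rform\<close>), and their values on \<open>W\<close> stay in K, which
  keeps both elimination procedures below rational.\<close>

definition rform :: "('a \<Rightarrow> real) \<Rightarrow> bool" where
  "rform u \<longleftrightarrow> linear u \<and> (\<forall>w\<in>W. u w \<in> K)"

lemma subspace_V: "subspace V"
  by (simp add: V_def)

lemma K_rules:
  "0 \<in> K" "1 \<in> K" "x \<in> K \<Longrightarrow> y \<in> K \<Longrightarrow> x + y \<in> K" "x \<in> K \<Longrightarrow> y \<in> K \<Longrightarrow> x * y \<in> K"
  "x \<in> K \<Longrightarrow> - x \<in> K" "x \<in> K \<Longrightarrow> inverse x \<in> K" "x \<in> K \<Longrightarrow> y \<in> K \<Longrightarrow> x - y \<in> K"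
  using K unfolding real_subfield_def by (blast | metis diff_conv_add_uminus)+

lemma K_of_nat: "of_nat n \<in> K"
  by (induction n) (auto intro: K_rules)

lemma W_subset_V: "W \<subseteq> V"
  by (auto simp: W_def)

lemma W_0: "0 \<in> W"
  by (simp add: W_def V_def representation_zero span_zero K_rules)

lemma W_add: "x \<in> W \<Longrightarrow> y \<in> W \<Longrightarrow> x + y \<in> W"
  by (auto simp: W_def V_def representation_add[OF B] span_add intro: K_rules)

lemma W_scale: "x \<in> W \<Longrightarrow> k \<in> K \<Longrightarrow> k *\<^sub>R x \<in> W"
  by (auto simp: W_def V_def representation_scale[OF B] span_scale intro: K_rules)

lemma W_minus: "x \<in> W \<Longrightarrow> - x \<in> W"
  using W_scale[of x "-1"] K_rules by auto

lemma W_diff: "x \<in> W \<Longrightarrow> y \<in> W \<Longrightarrow> x - y \<in> W"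
  using W_add[OF _ W_minus] by auto

lemma W_sum: "(\<And>x. x \<in> A \<Longrightarrow> f x \<in> W) \<Longrightarrow> sum f A \<in> W"
  by (induction A rule: infinite_finite_induct) (auto intro: W_0 W_add)

lemma B_subset_W: "B \<subseteq> W"
  by (auto simp: W_def V_def span_base representation_basis[OF B] K_rules)

lemma rform_linear: "rform u \<Longrightarrow> linear u"
  by (simp add: rform_def)

lemma rform_K: "rform u \<Longrightarrow> w \<in> W \<Longrightarrow> u w \<in> K"
  by (simp add: rform_def)

lemma rform_minus: "rform u \<Longrightarrow> rform (\<lambda>x. - u x)"
  by (auto simp: rform_def intro: linear_compose_neg K_rules)

lemma rform_comb:
  assumes "rform u" "rform v" "k \<in> K" "l \<in> K"
  shows "rform (\<lambda>x. k * u x - l * v x)"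
proof -
  have "linear (\<lambda>x. k *\<^sub>R u x - l *\<^sub>R v x)"
    using assms by (intro linear_compose_sub linear_compose_scale_right) (auto simp: rform_def)
  then show ?thesis using assms by (auto simp: rform_def intro!: K_rules)
qed

lemma exists_coordinates:
  "\<exists>c. \<forall>b\<in>B. rform (c b) \<and> (\<forall>x\<in>V. c b x = representation B x b)"
proof -
  have "\<exists>u. rform u \<and> (\<forall>x\<in>V. u x = representation B x b)" if b: "b \<in> B" for b
  proof -
    obtain u where u: "linear u" "\<forall>x\<in>B. u x = (if x = b then 1 else 0::real)"
      using linear_independent_extend[OF B, of "\<lambda>x. if x = b then 1 else 0::real"] by blast
    have eq: "u x = representation B x b" if x: "x \<in> V" for x
    proof -
      have fin: "finite B" by (rule finiteI_independent[OF B])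
      have "u x = u (\<Sum>c\<in>B. representation B x c *\<^sub>R c)"
        using sum_representation_eq[OF B _ fin order_refl] x by (simp add: V_def)
      also have "\<dots> = (\<Sum>c\<in>B. representation B x c * (if c = b then 1 else 0))"
        using u by (simp add: linear_sum[OF u(1)] linear_scale[OF u(1)])
      also have "\<dots> = (\<Sum>c\<in>B. if c = b then representation B x c else 0)"
        by (rule sum.cong) auto
      also have "\<dots> = representation B x b"
        using b fin by (simp add: sum.delta)
      finally show ?thesis .
    qed
    then have "rform u" using u(1) by (auto simp: rform_def W_def)
    then show ?thesis using eq by blast
  qed
  then show ?thesis by metis
qed

section \<open>Equivalence of generators and inequalities over K\<close>

definition hcone :: "('a \<Rightarrow> real) set \<Rightarrow> 'a set" where
  "hcone U = {x \<in> V. \<forall>u\<in>U. 0 \<le> u x}"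

lemma hconeI: "x \<in> V \<Longrightarrow> (\<And>u. u \<in> U \<Longrightarrow> 0 \<le> u x) \<Longrightarrow> x \<in> hcone U"
  by (simp add: hcone_def)

lemma hconeD: "x \<in> hcone U \<Longrightarrow> u \<in> U \<Longrightarrow> 0 \<le> u x" "x \<in> hcone U \<Longrightarrow> x \<in> V"
  by (simp_all add: hcone_def)

lemma hcone_zero: "\<exists>U. finite U \<and> (\<forall>u\<in>U. rform u) \<and> hcone U = {0}"
proof -
  obtain c where c: "\<And>b. b \<in> B \<Longrightarrow> rform (c b)" "\<And>b x. b \<in> B \<Longrightarrow> x \<in> V \<Longrightarrow> c b x = representation B x b"
    using exists_coordinates by metis
  have fin: "finite B" by (rule finiteI_independent[OF B])
  let ?U = "c ` B \<union> (\<lambda>b x. - c b x) ` B"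
  have "hcone ?U \<subseteq> {0}"
  proof
    fix x assume x: "x \<in> hcone ?U"
    then have xV: "x \<in> span B" by (simp add: hcone_def V_def)
    have "representation B x b = 0" if "b \<in> B" for b
    proof -
      note all = hconeD(1)[OF x]
      have "c b \<in> ?U" "(\<lambda>x. - c b x) \<in> ?U" using that by auto
      from this[THEN all] have "0 \<le> c b x" "0 \<le> - c b x" by simp_all
      then show ?thesis using c(2)[OF that, of x] xV by (simp add: V_def)
    qed
    then have "x = 0"
      using sum_representation_eq[OF B xV fin order_refl] by simp
    then show "x \<in> {0}" by simp
  qed
  moreover have "0 \<in> hcone ?U"
    using c(1) by (auto simp: hcone_def subspace_0[OF subspace_V] rform_def linear_0)
  moreover have "finite ?U" "\<forall>u\<in>?U. rform u" using fin c(1) rform_minus by auto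
  ultimately show ?thesis by blast
qed

text \<open>Fourier-Motzkin elimination of the coefficient of the new generator.\<close>

lemma finitely_generated_imp_hcone:
  assumes "finite G" "G \<subseteq> W"
  shows "\<exists>U. finite U \<and> (\<forall>u\<in>U. rform u) \<and> convex_cone hull G = hcone U"
  using assms
proof (induction G rule: finite_induct)
  case empty
  then show ?case using hcone_zero convex_cone_hull_empty by metis
next
  case (insert g G)
  then obtain U where U: "finite U" "\<forall>u\<in>U. rform u" "convex_cone hull G = hcone U" by auto
  define N where "N = {u\<in>U. u g \<ge> 0} \<union>
    (\<lambda>(p, m). \<lambda>x. p g * m x - m g * p x) ` ({u\<in>U. u g > 0} \<times> {u\<in>U. u g < 0})"
  have gW: "g \<in> W" "g \<in> V" using insert.prems W_subset_V by auto
  have lin: "u (x - t *\<^sub>R g) = u x - t * u g" if "u \<in> U" for u x t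
    using U(2) that by (simp add: rform_def linear_diff linear_scale)
  have "x \<in> convex_cone hull (insert g G) \<longleftrightarrow> x \<in> hcone N" for x
  proof
    assume "x \<in> convex_cone hull (insert g G)"
    then obtain t where t: "t \<ge> 0" "x - t *\<^sub>R g \<in> hcone U"
      unfolding convex_cone_hull_insert_iff U(3) by blast
    then have xV: "x \<in> V" using gW(2) subspace_V
      by (metis (no_types, lifting) hcone_def mem_Collect_eq diff_add_cancel subspace_add subspace_mul)
    have ge: "u x \<ge> t * u g" if "u \<in> U" for u
      using t(2) lin[OF that] that by (auto simp: hcone_def)
    have "0 \<le> p g * m x - m g * p x" if "p \<in> U" "m \<in> U" "p g > 0" "m g < 0" for p m
    proof -
      have "p g * m x \<ge> p g * (t * m g)" using ge[OF that(2)] that(3) by (simp add: mult_left_mono)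
      moreover have "m g * p x \<le> m g * (t * p g)" using ge[OF that(1)] that(4) by (simp add: mult_left_mono_neg)
      ultimately show ?thesis by (simp add: algebra_simps)
    qed
    moreover have "0 \<le> u x" if "u \<in> U" "u g \<ge> 0" for u
      using ge[OF that(1)] that t(1) by (meson mult_nonneg_nonneg order_trans)
    ultimately show "x \<in> hcone N" using xV by (auto simp: hcone_def N_def)
  next
    assume x: "x \<in> hcone N"
    then have xV: "x \<in> V" and pos: "\<And>u. u \<in> U \<Longrightarrow> u g \<ge> 0 \<Longrightarrow> 0 \<le> u x"
      and comb: "\<And>p m. p \<in> U \<Longrightarrow> m \<in> U \<Longrightarrow> p g > 0 \<Longrightarrow> m g < 0 \<Longrightarrow> 0 \<le> p g * m x - m g * p x"
      unfolding hcone_def N_def by fastforce+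
    \<comment> \<open>The required \<open>t\<close> must satisfy \<open>t \<ge> 0\<close> and
      \<open>t \<ge> m x / m g\<close> for each form \<open>m\<close> negative at \<open>g\<close>.
      The maximum of these bounds is the least admissible value; the combined inequalities in
      \<open>N\<close> say that it respects the upper bounds coming from forms positive at
      \<open>g\<close>.\<close>
    define M where "M = insert 0 ((\<lambda>m. m x / m g) ` {u\<in>U. u g < 0})"
    have M: "finite M" "M \<noteq> {}" using U(1) by (auto simp: M_def)
    let ?t = "Max M"
    have t0: "?t \<ge> 0" using M by (auto simp: M_def)
    have "?t * u g \<le> u x" if u: "u \<in> U" for u
    proof (cases "u g" "0::real" rule: linorder_cases)
      case less
      then have "u x / u g \<le> ?t" using u M by (auto simp: M_def)
      then show ?thesis using less by (simp add: neg_divide_le_eq)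
    next
      case equal
      then show ?thesis using pos[OF u] by simp
    next
      case greater
      have "?t \<in> M" using M by (rule Max_in)
      then consider "?t = 0" | m where "m \<in> U" "m g < 0" "?t = m x / m g" by (auto simp: M_def)
      then show ?thesis
      proof cases
        case 1
        then show ?thesis using pos[OF u] greater by simp
      next
        case 2
        have "u g * m x \<ge> m g * u x" using comb[OF u 2(1) greater 2(2)] by simp
        then show ?thesis unfolding 2(3) using 2(2) by (simp add: field_simps)
      qed
    qed
    moreover have "x - ?t *\<^sub>R g \<in> V"
      using xV gW(2) subspace_V by (simp add: subspace_diff subspace_mul)
    ultimately have "x - ?t *\<^sub>R g \<in> hcone U"
      by (intro hconeI) (simp_all add: lin)
    then show "x \<in> convex_cone hull (insert g G)"
      unfolding convex_cone_hull_insert_iff U(3) using t0 by blast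
  qed
  moreover have "finite N" using U(1) by (simp add: N_def)
  moreover have "\<forall>u\<in>N. rform u"
    using U(2) gW(1) by (auto simp: N_def intro!: rform_comb rform_K)
  ultimately show ?case by blast
qed

text \<open>The double description step: intersecting with the half-space of a further form.\<close>

lemma hcone_imp_finitely_generated:
  assumes "finite U" "\<forall>u\<in>U. rform u"
  shows "\<exists>G. finite G \<and> G \<subseteq> W \<and> convex_cone hull G = hcone U"
  using assms
proof (induction U rule: finite_induct)
  case empty
  let ?G = "B \<union> uminus ` B"
  have G: "finite ?G" "?G \<subseteq> W" using finiteI_independent[OF B] B_subset_W W_minus by auto
  have "V \<subseteq> convex_cone hull ?G"
  proof -
    have "subspace (convex_cone hull ?G)"
      unfolding subspace_def
    proof (intro conjI ballI allI)
      have neg: "- x \<in> convex_cone hull ?G" if "x \<in> convex_cone hull ?G" for x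
      proof -
        have "convex_cone (uminus ` (convex_cone hull ?G))"
          by (rule convex_cone_negations) (rule convex_cone_convex_cone_hull)
        moreover have "?G \<subseteq> uminus ` (convex_cone hull ?G)"
        proof
          fix g assume "g \<in> ?G"
          then have "- g \<in> convex_cone hull ?G" by (intro hull_inc) auto
          then show "g \<in> uminus ` (convex_cone hull ?G)" by (rule image_eqI[rotated]) simp
        qed
        ultimately have "convex_cone hull ?G \<subseteq> uminus ` (convex_cone hull ?G)"
          by (rule hull_minimal[rotated])
        then show ?thesis using that by auto
      qed
      fix x y and c :: real assume x: "x \<in> convex_cone hull ?G"
      show "c *\<^sub>R x \<in> convex_cone hull ?G"
        using convex_cone_hull_mul[OF x, of c] convex_cone_hull_mul[OF neg[OF x], of "-c"]
        by (cases "c \<ge> 0") auto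
    qed (auto intro: convex_cone_hull_contains_0 convex_cone_hull_add)
    then show ?thesis unfolding V_def by (rule span_minimal[rotated]) (auto intro: hull_inc)
  qed
  moreover have "convex_cone hull ?G \<subseteq> V"
    by (rule hull_minimal) (use G W_subset_V subspace_V subspace_imp_convex_cone in auto)
  ultimately have "convex_cone hull ?G = hcone {}" by (simp add: hcone_def)
  then show ?case using G by blast
next
  case (insert u U)
  then obtain G where G: "finite G" "G \<subseteq> W" "convex_cone hull G = hcone U" by auto
  have u: "rform u" and lu: "linear u" using insert.prems by (auto simp: rform_def)
  let ?P = "{g\<in>G. u g > 0}" and ?M = "{g\<in>G. u g < 0}" and ?Z = "{g\<in>G. u g \<ge> 0}"
  \<comment> \<open>Up to a positive factor, each mixed combination is the point where the segment
    from a generator on the positive side to one on the negative side crosses the hyperplane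
    \<open>u = 0\<close>.\<close>
  define N where "N = ?Z \<union> (\<lambda>(p, m). u p *\<^sub>R m - u m *\<^sub>R p) ` (?P \<times> ?M)"
  have NW: "finite N" "N \<subseteq> W"
    using G(1,2) u by (auto simp: N_def intro!: W_diff W_scale rform_K)
  have hc: "hcone (insert u U) = {x \<in> hcone U. 0 \<le> u x}" by (auto simp: hcone_def)
  have "convex_cone hull N \<subseteq> hcone (insert u U)"
  proof (rule hull_minimal)
    have GH: "g \<in> hcone U" if "g \<in> G" for g using hull_inc[OF that, of convex_cone] G(3) by simp
    have CH: "convex_cone (hcone U)" using G(3) convex_cone_convex_cone_hull by metis
    have "u p *\<^sub>R m - u m *\<^sub>R p \<in> hcone U" if "p \<in> ?P" "m \<in> ?M" for p m
      using that convex_cone_add[OF CH convex_cone_scaleR[OF CH, of "u p" m] convex_cone_scaleR[OF CH, of "- u m" p]] GH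
      by simp
    then show "N \<subseteq> hcone (insert u U)"
      using GH by (auto simp: hc N_def linear_diff[OF lu] linear_scale[OF lu])
    show "convex_cone (hcone (insert u U))"
      unfolding hc using CH by (auto simp: convex_cone_iff linear_0[OF lu] linear_add[OF lu] linear_scale[OF lu])
  qed
  moreover have "hcone (insert u U) \<subseteq> convex_cone hull N"
  proof
    fix x assume "x \<in> hcone (insert u U)"
    then have x: "x \<in> convex_cone hull G" "0 \<le> u x" by (auto simp: hc G(3))
    then obtain a where a: "a \<in> coef G" "x = vs a" unfolding convex_cone_hull_finite[OF G(1)] by blast
    have NH: "y \<in> convex_cone hull N" if "y \<in> N" for y using that by (rule hull_inc)
    have CN: "convex_cone (convex_cone hull N)" by (rule convex_cone_convex_cone_hull)
    have sumN: "(\<Sum>y\<in>A. f y) \<in> convex_cone hull N" if "\<And>y. y \<in> A \<Longrightarrow> f y \<in> convex_cone hull N"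
      for f and A :: "'b set"
      using that by (induction A rule: infinite_finite_induct)
        (auto intro: convex_cone_add[OF CN] convex_cone_contains_0[OF CN])
    let ?p = "\<Sum>g\<in>?P. a g *\<^sub>R g" and ?m = "\<Sum>g\<in>?M. a g *\<^sub>R g" and ?z = "\<Sum>g\<in>{g\<in>G. u g = 0}. a g *\<^sub>R g"
    let ?\<alpha> = "\<Sum>g\<in>?P. a g * u g" and ?\<beta> = "\<Sum>h\<in>?M. a h * u h"
    have split: "x = ?p + ?m + ?z"
    proof -
      have "x = (\<Sum>g\<in>G. a g *\<^sub>R g)" using vs_coef[OF G(1) a(1)] a(2) by simp
      also have "\<dots> = (\<Sum>g\<in>G. (if u g > 0 then a g *\<^sub>R g else 0) + (if u g < 0 then a g *\<^sub>R g else 0)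
          + (if u g = 0 then a g *\<^sub>R g else 0))"
        by (rule sum.cong) auto
      also have "\<dots> = ?p + ?m + ?z"
        by (simp add: sum.distrib sum.inter_filter[OF G(1)])
      finally show ?thesis .
    qed
    have ux: "u x = ?\<alpha> + ?\<beta>"
      unfolding split by (simp add: linear_add[OF lu] linear_sum[OF lu] linear_scale[OF lu])
    have \<beta>0: "?\<beta> \<le> 0" by (rule sum_nonpos) (use coef_nonneg[OF a(1)] in \<open>auto simp: mult_nonneg_nonpos\<close>)
    show "x \<in> convex_cone hull N"
    proof (cases "?\<alpha> = 0")
      case True
      then have "?\<beta> = 0" using ux x(2) \<beta>0 by simp
      then have "(\<Sum>h\<in>?M. a h * - u h) = 0" by (simp add: sum_negf)
      moreover have "(\<Sum>h\<in>?M. a h * - u h) = 0 \<longleftrightarrow> (\<forall>h\<in>?M. a h * - u h = 0)"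
        by (rule sum_nonneg_eq_0_iff) (use G(1) coef_nonneg[OF a(1)] in \<open>auto simp: mult_nonneg_nonpos\<close>)
      ultimately have "a h = 0" if "h \<in> ?M" for h
        using that by fastforce
      then have m0: "?m = 0" by simp
      have "?p + ?z \<in> convex_cone hull N"
        by (intro convex_cone_add[OF CN] sumN convex_cone_scaleR[OF CN] coef_nonneg[OF a(1)] NH) (auto simp: N_def)
      then show ?thesis using split m0 by simp
    next
      case False
      have "?\<alpha> \<ge> 0" by (rule sum_nonneg) (use coef_nonneg[OF a(1)] in auto)
      then have \<alpha>: "?\<alpha> > 0" using False by simp
      \<comment> \<open>The weights distribute the negative part over the positive generators in
        proportion to their share of \<open>?\<alpha>\<close>. The double sum becomes
        \<open>?m\<close> minus \<open>?\<beta> / ?\<alpha>\<close> times \<open>?p\<close>, and the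
        remaining factor \<open>1 + ?\<beta> / ?\<alpha>\<close> of \<open>?p\<close> is nonnegative
        because \<open>u x\<close> is.\<close>
      let ?s = "\<Sum>g\<in>?P. \<Sum>h\<in>?M. (a g * a h / ?\<alpha>) *\<^sub>R (u g *\<^sub>R h - u h *\<^sub>R g)"
      have dbl: "(\<Sum>g\<in>A. \<Sum>h\<in>C. p g *\<^sub>R f h) = sum p A *\<^sub>R sum f C"
        for A C :: "'a set" and p :: "'a \<Rightarrow> real" and f :: "'a \<Rightarrow> 'a"
        by (simp add: scaleR_sum_right[symmetric] scaleR_sum_left[symmetric])
      have "?s = (\<Sum>g\<in>?P. \<Sum>h\<in>?M. (a g * u g / ?\<alpha>) *\<^sub>R (a h *\<^sub>R h)) - (\<Sum>g\<in>?P. \<Sum>h\<in>?M. (a h * u h / ?\<alpha>) *\<^sub>R (a g *\<^sub>R g))"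
        by (simp add: sum_subtractf algebra_simps)
      also have "(\<Sum>g\<in>?P. \<Sum>h\<in>?M. (a h * u h / ?\<alpha>) *\<^sub>R (a g *\<^sub>R g)) = (\<Sum>h\<in>?M. a h * u h / ?\<alpha>) *\<^sub>R ?p"
        by (subst sum.swap) (rule dbl)
      also have "(\<Sum>h\<in>?M. a h * u h / ?\<alpha>) = ?\<beta> / ?\<alpha>"
        by (rule sum_divide_distrib[symmetric])
      also have "(\<Sum>g\<in>?P. \<Sum>h\<in>?M. (a g * u g / ?\<alpha>) *\<^sub>R (a h *\<^sub>R h)) = (\<Sum>g\<in>?P. a g * u g / ?\<alpha>) *\<^sub>R ?m"
        by (rule dbl)
      also have "(\<Sum>g\<in>?P. a g * u g / ?\<alpha>) = 1"
        using \<alpha> by (simp add: sum_divide_distrib[symmetric])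
      finally have "?s = ?m - (?\<beta> / ?\<alpha>) *\<^sub>R ?p" by simp
      then have x_eq: "x = ?s + (1 + ?\<beta> / ?\<alpha>) *\<^sub>R ?p + ?z"
        unfolding split by (simp add: algebra_simps)
      have c: "1 + ?\<beta> / ?\<alpha> \<ge> 0" using ux x(2) \<alpha> by (simp add: field_simps)
      have s: "?s \<in> convex_cone hull N"
        by (intro sumN convex_cone_scaleR[OF CN] NH) (use \<alpha> coef_nonneg[OF a(1)] in \<open>auto simp: N_def\<close>)
      have p: "?p \<in> convex_cone hull N" and z: "?z \<in> convex_cone hull N"
        by (intro sumN convex_cone_scaleR[OF CN] coef_nonneg[OF a(1)] NH; force simp: N_def)+
      show ?thesis
        unfolding x_eq by (rule convex_cone_add[OF CN convex_cone_add[OF CN s convex_cone_scaleR[OF CN c p]] z])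
    qed
  qed
  ultimately show ?case using NW by blast
qed

definition fg :: "'a set \<Rightarrow> bool" where
  "fg \<sigma> \<longleftrightarrow> (\<exists>G. finite G \<and> G \<subseteq> W \<and> \<sigma> = convex_cone hull G)"

lemma fg_iff_hcone: "fg \<sigma> \<longleftrightarrow> (\<exists>U. finite U \<and> (\<forall>u\<in>U. rform u) \<and> \<sigma> = hcone U)"
  unfolding fg_def using finitely_generated_imp_hcone hcone_imp_finitely_generated by metis

lemma fg_convex_cone: "fg \<sigma> \<Longrightarrow> convex_cone \<sigma>"
  unfolding fg_def using convex_cone_convex_cone_hull by blast

lemma fg_subset: "fg \<sigma> \<Longrightarrow> \<sigma> \<subseteq> V"
  unfolding fg_iff_hcone by (auto simp: hcone_def)

text \<open>One of the finitely many defining inequalities of \<sigma> fails at \<open>y\<close>;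
  its form separates.\<close>

lemma farkas:
  assumes "fg \<sigma>" "y \<in> V" "y \<notin> \<sigma>"
  shows "\<exists>u::'a \<Rightarrow> real. linear u \<and> (\<forall>x\<in>\<sigma>. 0 \<le> u x) \<and> u y < 0"
proof -
  obtain U where U: "\<forall>u\<in>U. rform u" "\<sigma> = hcone U" using assms(1) unfolding fg_iff_hcone by blast
  have "\<not> (\<forall>u\<in>U. 0 \<le> u y)" using assms(2,3) U(2) hconeI[of y U] by blast
  then obtain u where u: "u \<in> U" "u y < 0" by (meson not_le)
  then have "\<forall>x\<in>\<sigma>. 0 \<le> u x" using U(2) hconeD(1) by simp
  moreover have "linear u" using u U(1) rform_linear[of u] by simp
  ultimately show ?thesis using u(2) by (auto intro!: exI[of _ u])
qed

lemma fg_closed: "fg \<sigma> \<Longrightarrow> closed \<sigma>"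
proof -
  assume "fg \<sigma>"
  then obtain U where U: "\<forall>u\<in>U. rform u" "\<sigma> = hcone U" unfolding fg_iff_hcone by blast
  have "closed {x. 0 \<le> u x}" if "u \<in> U" for u
    using rform_linear[of u] U(1) that
    by (intro closed_Collect_le continuous_on_const linear_continuous_on) (auto simp: linear_conv_bounded_linear)
  then have "closed (V \<inter> (\<Inter>u\<in>U. {x. 0 \<le> u x}))"
    using closed_subspace[OF subspace_V] by (intro closed_Int closed_INT) auto
  moreover have "V \<inter> (\<Inter>u\<in>U. {x. 0 \<le> u x}) = \<sigma>" using U by (auto simp: hcone_def)
  ultimately show "closed \<sigma>" by simp
qed

lemma fg_face: "fg \<sigma> \<Longrightarrow> cface \<tau> \<sigma> \<Longrightarrow> fg \<tau>"
  unfolding fg_def using cface_hull finite_Int le_infI1 by meson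

lemma fg_sum:
  assumes "fg \<sigma>" "fg \<tau>" shows "fg {x + y | x y. x \<in> \<sigma> \<and> y \<in> \<tau>}"
proof -
  obtain G H where *: "finite G" "G \<subseteq> W" "\<sigma> = convex_cone hull G" "finite H" "H \<subseteq> W" "\<tau> = convex_cone hull H"
    using assms unfolding fg_def by blast
  have "{x + y | x y. x \<in> \<sigma> \<and> y \<in> \<tau>} = convex_cone hull (G \<union> H)"
    unfolding convex_cone_hull_Un * by blast
  then show ?thesis using * unfolding fg_def by (auto intro!: exI[of _ "G \<union> H"])
qed

lemma fg_hull: "finite G \<Longrightarrow> G \<subseteq> W \<Longrightarrow> fg (convex_cone hull G)"
  unfolding fg_def by blast

lemma fg_uminus:
  assumes "fg \<tau>" shows "fg (uminus ` \<tau>)"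
proof -
  obtain G where G: "finite G" "G \<subseteq> W" "\<tau> = convex_cone hull G" using assms unfolding fg_def by blast
  have "convex_cone hull (uminus ` G) = uminus ` \<tau>"
    unfolding G(3) by (rule convex_cone_hull_linear_image[OF linear_uminus])
  moreover have "fg (convex_cone hull (uminus ` G))" by (rule fg_hull) (use G W_minus in auto)
  ultimately show ?thesis by simp
qed

lemma fg_diff:
  assumes "fg \<sigma>" "fg \<tau>" shows "fg {x - y | x y. x \<in> \<sigma> \<and> y \<in> \<tau>}"
proof -
  have "{x - y | x y. x \<in> \<sigma> \<and> y \<in> \<tau>} = {x + y | x y. x \<in> \<sigma> \<and> y \<in> uminus ` \<tau>}"
  proof -
    have "{x + y | x y. x \<in> \<sigma> \<and> y \<in> uminus ` \<tau>} = {x + - y | x y. x \<in> \<sigma> \<and> y \<in> \<tau>}" by blast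
    then show ?thesis by simp
  qed
  then show ?thesis using fg_sum[OF assms(1) fg_uminus[OF assms(2)]] by simp
qed

lemma exists_rational_core: "fg \<tau> \<Longrightarrow> \<exists>b\<in>W. core b \<tau>"
proof -
  assume "fg \<tau>"
  then obtain G where G: "finite G" "G \<subseteq> W" "\<tau> = convex_cone hull G" unfolding fg_def by blast
  have "(\<Sum>g\<in>G. g) \<in> W" using G(2) by (intro W_sum) auto
  then show ?thesis using core_sum_hull[OF G(1)] G(3) by blast
qed

text \<open>One generator \<open>g\<close> outside \<tau> is handled at a time, and the resulting
  forms are added: the sum vanishes on a combination only if no generator outside \<tau> is used.
  This links the algebraic notion \<open>cface\<close> with faces cut out by linear forms.\<close>

lemma fg_exposed:
  assumes "fg \<sigma>" "cface \<tau> \<sigma>"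
  shows "\<exists>u::'a \<Rightarrow> real. linear u \<and> (\<forall>x\<in>\<sigma>. 0 \<le> u x) \<and> \<tau> = {x\<in>\<sigma>. u x = 0}"
proof -
  obtain G where G: "finite G" "G \<subseteq> W" "\<sigma> = convex_cone hull G" using assms unfolding fg_def by blast
  have ex: "\<exists>u::'a \<Rightarrow> real. linear u \<and> (\<forall>x\<in>\<sigma>. 0 \<le> u x) \<and> (\<forall>x\<in>\<tau>. u x = 0) \<and> u g > 0" if g: "g \<in> G - \<tau>" for g
  proof -
    \<comment> \<open>A form that is nonnegative on these differences is nonnegative on \<sigma> and
      vanishes on \<tau>. The face property keeps \<open>- g\<close> out of this cone.\<close>
    let ?C = "{x - y | x y. x \<in> \<sigma> \<and> y \<in> \<tau>}"
    have fgC: "fg ?C" by (rule fg_diff[OF assms(1) fg_face[OF assms]])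
    have gV: "- g \<in> V" using g G(2) W_subset_V subspace_neg[OF subspace_V] by auto
    have "- g \<notin> ?C"
    proof
      assume "- g \<in> ?C"
      then obtain s t where st: "s \<in> \<sigma>" "t \<in> \<tau>" "- g = s - t" by auto
      then have "g + s = t" by (simp add: algebra_simps)
      moreover have "g \<in> \<sigma>" using g hull_inc[of g G convex_cone] G(3) by simp
      ultimately show False using cface_left[OF assms(2), of g s] st g by simp
    qed
    then obtain u :: "'a \<Rightarrow> real" where u: "linear u" "\<forall>x\<in>?C. 0 \<le> u x" "u (- g) < 0" using farkas[OF fgC gV] by auto
    have 0: "0 \<in> \<tau>" "0 \<in> \<sigma>"
      using convex_cone_contains_0[OF cface_convex_cone[OF assms(2)]] cface_subset[OF assms(2)] by auto
    have 1: "0 \<le> u x" if "x \<in> \<sigma>" for x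
    proof -
      have "x - 0 \<in> ?C" using that 0(1) by blast
      then show ?thesis using u(2) by simp
    qed
    have 2: "u x = 0" if "x \<in> \<tau>" for x
    proof -
      have "0 - x \<in> ?C" using that 0(2) by blast
      then have "0 \<le> u (- x)" using u(2) by simp
      moreover have "0 \<le> u x" using 1 that cface_subset[OF assms(2)] by blast
      ultimately show ?thesis using linear_neg[OF u(1)] by simp
    qed
    have "u g > 0" using u(3) linear_neg[OF u(1)] by simp
    with u(1) 1 2 show ?thesis by (auto intro!: exI[of _ u])
  qed
  have "\<forall>g\<in>G - \<tau>. \<exists>u::'a \<Rightarrow> real. linear u \<and> (\<forall>x\<in>\<sigma>. 0 \<le> u x) \<and> (\<forall>x\<in>\<tau>. u x = 0) \<and> u g > 0"
    using ex by simp
  from bchoice[OF this] obtain f :: "'a \<Rightarrow> 'a \<Rightarrow> real" where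
    f: "\<And>g. g \<in> G - \<tau> \<Longrightarrow> linear (f g) \<and> (\<forall>x\<in>\<sigma>. 0 \<le> f g x) \<and> (\<forall>x\<in>\<tau>. f g x = 0) \<and> f g g > 0"
    by auto
  let ?u = "\<lambda>x. \<Sum>g\<in>G - \<tau>. f g x"
  have lin: "linear ?u" using f by (intro linear_compose_sum) auto
  have pos: "0 \<le> ?u x" if "x \<in> \<sigma>" for x using f that by (intro sum_nonneg) auto
  have "x \<in> \<tau>" if x: "x \<in> \<sigma>" "?u x = 0" for x
  proof -
    obtain a where a: "a \<in> coef G" "x = vs a" using x G convex_cone_hull_finite by blast
    have z: "f g x = 0" if "g \<in> G - \<tau>" for g
      using x f that G(1) sum_nonneg_eq_0_iff[of "G - \<tau>" "\<lambda>g. f g x"] by auto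
    have "a g = 0" if g: "g \<in> G - \<tau>" for g
    proof -
      have lg: "linear (f g)" using f g by blast
      have "0 = f g x" using z g by simp
      also have "\<dots> = (\<Sum>h\<in>G. a h * f g h)"
        using a vs_coef[OF G(1) a(1)] by (simp add: linear_sum[OF lg] linear_scale[OF lg])
      finally have "(\<Sum>h\<in>G. a h * f g h) = 0" by simp
      then have "a g * f g g = 0"
        using sum_nonneg_eq_0_iff[of G "\<lambda>h. a h * f g h"] f[OF g] coef_nonneg[OF a(1)] G g hull_inc
        by (metis (no_types, lifting) DiffD1 mult_nonneg_nonneg)
      then show ?thesis using f[OF g] by simp
    qed
    then have "a \<in> coef (G \<inter> \<tau>)" using a(1) by (auto simp: coef_def)
    then show ?thesis using a(2) vs_mem_convex_cone[OF cface_convex_cone[OF assms(2)], of "G \<inter> \<tau>"] G(1) by blast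
  qed
  moreover have "?u x = 0" if "x \<in> \<tau>" for x using f that by simp
  ultimately show ?thesis using lin pos cface_subset[OF assms(2)] by blast
qed

end

lemma finite_common_radius:
  assumes "finite U" "\<And>u. u \<in> U \<Longrightarrow> \<exists>e>0. \<forall>y::'b::real_normed_vector. norm y < e \<longrightarrow> P u y"
  shows "\<exists>e>0. \<forall>u\<in>U. \<forall>y. norm y < e \<longrightarrow> P u y"
  using assms
proof (induction U rule: finite_induct)
  case empty
  show ?case by (rule exI[of _ 1]) simp
next
  case (insert u U)
  then obtain d where d: "d > 0" "\<forall>u\<in>U. \<forall>y. norm y < d \<longrightarrow> P u y" by auto
  obtain e where e: "e > 0" "\<forall>y. norm y < e \<longrightarrow> P u y" using insert.prems[of u] by auto
  show ?case by (rule exI[of _ "min d e"]) (use d e in auto)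
qed

section \<open>Fans and joins\<close>

definition jset :: "'a::real_vector set \<Rightarrow> 'a set \<Rightarrow> 'a set" where
  "jset \<kappa> E = {s + vs a | s a. s \<in> \<kappa> \<and> a \<in> coef E}"

abbreviation cells :: "('a::real_vector set \<times> 'a set) set \<Rightarrow> 'a set set" where
  "cells P \<equiv> (\<lambda>(\<kappa>, E). jset \<kappa> E) ` P"

lemma jsetI: "s \<in> \<kappa> \<Longrightarrow> a \<in> coef E \<Longrightarrow> s + vs a \<in> jset \<kappa> E"
  unfolding jset_def by blast

lemma jsetE:
  assumes "x \<in> jset \<kappa> E"
  obtains s a where "s \<in> \<kappa>" "a \<in> coef E" "x = s + vs a"
  using assms unfolding jset_def by blast

lemma jset_empty: "jset \<kappa> {} = \<kappa>"
proof
  show "jset \<kappa> {} \<subseteq> \<kappa>" by (auto simp: jset_def dest!: coef_empty)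
  show "\<kappa> \<subseteq> jset \<kappa> {}"
  proof
    fix x assume "x \<in> \<kappa>"
    from jsetI[OF this coef_zero, of "{}"] show "x \<in> jset \<kappa> {}" by simp
  qed
qed

lemma jset_mono: "\<kappa> \<subseteq> \<kappa>' \<Longrightarrow> E \<subseteq> E' \<Longrightarrow> jset \<kappa> E \<subseteq> jset \<kappa>' E'"
  unfolding jset_def using coef_mono by blast

lemma jset_base: "\<kappa> \<subseteq> jset \<kappa> E"
  using jset_mono[of \<kappa> \<kappa> "{}" E] by (simp add: jset_empty)

lemma jset_vertex: "0 \<in> \<kappa> \<Longrightarrow> E \<subseteq> jset \<kappa> E"
proof
  fix e assume "0 \<in> \<kappa>" "e \<in> E"
  from jsetI[OF this(1) ucoef_in[OF this(2)]] show "e \<in> jset \<kappa> E" by simp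
qed

lemma jset_vs: "0 \<in> \<kappa> \<Longrightarrow> a \<in> coef E \<Longrightarrow> vs a \<in> jset \<kappa> E"
  using jsetI[of 0 \<kappa> a E] by simp

lemma jset_eq_sum: "finite E \<Longrightarrow> jset \<kappa> E = {x + y | x y. x \<in> \<kappa> \<and> y \<in> convex_cone hull E}"
  unfolding jset_def by (auto simp: convex_cone_hull_finite)

lemma jset_face:
  assumes "cface \<phi> (jset \<kappa> E)" "convex_cone (jset \<kappa> E)" "finite E" "convex_cone \<kappa>"
  shows "\<phi> = jset (\<kappa> \<inter> \<phi>) (E \<inter> \<phi>)" "cface (\<kappa> \<inter> \<phi>) \<kappa>"
proof -
  have k0: "0 \<in> \<kappa>" by (rule convex_cone_contains_0[OF assms(4)])
  note fc = cface_convex_cone[OF assms(1)]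
  show "cface (\<kappa> \<inter> \<phi>) \<kappa>"
    unfolding cface_def using convex_cone_Int[OF assms(4) fc] cface_left[OF assms(1)] jset_base[of \<kappa> E] by blast
  show "\<phi> = jset (\<kappa> \<inter> \<phi>) (E \<inter> \<phi>)"
  proof
    show "\<phi> \<subseteq> jset (\<kappa> \<inter> \<phi>) (E \<inter> \<phi>)"
    proof
      fix x assume x: "x \<in> \<phi>"
      then have "x \<in> jset \<kappa> E" using cface_subset[OF assms(1)] by blast
      then obtain s a where sa: "s \<in> \<kappa>" "a \<in> coef E" "x = s + vs a" by (rule jsetE)
      have "s \<in> \<phi>" "a \<in> coef (E \<inter> \<phi>)"
        using cface_vs[OF assms(1,2,3) jset_vertex[OF k0] sa(2) subsetD[OF jset_base sa(1)]] x sa(3) by simp_all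
      then show "x \<in> jset (\<kappa> \<inter> \<phi>) (E \<inter> \<phi>)" unfolding sa(3) using sa(1) by (intro jsetI) simp_all
    qed
    show "jset (\<kappa> \<inter> \<phi>) (E \<inter> \<phi>) \<subseteq> \<phi>"
    proof
      fix x assume "x \<in> jset (\<kappa> \<inter> \<phi>) (E \<inter> \<phi>)"
      then obtain s a where sa: "s \<in> \<kappa> \<inter> \<phi>" "a \<in> coef (E \<inter> \<phi>)" "x = s + vs a" by (rule jsetE)
      have "vs a \<in> \<phi>" using vs_mem_convex_cone[OF fc _ _ sa(2)] assms(3) by simp
      then show "x \<in> \<phi>" using sa(1,3) convex_cone_add[OF fc, of s "vs a"] by simp
    qed
  qed
qed

context rational_space
begin

text \<open>\<open>lfan L S\<close> encodes a fan of sharp cones in the quotient by \<open>L\<close>: \<open>L\<close> is a face of every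
  member, hence its lineality space.\<close>

definition lfan :: "'a set \<Rightarrow> 'a set set \<Rightarrow> bool" where
  "lfan L S \<longleftrightarrow> finite S \<and> subspace L \<and> L \<in> S \<and>
     (\<forall>\<sigma>\<in>S. fg \<sigma> \<and> L \<subseteq> \<sigma> \<and> (\<forall>\<tau>. cface \<tau> \<sigma> \<longrightarrow> \<tau> \<in> S) \<and> (\<forall>\<tau>\<in>S. cface (\<sigma> \<inter> \<tau>) \<sigma>))"

lemma lfanD:
  assumes "lfan L S"
  shows "finite S" "subspace L" "L \<in> S" "\<sigma> \<in> S \<Longrightarrow> fg \<sigma>" "\<sigma> \<in> S \<Longrightarrow> L \<subseteq> \<sigma>"
    "\<sigma> \<in> S \<Longrightarrow> cface \<tau> \<sigma> \<Longrightarrow> \<tau> \<in> S" "\<sigma> \<in> S \<Longrightarrow> \<tau> \<in> S \<Longrightarrow> cface (\<sigma> \<inter> \<tau>) \<sigma>"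
    "\<sigma> \<in> S \<Longrightarrow> convex_cone \<sigma>" "\<sigma> \<in> S \<Longrightarrow> 0 \<in> \<sigma>"
  using assms fg_convex_cone convex_cone_contains_0 unfolding lfan_def by blast+

lemma lfan_face_iff:
  assumes "lfan L S" "\<tau> \<in> S" "\<sigma> \<in> S"
  shows "cface \<tau> \<sigma> \<longleftrightarrow> \<tau> \<subseteq> \<sigma>"
  using lfanD(7)[OF assms(1,3,2)] cface_subset by (metis inf.absorb2)

lemma lfan_lineality:
  assumes "lfan L S" "\<sigma> \<in> S" "x \<in> \<sigma>" "- x \<in> \<sigma>"
  shows "x \<in> L"
proof -
  have "cface L \<sigma>" using lfan_face_iff[OF assms(1) lfanD(3)[OF assms(1)] assms(2)] lfanD(5)[OF assms(1,2)] by simp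
  moreover have "x + - x \<in> L" using subspace_0[OF lfanD(2)[OF assms(1)]] by simp
  ultimately show ?thesis using cface_left assms(3,4) by blast
qed

text \<open>A pair \<open>(\<kappa>, E)\<close> stands for the cone \<open>jset \<kappa> E\<close>.  The last condition makes any two such cones
  intersect in a common face; applied to a single pair, it says that \<open>E\<close> is linearly independent
  modulo the span of \<open>\<kappa>\<close>.\<close>

definition joinc :: "'a set set \<Rightarrow> ('a set \<times> 'a set) set \<Rightarrow> bool" where
  "joinc S P \<longleftrightarrow> finite P \<and> (\<forall>\<kappa>\<in>S. (\<kappa>, {}) \<in> P) \<and>
     (\<forall>\<kappa> E. (\<kappa>, E) \<in> P \<longrightarrow> \<kappa> \<in> S \<and> finite E \<and> E \<subseteq> W) \<and>
     (\<forall>\<kappa> E \<kappa>' E'. (\<kappa>, E) \<in> P \<longrightarrow> cface \<kappa>' \<kappa> \<longrightarrow> E' \<subseteq> E \<longrightarrow> (\<kappa>', E') \<in> P) \<and>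
     (\<forall>\<kappa>1 E1 \<kappa>2 E2 s1 s2 a1 a2. (\<kappa>1, E1) \<in> P \<longrightarrow> (\<kappa>2, E2) \<in> P \<longrightarrow> s1 \<in> \<kappa>1 \<longrightarrow> s2 \<in> \<kappa>2 \<longrightarrow>
        a1 \<in> coef E1 \<longrightarrow> a2 \<in> coef E2 \<longrightarrow> s1 + vs a1 = s2 + vs a2 \<longrightarrow> s1 = s2 \<and> a1 = a2)"

lemma joincI:
  assumes "finite P" "\<And>\<kappa>. \<kappa> \<in> S \<Longrightarrow> (\<kappa>, {}) \<in> P"
    "\<And>\<kappa> E. (\<kappa>, E) \<in> P \<Longrightarrow> \<kappa> \<in> S \<and> finite E \<and> E \<subseteq> W"
    "\<And>\<kappa> E \<kappa>' E'. (\<kappa>, E) \<in> P \<Longrightarrow> cface \<kappa>' \<kappa> \<Longrightarrow> E' \<subseteq> E \<Longrightarrow> (\<kappa>', E') \<in> P"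
    "\<And>\<kappa>1 E1 \<kappa>2 E2 s1 s2 a1 a2. (\<kappa>1, E1) \<in> P \<Longrightarrow> (\<kappa>2, E2) \<in> P \<Longrightarrow> s1 \<in> \<kappa>1 \<Longrightarrow> s2 \<in> \<kappa>2 \<Longrightarrow>
        a1 \<in> coef E1 \<Longrightarrow> a2 \<in> coef E2 \<Longrightarrow> s1 + vs a1 = s2 + vs a2 \<Longrightarrow> s1 = s2 \<and> a1 = a2"
  shows "joinc S P"
  unfolding joinc_def using assms by simp

lemma joincD:
  assumes "joinc S P"
  shows "finite P" "\<kappa> \<in> S \<Longrightarrow> (\<kappa>, {}) \<in> P" "(\<kappa>, E) \<in> P \<Longrightarrow> \<kappa> \<in> S" "(\<kappa>, E) \<in> P \<Longrightarrow> finite E"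
    "(\<kappa>, E) \<in> P \<Longrightarrow> E \<subseteq> W" "(\<kappa>, E) \<in> P \<Longrightarrow> cface \<kappa>' \<kappa> \<Longrightarrow> E' \<subseteq> E \<Longrightarrow> (\<kappa>', E') \<in> P"
  using assms unfolding joinc_def by simp_all

lemma joinc_inj:
  assumes "joinc S P" "(\<kappa>1, E1) \<in> P" "(\<kappa>2, E2) \<in> P" "s1 \<in> \<kappa>1" "s2 \<in> \<kappa>2" "a1 \<in> coef E1" "a2 \<in> coef E2"
    "s1 + vs a1 = s2 + vs a2"
  shows "s1 = s2" "a1 = a2"
  using assms(1)[unfolded joinc_def] assms(2-8) by simp_all

lemma joinc_fg:
  assumes "lfan L S" "joinc S P" "(\<kappa>, E) \<in> P"
  shows "fg (jset \<kappa> E)"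
  unfolding jset_eq_sum[OF joincD(4)[OF assms(2,3)]]
  by (intro fg_sum fg_hull lfanD(4)[OF assms(1)] joincD(3)[OF assms(2,3)] joincD(4)[OF assms(2,3)] joincD(5)[OF assms(2,3)])

lemma jset_sum:
  assumes "joinc S P" "(\<kappa>, E) \<in> P" "a \<in> coef E" "c \<in> coef E"
  shows "vs a + vs c = vs (\<lambda>v. a v + c v)"
  using vs_add[of a c] coef_finite[OF joincD(4)[OF assms(1,2)]] assms(3,4) by simp

text \<open>Uniqueness lets an equation \<open>x + y = r + vs d\<close> be compared in both
  components. In the base component it is the face property of \<open>\<kappa>'\<close> in \<kappa>;
  in the other one, nonnegative coefficients with sum zero outside \<open>E'\<close> vanish one by
  one.\<close>

lemma joinc_face:
  assumes "lfan L S" "joinc S P" "(\<kappa>, E) \<in> P" "cface \<kappa>' \<kappa>" "E' \<subseteq> E"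
  shows "cface (jset \<kappa>' E') (jset \<kappa> E)"
  unfolding cface_def
proof (intro conjI ballI impI)
  have P': "(\<kappa>', E') \<in> P" by (rule joincD(6)[OF assms(2,3,4,5)])
  show "convex_cone (jset \<kappa>' E')" using joinc_fg[OF assms(1,2) P'] by (rule fg_convex_cone)
  show "jset \<kappa>' E' \<subseteq> jset \<kappa> E" by (rule jset_mono[OF cface_subset[OF assms(4)] assms(5)])
  fix x y assume "x \<in> jset \<kappa> E" "y \<in> jset \<kappa> E" "x + y \<in> jset \<kappa>' E'"
  then obtain s a t c r d where *: "s \<in> \<kappa>" "a \<in> coef E" "x = s + vs a" "t \<in> \<kappa>" "c \<in> coef E" "y = t + vs c"
    "r \<in> \<kappa>'" "d \<in> coef E'" "x + y = r + vs d"
    by (elim jsetE)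
  have st: "s + t \<in> \<kappa>" using convex_cone_add[OF lfanD(8)[OF assms(1) joincD(3)[OF assms(2,3)]] *(1,4)] .
  have "(s + t) + vs (\<lambda>v. a v + c v) = x + y"
    unfolding *(3,6) jset_sum[OF assms(2,3) *(2,5), symmetric] by (simp add: algebra_simps)
  then have eq: "s + t = r" "(\<lambda>v. a v + c v) = d"
    using joinc_inj[OF assms(2,3) P' st *(7) coef_add[OF *(2,5)] *(8)] *(9) by simp_all
  have "s \<in> \<kappa>'" using cface_left[OF assms(4) *(1,4)] eq(1) *(7) by simp
  moreover have "a \<in> coef E'"
    unfolding coef_def
  proof (intro CollectI conjI allI impI)
    fix v
    show "0 \<le> a v" using coef_nonneg[OF *(2)] .
    assume "v \<notin> E'"
    then have "a v + c v = 0" using coef_outside[OF *(8)] fun_cong[OF eq(2), of v] by simp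
    then show "a v = 0" using coef_nonneg[OF *(2), of v] coef_nonneg[OF *(5), of v] by simp
  qed
  ultimately show "x \<in> jset \<kappa>' E'" unfolding *(3) by (rule jsetI)
qed

lemma joinc_Int:
  assumes "joinc S P" "(\<kappa>1, E1) \<in> P" "(\<kappa>2, E2) \<in> P"
  shows "jset \<kappa>1 E1 \<inter> jset \<kappa>2 E2 = jset (\<kappa>1 \<inter> \<kappa>2) (E1 \<inter> E2)"
proof
  show "jset \<kappa>1 E1 \<inter> jset \<kappa>2 E2 \<subseteq> jset (\<kappa>1 \<inter> \<kappa>2) (E1 \<inter> E2)"
  proof
    fix x assume "x \<in> jset \<kappa>1 E1 \<inter> jset \<kappa>2 E2"
    then have "x \<in> jset \<kappa>1 E1" "x \<in> jset \<kappa>2 E2" by auto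
    then obtain s1 a1 s2 a2 where *: "s1 \<in> \<kappa>1" "a1 \<in> coef E1" "x = s1 + vs a1" "s2 \<in> \<kappa>2" "a2 \<in> coef E2" "x = s2 + vs a2"
      by (elim jsetE)
    have eq: "s1 = s2" "a1 = a2" using joinc_inj[OF assms *(1,4,2,5)] *(3,6) by simp_all
    show "x \<in> jset (\<kappa>1 \<inter> \<kappa>2) (E1 \<inter> E2)"
      unfolding *(3) by (rule jsetI) (use * eq in \<open>auto intro: coef_Int\<close>)
  qed
  show "jset (\<kappa>1 \<inter> \<kappa>2) (E1 \<inter> E2) \<subseteq> jset \<kappa>1 E1 \<inter> jset \<kappa>2 E2"
    by (intro Int_greatest jset_mono) auto
qed

lemma cells_subset_base:
  assumes "joinc S P" shows "S \<subseteq> cells P"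
proof
  fix \<kappa> assume "\<kappa> \<in> S"
  then have "(\<kappa>, {}) \<in> P" using joincD(2)[OF assms] by blast
  then show "\<kappa> \<in> cells P" by (rule image_eqI[rotated]) (simp add: jset_empty)
qed

lemma cellsE:
  assumes "\<rho> \<in> cells P" obtains \<kappa> E where "(\<kappa>, E) \<in> P" "\<rho> = jset \<kappa> E"
  using assms by auto

lemma cellsI: "(\<kappa>, E) \<in> P \<Longrightarrow> jset \<kappa> E \<in> cells P"
  by (rule image_eqI) simp_all

lemma lfan_cells:
  assumes "lfan L S" "joinc S P"
  shows "lfan L (cells P)"
  unfolding lfan_def
proof (intro conjI ballI allI impI)
  show "finite (cells P)" using joincD(1)[OF assms(2)] by simp
  show "subspace L" by (rule lfanD(2)[OF assms(1)])
  show "L \<in> cells P" using cells_subset_base[OF assms(2)] lfanD(3)[OF assms(1)] by blast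
  fix \<sigma> assume "\<sigma> \<in> cells P"
  then obtain \<kappa> E where \<sigma>: "(\<kappa>, E) \<in> P" "\<sigma> = jset \<kappa> E" by (rule cellsE)
  show "fg \<sigma>" unfolding \<sigma>(2) by (rule joinc_fg[OF assms \<sigma>(1)])
  have \<kappa>: "\<kappa> \<in> S" by (rule joincD(3)[OF assms(2) \<sigma>(1)])
  show "L \<subseteq> \<sigma>" using lfanD(5)[OF assms(1) \<kappa>] jset_base \<sigma>(2) by blast
  { fix \<tau> assume "cface \<tau> \<sigma>"
    from jset_face[OF this[unfolded \<sigma>(2)] fg_convex_cone[OF joinc_fg[OF assms \<sigma>(1)]] joincD(4)[OF assms(2) \<sigma>(1)] lfanD(8)[OF assms(1) \<kappa>]]
    have "\<tau> = jset (\<kappa> \<inter> \<tau>) (E \<inter> \<tau>)" "(\<kappa> \<inter> \<tau>, E \<inter> \<tau>) \<in> P"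
      using joincD(6)[OF assms(2) \<sigma>(1)] by simp_all
    then show "\<tau> \<in> cells P" using cellsI by metis }
  fix \<tau> assume "\<tau> \<in> cells P"
  then obtain \<kappa>' E' where \<tau>: "(\<kappa>', E') \<in> P" "\<tau> = jset \<kappa>' E'" by (rule cellsE)
  have \<kappa>': "\<kappa>' \<in> S" by (rule joincD(3)[OF assms(2) \<tau>(1)])
  show "cface (\<sigma> \<inter> \<tau>) \<sigma>"
    unfolding \<sigma>(2) \<tau>(2) joinc_Int[OF assms(2) \<sigma>(1) \<tau>(1)]
    by (rule joinc_face[OF assms \<sigma>(1) lfanD(7)[OF assms(1) \<kappa> \<kappa>']]) simp
qed

section \<open>Interior points of the support and tangent cones\<close>

text \<open>\<open>x\<close> is an interior point of the support: the tangent cones at \<open>x\<close> cover \<open>V\<close>.\<close>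

definition intpt :: "'a set set \<Rightarrow> 'a \<Rightarrow> bool" where
  "intpt N x \<longleftrightarrow> (\<forall>y\<in>V. \<exists>\<rho>\<in>N. x \<in> \<rho> \<and> (\<exists>M\<ge>0. y + M *\<^sub>R x \<in> \<rho>))"

lemma intpt_mono: "intpt N x \<Longrightarrow> N \<subseteq> N' \<Longrightarrow> intpt N' x"
  unfolding intpt_def by blast

text \<open>Forms of \<rho> that are positive at \<open>x\<close> stay positive within a fixed
  radius, and forms vanishing at \<open>x\<close> do not see the added multiple of
  \<open>x\<close>.\<close>

lemma fg_locally_conic:
  assumes "fg \<rho>" "x \<in> \<rho>"
  shows "\<exists>e>0. \<forall>y. norm y < e \<longrightarrow> y \<in> V \<longrightarrow> (\<exists>M\<ge>0. y + M *\<^sub>R x \<in> \<rho>) \<longrightarrow> x + y \<in> \<rho>"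
proof -
  obtain U where U: "finite U" "\<forall>u\<in>U. rform u" "\<rho> = hcone U" using assms(1) unfolding fg_iff_hcone by blast
  have "\<exists>e>0. \<forall>y. norm y < e \<longrightarrow> u x > 0 \<longrightarrow> u (x + y) > 0" if "u \<in> U" for u
  proof (cases "u x > 0")
    case True
    have lu: "linear u" using U(2) that by (simp add: rform_def)
    obtain c where c: "c > 0" "\<And>y. norm (u y) \<le> c * norm y" using linear_bounded_pos[OF lu] by blast
    have "u (x + y) > 0" if "norm y < u x / c" for y
    proof -
      have "\<bar>u y\<bar> \<le> c * norm y" using c(2)[of y] by simp
      also have "\<dots> < u x" using that c(1) by (simp add: pos_less_divide_eq mult.commute)
      finally show ?thesis by (simp add: linear_add[OF lu])
    qed
    then show ?thesis using True c(1) by (intro exI[of _ "u x / c"]) simp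
  qed (auto intro: exI[of _ 1])
  from finite_common_radius[OF U(1), where P = "\<lambda>u y. u x > 0 \<longrightarrow> u (x + y) > 0", OF this]
  obtain e where e: "e > 0" "\<forall>u\<in>U. \<forall>y. norm y < e \<longrightarrow> u x > 0 \<longrightarrow> u (x + y) > 0" by blast
  have "x + y \<in> \<rho>" if y: "norm y < e" "y \<in> V" "M \<ge> 0" "y + M *\<^sub>R x \<in> \<rho>" for y M
    unfolding U(3)
  proof (rule hconeI)
    have xV: "x \<in> V" using assms fg_subset by blast
    then show "x + y \<in> V" using y(2) subspace_add[OF subspace_V] by blast
    fix u assume u: "u \<in> U"
    then have lu: "linear u" using U(2) by (simp add: rform_def)
    have ux: "0 \<le> u x" using assms(2) u unfolding U(3) by (intro hconeD(1))
    show "0 \<le> u (x + y)"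
    proof (cases "u x = 0")
      case True
      have "0 \<le> u (y + M *\<^sub>R x)" using y(4) u unfolding U(3) by (intro hconeD(1))
      then show ?thesis using True by (simp add: linear_add[OF lu] linear_scale[OF lu])
    next
      case False
      then show ?thesis using e(2) u y(1) ux by (simp add: less_imp_le)
    qed
  qed
  then show ?thesis using e(1) by blast
qed

definition topin :: "'a set set \<Rightarrow> 'a \<Rightarrow> bool" where
  "topin N x \<longleftrightarrow> (\<exists>e>0. \<forall>y\<in>V. norm (y - x) < e \<longrightarrow> y \<in> \<Union>N)"

lemma intpt_imp_topin:
  assumes "finite N" "\<And>\<rho>. \<rho> \<in> N \<Longrightarrow> fg \<rho>" "x \<in> V" "intpt N x"
  shows "topin N x"
proof -
  have "\<exists>e>0. \<forall>y. norm y < e \<longrightarrow> x \<in> \<rho> \<longrightarrow> y \<in> V \<longrightarrow> (\<exists>M\<ge>0. y + M *\<^sub>R x \<in> \<rho>) \<longrightarrow> x + y \<in> \<rho>" if "\<rho> \<in> N" for \<rho>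
    using fg_locally_conic[OF assms(2)[OF that], of x] by (cases "x \<in> \<rho>") (auto intro: exI[of _ 1])
  from finite_common_radius[OF assms(1),
      where P = "\<lambda>\<rho> y. x \<in> \<rho> \<longrightarrow> y \<in> V \<longrightarrow> (\<exists>M\<ge>0. y + M *\<^sub>R x \<in> \<rho>) \<longrightarrow> x + y \<in> \<rho>", OF this]
  obtain e where e: "e > 0" "\<And>\<rho> y. \<rho> \<in> N \<Longrightarrow> norm y < e \<Longrightarrow> x \<in> \<rho> \<Longrightarrow> y \<in> V \<Longrightarrow> (\<exists>M\<ge>0. y + M *\<^sub>R x \<in> \<rho>) \<Longrightarrow> x + y \<in> \<rho>" by blast
  have "y \<in> \<Union>N" if y: "y \<in> V" "norm (y - x) < e" for y
  proof -
    have yx: "y - x \<in> V" using y(1) assms(3) subspace_diff[OF subspace_V] by blast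
    then obtain \<rho> where "\<rho> \<in> N" "x \<in> \<rho>" "\<exists>M\<ge>0. (y - x) + M *\<^sub>R x \<in> \<rho>" using assms(4) unfolding intpt_def by blast
    then have "x + (y - x) \<in> \<rho>" using e(2) y(2) yx by blast
    then show ?thesis using \<open>\<rho> \<in> N\<close> by auto
  qed
  then show ?thesis using e(1) unfolding topin_def by blast
qed

text \<open>The points \<open>x + z n\<close> approach \<open>x\<close> from the direction of
  \<open>y\<close>, and by the pigeonhole principle one cell contains infinitely many of them. It
  contains \<open>x\<close> because it is closed, and rescaling one of these points gives
  \<open>y\<close> plus a multiple of \<open>x\<close>.\<close>

lemma topin_imp_intpt:
  assumes "finite N" "\<And>\<rho>. \<rho> \<in> N \<Longrightarrow> fg \<rho>" "x \<in> V" "topin N x"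
  shows "intpt N x"
  unfolding intpt_def
proof
  fix y assume y: "y \<in> V"
  obtain e where e: "e > 0" "\<forall>y\<in>V. norm (y - x) < e \<longrightarrow> y \<in> \<Union>N" using assms(4) unfolding topin_def by blast
  define c where "c = e / (norm y + 1)"
  have "norm y + 1 > 0" by (simp add: add_nonneg_pos)
  then have c: "c > 0" "c * norm y < e"
    using e(1) by (simp_all add: c_def field_simps)
  define z where "z n = (c / real (Suc n)) *\<^sub>R y" for n
  have nz: "norm (z n) \<le> c * norm y / real (Suc n)" for n
    using c(1) by (simp add: z_def)
  have "\<exists>\<rho>\<in>N. x + z n \<in> \<rho>" for n
  proof -
    have "x + z n \<in> V" using assms(3) y subspace_V by (simp add: z_def subspace_add subspace_mul)
    moreover have "c * norm y / real (Suc n) \<le> c * norm y / 1"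
      by (rule divide_left_mono) (use c(1) in auto)
    then have "norm (x + z n - x) < e" using nz[of n] c(2) by simp
    ultimately show ?thesis using e(2) by blast
  qed
  then obtain f where f: "\<And>n. f n \<in> N" "\<And>n. x + z n \<in> f n" by metis
  have "finite (range f)" using assms(1) f(1) by (meson finite_subset image_subsetI)
  then obtain m where m: "infinite {n. f n = f m}"
    using pigeonhole_infinite[of "UNIV :: nat set" f] by auto
  have "x + z m \<in> f m" by (rule f(2))
  have cc: "convex_cone (f m)" using fg_convex_cone assms(2) f(1) by blast
  have "\<exists>p\<in>f m. dist p x < d" if "d > 0" for d
  proof -
    obtain k :: nat where k: "real k > c * norm y / d" using reals_Archimedean2 by blast
    obtain n where n: "n \<ge> k" "f n = f m" using m unfolding infinite_nat_iff_unbounded_le by blast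
    have "real (Suc n) > c * norm y / d" using k n(1) by simp
    then have "c * norm y / real (Suc n) < d" using that by (simp add: field_simps)
    then have "dist (x + z n) x < d" using nz[of n] by (simp add: dist_norm)
    then show ?thesis using f(2)[of n] n(2) by metis
  qed
  then have "x \<in> f m" using closed_approachable[OF fg_closed[OF assms(2)[OF f(1)]]] by blast
  moreover have "y + (real (Suc m) / c) *\<^sub>R x \<in> f m"
  proof -
    have "(real (Suc m) / c) * (c / real (Suc m)) = 1" using c(1) by simp
    then have "(real (Suc m) / c) *\<^sub>R (x + z m) = y + (real (Suc m) / c) *\<^sub>R x"
      by (simp add: z_def scaleR_add_right del: of_nat_Suc)
    moreover have "(real (Suc m) / c) *\<^sub>R (x + z m) \<in> f m"
      by (rule convex_cone_scaleR[OF cc _ f(2)]) (use c(1) in simp)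
    ultimately show ?thesis by simp
  qed
  moreover have "real (Suc m) / c \<ge> 0" using c(1) by simp
  ultimately show "\<exists>\<rho>\<in>N. x \<in> \<rho> \<and> (\<exists>M\<ge>0. y + M *\<^sub>R x \<in> \<rho>)" using f(1) by blast
qed

text \<open>Whether a point is interior depends only on the cells containing it, and \<open>s + t e\<close> and \<open>s + e\<close> lie
  in the same cells for \<open>t > 0\<close>.\<close>

lemma intpt_add:
  assumes "lfan L N" "intpt N s" "\<rho>\<^sub>0 \<in> N" "s \<in> \<rho>\<^sub>0" "e \<in> \<rho>\<^sub>0"
  shows "intpt N (s + e)"
proof -
  note N = lfanD(1,4)[OF assms(1)]
  have V: "s \<in> V" "e \<in> V" using fg_subset[OF N(2)[OF assms(3)]] assms(4,5) by auto
  have "topin N s" by (rule intpt_imp_topin[OF N V(1) assms(2)])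
  then obtain d where d: "d > 0" "\<forall>y\<in>V. norm (y - s) < d \<longrightarrow> y \<in> \<Union>N" unfolding topin_def by blast
  \<comment> \<open>Small enough for \<open>s + t e\<close> to lie within \<open>d / 2\<close> of
    \<open>s\<close>, so that the ball of radius \<open>d / 2\<close> around it stays in the
    support. The bound \<open>t \<le> 1\<close> makes the correction \<open>M * (1 - t)\<close>
    nonnegative when passing from \<open>s + t e\<close> to \<open>s + e\<close>.\<close>
  define t where "t = min 1 (d / (2 * (norm e + 1)))"
  have t: "0 < t" "t \<le> 1" using d(1) by (auto simp: t_def add_nonneg_pos)
  have "t * norm e \<le> d / (2 * (norm e + 1)) * norm e" by (rule mult_right_mono) (simp_all add: t_def)
  also have "\<dots> = d / 2 * (norm e / (norm e + 1))" by simp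
  also have "\<dots> < d / 2 * 1"
    using d(1) add_nonneg_pos[OF norm_ge_zero zero_less_one, of e]
    by (intro mult_strict_left_mono) (simp_all add: divide_less_eq)
  also have "\<dots> = d / 2" by simp
  finally have tn: "t * norm e < d / 2" .
  let ?x = "s + t *\<^sub>R e"
  have xV: "?x \<in> V" using V subspace_V by (simp add: subspace_add subspace_mul)
  have tp: "topin N ?x"
    unfolding topin_def
  proof (intro exI[of _ "d / 2"] conjI ballI impI)
    show "0 < d / 2" using d(1) by simp
    fix y assume y: "y \<in> V" "norm (y - ?x) < d / 2"
    have "norm (y - s) \<le> norm (y - ?x) + norm (t *\<^sub>R e)"
      using norm_triangle_ineq[of "y - ?x" "t *\<^sub>R e"] by simp
    also have "\<dots> < d" using y(2) tn t(1) by simp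
    finally show "y \<in> \<Union>N" using d(2) y(1) by blast
  qed
  have ip: "intpt N ?x" by (rule topin_imp_intpt[OF N xV tp])
  show ?thesis
    unfolding intpt_def
  proof
    fix y assume "y \<in> V"
    then obtain \<rho> M where \<rho>: "\<rho> \<in> N" "?x \<in> \<rho>" "M \<ge> 0" "y + M *\<^sub>R ?x \<in> \<rho>" using ip unfolding intpt_def by blast
    have F: "cface (\<rho>\<^sub>0 \<inter> \<rho>) \<rho>\<^sub>0" by (rule lfanD(7)[OF assms(1,3) \<rho>(1)])
    have C: "convex_cone \<rho>\<^sub>0" "convex_cone \<rho>" using lfanD(8)[OF assms(1)] assms(3) \<rho>(1) by auto
    have te: "t *\<^sub>R e \<in> \<rho>\<^sub>0" using C(1) assms(5) t(1) by (simp add: convex_cone_scaleR)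
    have "?x \<in> \<rho>\<^sub>0 \<inter> \<rho>" using \<rho>(2) convex_cone_add[OF C(1) assms(4) te] by blast
    then have "s \<in> \<rho>" "t *\<^sub>R e \<in> \<rho>\<^sub>0 \<inter> \<rho>" using cface_left[OF F assms(4) te] cface_right[OF F assms(4) te] by auto
    moreover from this(2) have "e \<in> \<rho>" using cface_pos[OF F assms(5) _ t(1)] by blast
    ultimately have se: "s + e \<in> \<rho>" using convex_cone_add[OF C(2)] by blast
    have "(M * (1 - t)) *\<^sub>R e \<in> \<rho>" using convex_cone_scaleR[OF C(2) _ \<open>e \<in> \<rho>\<close>] \<rho>(3) t(2) by simp
    then have "(y + M *\<^sub>R ?x) + (M * (1 - t)) *\<^sub>R e \<in> \<rho>" by (rule convex_cone_add[OF C(2) \<rho>(4)])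
    moreover have "(y + M *\<^sub>R ?x) + (M * (1 - t)) *\<^sub>R e = y + M *\<^sub>R (s + e)" by (simp add: algebra_simps)
    ultimately show "\<exists>\<rho>\<in>N. s + e \<in> \<rho> \<and> (\<exists>M\<ge>0. y + M *\<^sub>R (s + e) \<in> \<rho>)"
      using \<rho>(1,3) se by auto
  qed
qed

end

section \<open>Completing the star of a cone\<close>

lemma convex_cone_sum:
  assumes "convex_cone C" "\<And>i. i \<in> I \<Longrightarrow> f i \<in> C"
  shows "sum f I \<in> C"
  using assms(2) by (induction I rule: infinite_finite_induct)
    (auto intro: convex_cone_add[OF assms(1)] convex_cone_contains_0[OF assms(1)])

definition ext :: "'a::real_vector set \<Rightarrow> 'a set \<Rightarrow> 'a set" where
  "ext \<tau> \<rho> = {x + y | x y. x \<in> \<rho> \<and> y \<in> span \<tau>}"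

definition star :: "'a::real_vector set set \<Rightarrow> 'a set \<Rightarrow> 'a set set" where
  "star N \<tau> = ext \<tau> ` {\<rho>\<in>N. \<tau> \<subseteq> \<rho>}"

text \<open>A vector in the span of \<tau> is carried into \<tau> by a multiple of \<open>b\<close>,
  so adding the whole span amounts to adding negative multiples of \<open>b\<close>. Membership in
  star cells thereby gets the shape of the condition in \<open>intpt\<close>.\<close>

lemma ext_iff:
  assumes "convex_cone \<rho>" "\<tau> \<subseteq> \<rho>" "core b \<tau>"
  shows "x \<in> ext \<tau> \<rho> \<longleftrightarrow> (\<exists>M\<ge>0. x + M *\<^sub>R b \<in> \<rho>)"
proof
  assume "x \<in> ext \<tau> \<rho>"
  then obtain r t where rt: "x = r + t" "r \<in> \<rho>" "t \<in> span \<tau>" unfolding ext_def by blast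
  then obtain M where M: "M \<ge> 0" "t + M *\<^sub>R b \<in> \<tau>" using assms(3) unfolding core_def by blast
  have "r + (t + M *\<^sub>R b) \<in> \<rho>" using convex_cone_add[OF assms(1) rt(2)] M(2) assms(2) by blast
  then show "\<exists>M\<ge>0. x + M *\<^sub>R b \<in> \<rho>" using M(1) rt(1) by (auto simp: add.assoc)
next
  assume "\<exists>M\<ge>0. x + M *\<^sub>R b \<in> \<rho>"
  then obtain M where "x + M *\<^sub>R b \<in> \<rho>" by blast
  moreover have "- M *\<^sub>R b \<in> span \<tau>"
    using assms(3) span_scale[OF span_base[of b \<tau>], of "- M"] unfolding core_def by simp
  moreover have "x = (x + M *\<^sub>R b) + (- M *\<^sub>R b)" by simp
  ultimately show "x \<in> ext \<tau> \<rho>" unfolding ext_def by blast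
qed

lemma ext_larger:
  assumes "convex_cone \<rho>" "b \<in> \<rho>" "x + M *\<^sub>R b \<in> \<rho>" "M \<le> M'"
  shows "x + M' *\<^sub>R b \<in> \<rho>"
proof -
  have "(x + M *\<^sub>R b) + (M' - M) *\<^sub>R b \<in> \<rho>"
    by (rule convex_cone_add[OF assms(1,3) convex_cone_scaleR[OF assms(1) _ assms(2)]]) (use assms(4) in simp)
  then show ?thesis by (simp add: algebra_simps)
qed

lemma subset_ext: "\<rho> \<subseteq> ext \<tau> \<rho>"
proof
  fix x assume "x \<in> \<rho>"
  then have "x + 0 \<in> ext \<tau> \<rho>" unfolding ext_def using span_zero by blast
  then show "x \<in> ext \<tau> \<rho>" by simp
qed

lemma ext_self: "convex_cone \<tau> \<Longrightarrow> ext \<tau> \<tau> = span \<tau>"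
proof
  show "ext \<tau> \<tau> \<subseteq> span \<tau>" unfolding ext_def by (auto intro: span_add span_base)
  assume "convex_cone \<tau>"
  then have "0 \<in> \<tau>" by (rule convex_cone_contains_0)
  then have "0 + y \<in> ext \<tau> \<tau>" if "y \<in> span \<tau>" for y unfolding ext_def using that by blast
  then show "span \<tau> \<subseteq> ext \<tau> \<tau>" by auto
qed

context rational_space
begin

lemma fg_ext: "fg \<tau> \<Longrightarrow> fg \<rho> \<Longrightarrow> fg (ext \<tau> \<rho>)"
proof -
  assume *: "fg \<tau>" "fg \<rho>"
  have "span \<tau> = {x - y | x y. x \<in> \<tau> \<and> y \<in> \<tau>}"
  proof
    show "span \<tau> \<subseteq> {x - y | x y. x \<in> \<tau> \<and> y \<in> \<tau>}"
      using convex_cone_span_diff[OF fg_convex_cone[OF *(1)]] by blast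
    show "{x - y | x y. x \<in> \<tau> \<and> y \<in> \<tau>} \<subseteq> span \<tau>" by (auto intro: span_diff span_base)
  qed
  then have "fg (span \<tau>)" using fg_diff[OF *(1,1)] by simp
  then show ?thesis unfolding ext_def by (rule fg_sum[OF *(2)])
qed

text \<open>By \<open>ext_iff\<close> a point belongs to a star cell as soon as a large multiple of
  \<open>b\<close> moves it into the original cell. Finitely many such statements hold with a common
  multiple (\<open>ext_larger\<close>), so faces and intersections in the star reduce to those in
  \<open>N\<close>.\<close>

lemma lfan_star:
  assumes N: "lfan L N" and \<tau>: "\<tau> \<in> N"
  shows "lfan (span \<tau>) (star N \<tau>)"
proof -
  obtain b where b: "core b \<tau>" using exists_rational_core[OF lfanD(4)[OF N \<tau>]] by blast
  have b\<tau>: "b \<in> \<tau>" using b by (simp add: core_def)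
  have C: "convex_cone \<rho>" if "\<rho> \<in> N" for \<rho> by (rule lfanD(8)[OF N that])
  have fgE: "fg (ext \<tau> \<rho>)" if "\<rho> \<in> N" for \<rho> by (rule fg_ext[OF lfanD(4)[OF N \<tau>] lfanD(4)[OF N that]])
  have iff: "x \<in> ext \<tau> \<rho> \<longleftrightarrow> (\<exists>M\<ge>0. x + M *\<^sub>R b \<in> \<rho>)" if "\<rho> \<in> N" "\<tau> \<subseteq> \<rho>" for x \<rho>
    by (rule ext_iff[OF C[OF that(1)] that(2) b])
  have sp: "span \<tau> \<subseteq> ext \<tau> \<rho>" if "\<rho> \<in> N" "\<tau> \<subseteq> \<rho>" for \<rho>
    using ext_self[OF C[OF \<tau>]] that(2) unfolding ext_def by blast
  show ?thesis
    unfolding lfan_def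
  proof (intro conjI ballI allI impI)
    show "finite (star N \<tau>)" unfolding star_def using lfanD(1)[OF N] by simp
    show "subspace (span \<tau>)" by (rule subspace_span)
    show "span \<tau> \<in> star N \<tau>" unfolding star_def
      by (rule image_eqI[of _ _ \<tau>]) (use \<tau> ext_self[OF C[OF \<tau>]] in auto)
    fix \<sigma> assume "\<sigma> \<in> star N \<tau>"
    then obtain \<rho> where \<rho>: "\<rho> \<in> N" "\<tau> \<subseteq> \<rho>" "\<sigma> = ext \<tau> \<rho>" unfolding star_def by blast
    show "fg \<sigma>" unfolding \<rho>(3) by (rule fgE[OF \<rho>(1)])
    show "span \<tau> \<subseteq> \<sigma>" unfolding \<rho>(3) by (rule sp[OF \<rho>(1,2)])
    { fix \<phi> assume F: "cface \<phi> \<sigma>"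
      have \<tau>\<phi>: "\<tau> \<subseteq> \<phi>"
      proof
        fix t assume t: "t \<in> \<tau>"
        then have "t \<in> \<sigma>" "- t \<in> \<sigma>" using sp[OF \<rho>(1,2)] \<rho>(3) span_base span_neg by blast+
        moreover have "t + - t \<in> \<phi>" using convex_cone_contains_0[OF cface_convex_cone[OF F]] by simp
        ultimately show "t \<in> \<phi>" by (rule cface_left[OF F])
      qed
      \<comment> \<open>A face of the star cell is traced on the original cell; the trace is a
        member of \<open>N\<close> containing \<tau>, and extending it gives the face back.\<close>
      have "cface (\<phi> \<inter> \<rho>) \<rho>"
        unfolding cface_def
      proof (intro conjI ballI impI)
        show "convex_cone (\<phi> \<inter> \<rho>)" by (rule convex_cone_Int[OF cface_convex_cone[OF F] C[OF \<rho>(1)]])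
        fix x y assume xy: "x \<in> \<rho>" "y \<in> \<rho>" "x + y \<in> \<phi> \<inter> \<rho>"
        then show "x \<in> \<phi> \<inter> \<rho>" using cface_left[OF F, of x y] \<rho>(3) subset_ext by blast
      qed simp
      then have \<phi>N: "\<phi> \<inter> \<rho> \<in> N" by (rule lfanD(6)[OF N \<rho>(1)])
      have \<tau>\<phi>': "\<tau> \<subseteq> \<phi> \<inter> \<rho>" using \<tau>\<phi> \<rho>(2) by blast
      have "\<phi> = ext \<tau> (\<phi> \<inter> \<rho>)"
      proof (intro Set.set_eqI iffI)
        fix x assume x: "x \<in> \<phi>"
        then obtain M where M: "M \<ge> 0" "x + M *\<^sub>R b \<in> \<rho>"
          using cface_subset[OF F] iff[OF \<rho>(1,2)] \<rho>(3) by blast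
        have "x + M *\<^sub>R b \<in> \<phi>"
          using x M(1) b\<tau> \<tau>\<phi> cface_convex_cone[OF F] by (blast intro: convex_cone_add convex_cone_scaleR)
        then show "x \<in> ext \<tau> (\<phi> \<inter> \<rho>)" using M iff[OF \<phi>N \<tau>\<phi>'] by blast
      next
        fix x assume "x \<in> ext \<tau> (\<phi> \<inter> \<rho>)"
        then obtain M where M: "M \<ge> 0" "x + M *\<^sub>R b \<in> \<phi> \<inter> \<rho>" using iff[OF \<phi>N \<tau>\<phi>'] by blast
        then have "x \<in> \<sigma>" using iff[OF \<rho>(1,2)] \<rho>(3) by blast
        moreover have "M *\<^sub>R b \<in> \<sigma>"
          using convex_cone_scaleR[OF C[OF \<tau>] M(1) b\<tau>] \<rho>(2,3) subset_ext by blast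
        ultimately show "x \<in> \<phi>" using cface_left[OF F] M(2) by blast
      qed
      then show "\<phi> \<in> star N \<tau>" unfolding star_def using \<phi>N \<tau>\<phi>' by blast }
    fix \<sigma>' assume "\<sigma>' \<in> star N \<tau>"
    then obtain \<rho>' where \<rho>': "\<rho>' \<in> N" "\<tau> \<subseteq> \<rho>'" "\<sigma>' = ext \<tau> \<rho>'" unfolding star_def by blast
    have I: "cface (\<rho> \<inter> \<rho>') \<rho>" by (rule lfanD(7)[OF N \<rho>(1) \<rho>'(1)])
    then have IN: "\<rho> \<inter> \<rho>' \<in> N" by (rule lfanD(6)[OF N \<rho>(1)])
    have I\<tau>: "\<tau> \<subseteq> \<rho> \<inter> \<rho>'" using \<rho>(2) \<rho>'(2) by blast
    have b\<rho>: "b \<in> \<rho>" "b \<in> \<rho>'" "b \<in> \<rho> \<inter> \<rho>'" using b\<tau> \<rho>(2) \<rho>'(2) by auto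
    have eq: "\<sigma> \<inter> \<sigma>' = ext \<tau> (\<rho> \<inter> \<rho>')"
    proof (intro Set.set_eqI iffI)
      fix x assume "x \<in> \<sigma> \<inter> \<sigma>'"
      then obtain M M' where M: "M \<ge> 0" "x + M *\<^sub>R b \<in> \<rho>" "M' \<ge> 0" "x + M' *\<^sub>R b \<in> \<rho>'"
        using iff[OF \<rho>(1,2)] iff[OF \<rho>'(1,2)] \<rho>(3) \<rho>'(3) by blast
      have "x + max M M' *\<^sub>R b \<in> \<rho>" by (rule ext_larger[OF C[OF \<rho>(1)] b\<rho>(1) M(2)]) simp
      moreover have "x + max M M' *\<^sub>R b \<in> \<rho>'" by (rule ext_larger[OF C[OF \<rho>'(1)] b\<rho>(2) M(4)]) simp
      moreover have "max M M' \<ge> 0" using M by simp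
      ultimately show "x \<in> ext \<tau> (\<rho> \<inter> \<rho>')" using iff[OF IN I\<tau>] by blast
    next
      fix x assume "x \<in> ext \<tau> (\<rho> \<inter> \<rho>')"
      then show "x \<in> \<sigma> \<inter> \<sigma>'" unfolding \<rho>(3) \<rho>'(3) ext_def by blast
    qed
    show "cface (\<sigma> \<inter> \<sigma>') \<sigma>"
      unfolding cface_def
    proof (intro conjI ballI impI)
      show "convex_cone (\<sigma> \<inter> \<sigma>')" unfolding eq by (rule fg_convex_cone[OF fgE[OF IN]])
      fix x y assume x: "x \<in> \<sigma>" "y \<in> \<sigma>" "x + y \<in> \<sigma> \<inter> \<sigma>'"
      obtain M1 where M1: "M1 \<ge> 0" "x + M1 *\<^sub>R b \<in> \<rho>" using x(1) iff[OF \<rho>(1,2)] \<rho>(3) by blast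
      obtain M2 where M2: "M2 \<ge> 0" "y + M2 *\<^sub>R b \<in> \<rho>" using x(2) iff[OF \<rho>(1,2)] \<rho>(3) by blast
      obtain M3 where M3: "M3 \<ge> 0" "x + y + M3 *\<^sub>R b \<in> \<rho> \<inter> \<rho>'"
        using x(3) iff[OF IN I\<tau>] unfolding eq by blast
      define M where "M = max M1 (max M2 M3)"
      have 1: "x + M *\<^sub>R b \<in> \<rho>" by (rule ext_larger[OF C[OF \<rho>(1)] b\<rho>(1) M1(2)]) (simp add: M_def)
      have 2: "y + M *\<^sub>R b \<in> \<rho>" by (rule ext_larger[OF C[OF \<rho>(1)] b\<rho>(1) M2(2)]) (simp add: M_def)
      \<comment> \<open>The doubled multiplier makes this point the sum of the two shifted points,
        to which the face property in \<open>N\<close> applies.\<close>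
      have "x + y + (M + M) *\<^sub>R b \<in> \<rho> \<inter> \<rho>'"
        by (rule ext_larger[OF C[OF IN] b\<rho>(3) M3(2)]) (use M1(1) M2(1) M3(1) in \<open>auto simp: M_def\<close>)
      moreover have "x + y + (M + M) *\<^sub>R b = (x + M *\<^sub>R b) + (y + M *\<^sub>R b)"
        unfolding scaleR_add_left by (simp add: ac_simps)
      ultimately have "x + M *\<^sub>R b \<in> \<rho> \<inter> \<rho>'" using cface_left[OF I 1 2] by metis
      moreover have "M \<ge> 0" using M1(1) by (simp add: M_def)
      ultimately show "x \<in> \<sigma> \<inter> \<sigma>'" unfolding eq using iff[OF IN I\<tau>] by blast
    qed simp
  qed
qed

text \<open>The tangent cone of the cell \<open>jset \<kappa> E1\<close> along cone
  \<open>E\<close>: coefficients on \<open>E\<close> may become negative.\<close>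

definition dset :: "'a set \<Rightarrow> 'a set \<Rightarrow> 'a set \<Rightarrow> 'a set" where
  "dset \<kappa> E1 E = {x - y | x y. x \<in> jset \<kappa> E1 \<and> y \<in> convex_cone hull E}"

text \<open>The vector \<open>y\<close> witnesses that the cells containing \<open>cone E\<close> leave a gap there: \<open>y\<close> is in none of
  their tangent cones along \<open>cone E\<close>.  A single witness per \<open>E\<close> survives small perturbations.\<close>

definition tight :: "('a set \<times> 'a set) set \<Rightarrow> bool" where
  "tight P \<longleftrightarrow> (\<forall>\<kappa> E. (\<kappa>, E) \<in> P \<longrightarrow> E \<noteq> {} \<longrightarrow>
     (\<exists>y\<in>V. \<forall>\<kappa>1 E1. (\<kappa>1, E1) \<in> P \<longrightarrow> E \<subseteq> E1 \<longrightarrow> y \<notin> dset \<kappa>1 E1 E))"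

text \<open>A simplicial part attached to \<open>L\<close> alone could be a cell of too small
  dimension. A base cone larger than \<open>L\<close> has core points that become interior to the
  support, and these force a full-dimensional cell around the join.\<close>

definition based :: "'a set \<Rightarrow> ('a set \<times> 'a set) set \<Rightarrow> bool" where
  "based L P \<longleftrightarrow> (\<forall>\<kappa> E. (\<kappa>, E) \<in> P \<longrightarrow> E \<noteq> {} \<longrightarrow> (\<exists>\<kappa>'. \<kappa>' \<noteq> L \<and> cface \<kappa> \<kappa>' \<and> (\<kappa>', E) \<in> P))"

lemma joinc_base_subset:
  assumes "joinc S P" "\<tau> \<in> S" "(\<kappa>, E) \<in> P" "\<tau> \<subseteq> jset \<kappa> E"
  shows "\<tau> \<subseteq> \<kappa>"
proof
  fix t assume t: "t \<in> \<tau>"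
  then obtain s a where sa: "s \<in> \<kappa>" "a \<in> coef E" "t = s + vs a" using assms(4) by (auto elim!: jsetE)
  have "t = s" using joinc_inj(1)[OF assms(1) joincD(2)[OF assms(1,2)] assms(3) t sa(1) coef_zero sa(2)] sa(3) by simp
  then show "t \<in> \<kappa>" using sa(1) by simp
qed

end

text \<open>Every smallness requirement on \<epsilon> is positivity of a form that is already
  positive at \<open>b\<close>. As an eventual property of \<open>n\<close> it can be imposed
  finitely often with one \<open>n\<close>.\<close>

lemma eventually_perturbed_pos:
  fixes u :: "'a::euclidean_space \<Rightarrow> real"
  assumes "linear u" "u b > 0" "finite F"
  shows "eventually (\<lambda>n. \<forall>f\<in>F. u (b + (1 / real (Suc n)) *\<^sub>R f) > 0) sequentially"
proof -
  have "eventually (\<lambda>n. u (b + (1 / real (Suc n)) *\<^sub>R f) > 0) sequentially" for f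
  proof -
    have "(\<lambda>n. u b + (1 / real (Suc n)) * u f) \<longlonglongrightarrow> u b + 0 * u f"
      using LIMSEQ_inverse_real_of_nat by (intro tendsto_add tendsto_mult tendsto_const) (simp add: inverse_eq_divide)
    then have "eventually (\<lambda>n. u b + (1 / real (Suc n)) * u f > 0) sequentially"
      using assms(2) by (intro order_tendstoD(1)) auto
    then show ?thesis by (simp add: linear_add[OF assms(1)] linear_scale[OF assms(1)])
  qed
  then show ?thesis using assms(3) by (simp add: eventually_ball_finite)
qed

text \<open>\<open>Q\<close> completes the star of \<open>\<tau>\<close> modulo the span of \<open>\<tau>\<close>; the assumptions \<open>sep\<close> and \<open>sepy\<close> hold as
  soon as \<open>\<epsilon>\<close> is small enough.\<close>

locale star_completion = rational_space +
  fixes L :: "'a set" and S P \<tau> Q b and \<epsilon> :: real and y :: "'a set \<Rightarrow> 'a"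
  assumes S: "lfan L S" and P: "joinc S P" and \<tau>: "\<tau> \<in> S" "\<tau> \<noteq> L" and b: "b \<in> W" "core b \<tau>"
    and Q: "joinc (star (cells P) \<tau>) Q" and Qc: "\<Union>(cells Q) = V" and \<epsilon>: "\<epsilon> > 0" "\<epsilon> \<in> K"
    and sep: "\<And>\<kappa>1 E1 \<kappa>2 E2. (\<kappa>1, E1) \<in> P \<Longrightarrow> \<tau> \<subseteq> \<kappa>1 \<Longrightarrow> (\<kappa>2, E2) \<in> P \<Longrightarrow> \<not> \<tau> \<subseteq> \<kappa>2 \<Longrightarrow>
      \<exists>u::'a \<Rightarrow> real. linear u \<and> (\<forall>x\<in>jset \<kappa>1 E1. 0 \<le> u x) \<and> (\<forall>x\<in>jset \<kappa>2 E2. u x \<le> 0) \<and>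
        (\<forall>f\<in>\<Union>(snd ` Q). u (b + \<epsilon> *\<^sub>R f) > 0)"
    and y: "\<And>\<kappa> E. (\<kappa>, E) \<in> P \<Longrightarrow> E \<noteq> {} \<Longrightarrow>
      y E \<in> V \<and> (\<forall>\<kappa>1 E1. (\<kappa>1, E1) \<in> P \<longrightarrow> E \<subseteq> E1 \<longrightarrow> y E \<notin> dset \<kappa>1 E1 E)"
    and sepy: "\<And>\<kappa> E0 E. (\<kappa>, E0) \<in> P \<Longrightarrow> \<tau> \<subseteq> \<kappa> \<Longrightarrow> E \<subseteq> E0 \<Longrightarrow> E \<noteq> {} \<Longrightarrow>
      \<exists>u::'a \<Rightarrow> real. linear u \<and> (\<forall>x\<in>dset \<kappa> E0 E. 0 \<le> u x) \<and> u (y E) < 0 \<and>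
        (\<forall>f\<in>\<Union>(snd ` Q). u (b + \<epsilon> *\<^sub>R f) > 0)"
    and based: "based L P"
begin

definition "FF = \<Union>(snd ` Q)"
definition "h f = b + \<epsilon> *\<^sub>R f" for f
text \<open>A star cell comes from a pair with \<open>\<tau> \<subseteq> \<kappa>\<close>
  (\<open>joinc_base_subset\<close>); \<open>F\<close> is a simplex of \<open>Q\<close> over that
  star cell, to be lifted and attached to the pair.\<close>

definition triple :: "'a set \<Rightarrow> 'a set \<Rightarrow> 'a set \<Rightarrow> bool" where
  "triple \<kappa> E F \<longleftrightarrow> (\<kappa>, E) \<in> P \<and> \<tau> \<subseteq> \<kappa> \<and> (ext \<tau> (jset \<kappa> E), F) \<in> Q"
definition "New = {(\<kappa>', E' \<union> h ` F) | \<kappa>' E' F. \<exists>\<kappa> E. triple \<kappa> E F \<and> cface \<kappa>' \<kappa> \<and> E' \<subseteq> E}"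
definition "P' = P \<union> New"

lemma lfan_cells_P: "lfan L (cells P)"
  by (rule lfan_cells[OF S P])

lemma lfan_star_P: "lfan (span \<tau>) (star (cells P) \<tau>)"
  using lfan_star[OF lfan_cells_P] cells_subset_base[OF P] \<tau>(1) by blast

lemma b\<tau>: "b \<in> \<tau>"
  using b(2) by (simp add: core_def)

lemma tripleD:
  assumes "triple \<kappa> E F"
  shows "(\<kappa>, E) \<in> P" "\<tau> \<subseteq> \<kappa>" "(ext \<tau> (jset \<kappa> E), F) \<in> Q" "\<kappa> \<in> S" "F \<subseteq> FF" "finite E" "finite F" "b \<in> \<kappa>"
    "convex_cone \<kappa>"
proof -
  show *: "(\<kappa>, E) \<in> P" "\<tau> \<subseteq> \<kappa>" "(ext \<tau> (jset \<kappa> E), F) \<in> Q" using assms by (auto simp: triple_def)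
  show "\<kappa> \<in> S" "finite E" using joincD(3,4)[OF P *(1)] by auto
  then show "convex_cone \<kappa>" using lfanD(8)[OF S] by blast
  show "finite F" by (rule joincD(4)[OF Q *(3)])
  show "F \<subseteq> FF" unfolding FF_def using *(3) by (metis Union_upper imageI snd_conv)
  show "b \<in> \<kappa>" using *(2) b\<tau> by blast
qed

lemma star_mem: "(\<kappa>, E) \<in> P \<Longrightarrow> \<tau> \<subseteq> \<kappa> \<Longrightarrow> ext \<tau> (jset \<kappa> E) \<in> star (cells P) \<tau>"
proof -
  assume "(\<kappa>, E) \<in> P" "\<tau> \<subseteq> \<kappa>"
  then have "jset \<kappa> E \<in> cells P" "\<tau> \<subseteq> jset \<kappa> E" using cellsI subset_trans[OF _ jset_base] by metis+
  then show ?thesis unfolding star_def by (intro imageI CollectI conjI)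
qed

lemma triple_empty: "(\<kappa>, E) \<in> P \<Longrightarrow> \<tau> \<subseteq> \<kappa> \<Longrightarrow> triple \<kappa> E {}"
  unfolding triple_def using joincD(2)[OF Q star_mem] by blast

lemma h_inj: "h f = h g \<longleftrightarrow> f = g"
  using \<epsilon>(1) by (simp add: h_def)

lemma finite_FF: "finite FF"
proof -
  have "finite E" if "E \<in> snd ` Q" for E using that joincD(4)[OF Q] by auto
  then show ?thesis unfolding FF_def using joincD(1)[OF Q] by blast
qed

text \<open>Otherwise \<open>b\<close> would lie in the lineality space \<open>L\<close> and, as a
  core point, pull \<tau> into \<open>L\<close>, against \<open>\<tau> \<noteq> L\<close>. This
  makes \<open>- b\<close> available as the gap direction in \<open>tight_P'\<close>.\<close>

lemma neg_b_notin: "\<kappa> \<in> S \<Longrightarrow> \<tau> \<subseteq> \<kappa> \<Longrightarrow> - b \<notin> \<kappa>"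
proof
  assume *: "\<kappa> \<in> S" "\<tau> \<subseteq> \<kappa>" "- b \<in> \<kappa>"
  then have "b \<in> L" using lfan_lineality[OF S *(1)] b\<tau> by blast
  moreover have "cface L \<tau>" using lfan_face_iff[OF S lfanD(3)[OF S] \<tau>(1)] lfanD(5)[OF S \<tau>(1)] by simp
  ultimately have "\<tau> \<subseteq> L" using cface_core_subset[OF _ b(2), of L \<tau>] lfanD(8)[OF S \<tau>(1)] by blast
  then show False using lfanD(5)[OF S \<tau>(1)] \<tau>(2) by blast
qed

text \<open>If \<tau> is not contained in \<kappa>, the separating form is positive at
  \<open>h f\<close> but nonpositive on the cell. If it is, then \<open>f\<close> itself would lie
  in a star cell and have two representations in \<open>Q\<close>. Old and lifted coefficients can
  therefore be told apart.\<close>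

lemma h_notin:
  assumes "(\<kappa>, E) \<in> P" "f \<in> FF"
  shows "h f \<notin> E"
proof
  assume hE: "h f \<in> E"
  have 0: "0 \<in> \<kappa>" using lfanD(9)[OF S joincD(3)[OF P assms(1)]] .
  have hJ: "h f \<in> jset \<kappa> E" using jset_vertex[OF 0] hE by blast
  show False
  proof (cases "\<tau> \<subseteq> \<kappa>")
    case False
    obtain u :: "'a \<Rightarrow> real" where "\<forall>x\<in>jset \<kappa> E. u x \<le> 0" "\<forall>f\<in>\<Union>(snd ` Q). u (b + \<epsilon> *\<^sub>R f) > 0"
      using sep[OF joincD(2)[OF P \<tau>(1)] order_refl assms(1) False] by auto
    then have "u (h f) \<le> 0" "u (h f) > 0" using hJ assms(2) by (auto simp: FF_def h_def)
    then show False by simp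
  next
    case True
    obtain \<rho> F where F: "(\<rho>, F) \<in> Q" "f \<in> F" using assms(2) by (auto simp: FF_def)
    let ?\<sigma> = "ext \<tau> (jset \<kappa> E)"
    have \<sigma>: "?\<sigma> \<in> star (cells P) \<tau>" by (rule star_mem[OF assms(1) True])
    have "h f + (- b) \<in> ?\<sigma>" unfolding ext_def using hJ span_neg[OF span_base[OF b\<tau>]] by blast
    then have "\<epsilon> *\<^sub>R f \<in> ?\<sigma>" by (simp add: h_def)
    then have "(1 / \<epsilon>) *\<^sub>R \<epsilon> *\<^sub>R f \<in> ?\<sigma>"
      using convex_cone_scaleR[OF lfanD(8)[OF lfan_star_P \<sigma>], of "1 / \<epsilon>" "\<epsilon> *\<^sub>R f"] \<epsilon>(1) by simp
    then have f: "f \<in> ?\<sigma>" using \<epsilon>(1) by simp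
    have "0 \<in> \<rho>" by (rule lfanD(9)[OF lfan_star_P joincD(3)[OF Q F(1)]])
    from joinc_inj(2)[OF Q joincD(2)[OF Q \<sigma>] F(1) f this coef_zero ucoef_in[OF F(2)]]
    have "(\<lambda>v. 0) = ucoef f" by simp
    from fun_cong[OF this, of f] show False by (simp add: ucoef_def)
  qed
qed

text \<open>\<open>pull\<close> turns coefficients of the lifted vectors \<open>h f\<close> into those of the vectors \<open>f\<close> of \<open>Q\<close>; the
  difference is a multiple of \<open>b\<close>.\<close>

definition "resE E a = (\<lambda>v. if v \<in> E then a v else 0)" for E :: "'a set" and a :: "'a \<Rightarrow> real"
definition "pull F a = (\<lambda>f. if f \<in> F then \<epsilon> * a (h f) else 0)" for F :: "'a set" and a :: "'a \<Rightarrow> real"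

text \<open>Splits a combination into its old part, a multiple of \<open>b\<close> and a combination
  of unlifted vectors. Summing over all of \<open>FF\<close> instead of \<open>F\<close> lets the
  multiples of \<open>b\<close> from cells with different \<open>F\<close> be compared.\<close>

lemma decompose:
  assumes "triple \<kappa> E F" "a \<in> coef (E \<union> h ` F)"
  shows "resE E a \<in> coef E" "pull F a \<in> coef F"
    "vs a = vs (resE E a) + (\<Sum>f\<in>F. a (h f) *\<^sub>R h f)"
    "vs a = (\<Sum>f\<in>FF. a (h f)) *\<^sub>R b + vs (resE E a) + vs (pull F a)"
    "0 \<le> (\<Sum>f\<in>FF. a (h f))"
    "\<And>f. f \<in> FF \<Longrightarrow> pull F a f = \<epsilon> * a (h f)"
    "\<And>v. v \<notin> h ` FF \<Longrightarrow> a v = resE E a v"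
proof -
  note T = tripleD[OF assms(1)]
  note nn = coef_nonneg[OF assms(2)]
  show 1: "resE E a \<in> coef E" "pull F a \<in> coef F"
    using nn \<epsilon>(1) by (auto simp: coef_def resE_def pull_def)
  have disj: "E \<inter> h ` F = {}" using h_notin[OF T(1)] T(5) by blast
  have out: "a (h f) = 0" if "f \<in> FF" "f \<notin> F" for f
  proof -
    have "h f \<notin> h ` F" using that(2) h_inj by (metis imageE)
    then show ?thesis using coef_outside[OF assms(2), of "h f"] h_notin[OF T(1) that(1)] by simp
  qed
  have inj: "inj_on h F" using h_inj by (auto simp: inj_on_def)
  have "vs a = (\<Sum>v\<in>E \<union> h ` F. a v *\<^sub>R v)" by (rule vs_coef[OF _ assms(2)]) (use T(6,7) in auto)
  also have "\<dots> = (\<Sum>v\<in>E. a v *\<^sub>R v) + (\<Sum>v\<in>h ` F. a v *\<^sub>R v)"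
    by (rule sum.union_disjoint) (use T(6,7) disj in auto)
  also have "(\<Sum>v\<in>E. a v *\<^sub>R v) = vs (resE E a)"
    unfolding vs_coef[OF T(6) 1(1)] by (simp add: resE_def)
  also have "(\<Sum>v\<in>h ` F. a v *\<^sub>R v) = (\<Sum>f\<in>F. a (h f) *\<^sub>R h f)"
    by (simp add: sum.reindex[OF inj])
  finally show 2: "vs a = vs (resE E a) + (\<Sum>f\<in>F. a (h f) *\<^sub>R h f)" .
  have "(\<Sum>f\<in>F. a (h f) *\<^sub>R h f) = (\<Sum>f\<in>F. a (h f)) *\<^sub>R b + (\<Sum>f\<in>F. (\<epsilon> * a (h f)) *\<^sub>R f)"
    by (simp add: h_def scaleR_add_right sum.distrib scaleR_sum_left mult.commute)
  also have "(\<Sum>f\<in>F. (\<epsilon> * a (h f)) *\<^sub>R f) = vs (pull F a)"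
    unfolding vs_coef[OF T(7) 1(2)] by (simp add: pull_def)
  also have "(\<Sum>f\<in>F. a (h f)) = (\<Sum>f\<in>FF. a (h f))"
    by (rule sum.mono_neutral_left[OF finite_FF T(5)]) (use out in auto)
  finally show "vs a = (\<Sum>f\<in>FF. a (h f)) *\<^sub>R b + vs (resE E a) + vs (pull F a)" using 2 by simp
  show "0 \<le> (\<Sum>f\<in>FF. a (h f))" by (rule sum_nonneg) (rule nn)
  show "pull F a f = \<epsilon> * a (h f)" if "f \<in> FF" for f using out[OF that] by (simp add: pull_def)
  show "a v = resE E a v" if "v \<notin> h ` FF" for v
    using coef_outside[OF assms(2), of v] that T(5) by (auto simp: resE_def)
qed

text \<open>Uniqueness in \<open>Q\<close> identifies the coefficients of the new vectors, then uniqueness in \<open>P\<close> the rest.\<close>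

lemma inj_AA:
  assumes "triple \<kappa>1 E1 F1" "triple \<kappa>2 E2 F2" "s1 \<in> \<kappa>1" "s2 \<in> \<kappa>2" "a1 \<in> coef (E1 \<union> h ` F1)" "a2 \<in> coef (E2 \<union> h ` F2)"
    "s1 + vs a1 = s2 + vs a2"
  shows "s1 = s2 \<and> a1 = a2"
proof -
  note T1 = tripleD[OF assms(1)] and T2 = tripleD[OF assms(2)]
  note D1 = decompose[OF assms(1,5)] and D2 = decompose[OF assms(2,6)]
  \<comment> \<open>The multiple of \<open>b\<close> is absorbed into the base point, which stays in
    the cone because \<tau> is contained in both base cones.\<close>
  let ?t1 = "s1 + (\<Sum>f\<in>FF. a1 (h f)) *\<^sub>R b" and ?t2 = "s2 + (\<Sum>f\<in>FF. a2 (h f)) *\<^sub>R b"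
  have t: "?t1 \<in> \<kappa>1" "?t2 \<in> \<kappa>2"
    using convex_cone_add[OF T1(9) assms(3) convex_cone_scaleR[OF T1(9) D1(5) T1(8)]]
      convex_cone_add[OF T2(9) assms(4) convex_cone_scaleR[OF T2(9) D2(5) T2(8)]] by auto
  have e: "?t1 + vs (resE E1 a1) \<in> ext \<tau> (jset \<kappa>1 E1)" "?t2 + vs (resE E2 a2) \<in> ext \<tau> (jset \<kappa>2 E2)"
    using jsetI[OF t(1) D1(1)] jsetI[OF t(2) D2(1)] subset_ext by blast+
  have eq: "(?t1 + vs (resE E1 a1)) + vs (pull F1 a1) = (?t2 + vs (resE E2 a2)) + vs (pull F2 a2)"
    using assms(7) unfolding D1(4) D2(4) by (simp add: algebra_simps)
  note I = joinc_inj[OF Q T1(3) T2(3) e D1(2) D2(2) eq]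
  have ah: "a1 (h f) = a2 (h f)" if "f \<in> FF" for f
    using fun_cong[OF I(2), of f] D1(6)[OF that] D2(6)[OF that] \<epsilon>(1) by simp
  then have "(\<Sum>f\<in>FF. a1 (h f)) = (\<Sum>f\<in>FF. a2 (h f))" by simp
  then have "s1 + vs (resE E1 a1) = s2 + vs (resE E2 a2)" using I(1) by simp
  note J = joinc_inj[OF P T1(1) T2(1) assms(3,4) D1(1) D2(1) this]
  have "a1 v = a2 v" for v
  proof (cases "v \<in> h ` FF")
    case True
    then show ?thesis using ah by auto
  next
    case False
    then show ?thesis using D1(7)[OF False] D2(7)[OF False] J(2) by simp
  qed
  then show ?thesis using J(1) by auto
qed

text \<open>The form from \<open>sep\<close> is nonnegative on the old part, positive on the lifted
  vectors and nonpositive on the second cell. A common point thus uses no lifted vector, and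
  uniqueness in \<open>P\<close> takes over.\<close>

lemma inj_AB:
  assumes "triple \<kappa>1 E1 F1" "(\<kappa>2, E2) \<in> P" "\<not> \<tau> \<subseteq> \<kappa>2" "s1 \<in> \<kappa>1" "s2 \<in> \<kappa>2" "a1 \<in> coef (E1 \<union> h ` F1)" "a2 \<in> coef E2"
    "s1 + vs a1 = s2 + vs a2"
  shows "s1 = s2 \<and> a1 = a2"
proof -
  note T1 = tripleD[OF assms(1)]
  note D1 = decompose[OF assms(1,6)]
  obtain u :: "'a \<Rightarrow> real" where u: "linear u" "\<forall>x\<in>jset \<kappa>1 E1. 0 \<le> u x" "\<forall>x\<in>jset \<kappa>2 E2. u x \<le> 0" "\<forall>f\<in>FF. u (h f) > 0"
    using sep[OF T1(1,2) assms(2,3)] unfolding FF_def h_def by blast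
  have "u (s1 + vs a1) = u (s1 + vs (resE E1 a1)) + (\<Sum>f\<in>F1. a1 (h f) * u (h f))"
    unfolding D1(3) by (simp add: linear_add[OF u(1)] linear_sum[OF u(1)] linear_scale[OF u(1)])
  moreover have "u (s1 + vs a1) \<le> 0" unfolding assms(8) using u(3) jsetI[OF assms(5,7)] by blast
  moreover have "0 \<le> u (s1 + vs (resE E1 a1))" using u(2) jsetI[OF assms(4) D1(1)] by blast
  moreover have nn: "0 \<le> a1 (h f) * u (h f)" if "f \<in> F1" for f
    using u(4) that T1(5) coef_nonneg[OF assms(6)] by (simp add: less_imp_le subset_iff)
  then have "0 \<le> (\<Sum>f\<in>F1. a1 (h f) * u (h f))" by (rule sum_nonneg)
  ultimately have "(\<Sum>f\<in>F1. a1 (h f) * u (h f)) = 0" by linarith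
  moreover have "(\<Sum>f\<in>F1. a1 (h f) * u (h f)) = 0 \<longleftrightarrow> (\<forall>f\<in>F1. a1 (h f) * u (h f) = 0)"
    by (rule sum_nonneg_eq_0_iff[OF T1(7)]) (rule nn)
  ultimately have "\<forall>f\<in>F1. a1 (h f) * u (h f) = 0" by simp
  then have z: "a1 (h f) = 0" if "f \<in> F1" for f using that u(4) T1(5) by fastforce
  have "a1 \<in> coef E1" using assms(6) z by (auto simp: coef_def)
  from joinc_inj[OF P T1(1) assms(2,4,5) this assms(7,8)] show ?thesis by blast
qed

lemma P'_cases:
  assumes "(\<kappa>', E') \<in> P'" "s \<in> \<kappa>'" "a \<in> coef E'"
  obtains \<kappa> E F where "triple \<kappa> E F" "s \<in> \<kappa>" "a \<in> coef (E \<union> h ` F)"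
  | "(\<kappa>', E') \<in> P" "\<not> \<tau> \<subseteq> \<kappa>'"
proof (cases "(\<kappa>', E') \<in> P")
  case True
  show thesis
  proof (cases "\<tau> \<subseteq> \<kappa>'")
    case t: True
    show thesis by (rule that(1)[OF triple_empty[OF True t] assms(2)]) (use assms(3) in simp)
  qed (use that(2) True in blast)
next
  case False
  then have "(\<kappa>', E') \<in> New" using assms(1) by (simp add: P'_def)
  then obtain E0 F \<kappa> E where *: "E' = E0 \<union> h ` F" "triple \<kappa> E F" "cface \<kappa>' \<kappa>" "E0 \<subseteq> E"
    unfolding New_def by blast
  show thesis
  proof (rule that(1)[OF *(2)])
    show "s \<in> \<kappa>" using assms(2) cface_subset[OF *(3)] by blast
    have "E' \<subseteq> E \<union> h ` F" using *(1,4) by blast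
    then show "a \<in> coef (E \<union> h ` F)" using assms(3) coef_mono by blast
  qed
qed

lemma New_face:
  assumes "triple \<kappa> E F" "cface \<kappa>' \<kappa>" "E' \<subseteq> E \<union> h ` F"
  shows "(\<kappa>', E') \<in> New"
proof -
  let ?F = "{f\<in>F. h f \<in> E'}"
  have "cface (ext \<tau> (jset \<kappa> E)) (ext \<tau> (jset \<kappa> E))"
    using lfanD(8)[OF lfan_star_P joincD(3)[OF Q tripleD(3)[OF assms(1)]]] by (rule cface_refl)
  then have "triple \<kappa> E ?F"
    using tripleD(1,2)[OF assms(1)] joincD(6)[OF Q tripleD(3)[OF assms(1)], of _ ?F] unfolding triple_def by blast
  moreover have "E' = (E' \<inter> E) \<union> h ` ?F" using assms(3) by blast
  ultimately show ?thesis unfolding New_def using assms(2) by blast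
qed

lemma joinc_P': "joinc S P'"
proof (rule joincI)
  have "New \<subseteq> S \<times> Pow (\<Union>(snd ` P) \<union> h ` FF)"
  proof
    fix p assume "p \<in> New"
    then obtain \<kappa>' E' F \<kappa> E where *: "p = (\<kappa>', E' \<union> h ` F)" "triple \<kappa> E F" "cface \<kappa>' \<kappa>" "E' \<subseteq> E"
      unfolding New_def by blast
    have "\<kappa>' \<in> S" by (rule lfanD(6)[OF S tripleD(4)[OF *(2)] *(3)])
    moreover have "E \<subseteq> \<Union>(snd ` P)" using tripleD(1)[OF *(2)] by (metis Union_upper imageI snd_conv)
    ultimately show "p \<in> S \<times> Pow (\<Union>(snd ` P) \<union> h ` FF)" using *(1,4) tripleD(5)[OF *(2)] by auto
  qed
  moreover have "finite (\<Union>(snd ` P))" using joincD(1,4)[OF P] by auto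
  ultimately have "finite New" using lfanD(1)[OF S] finite_FF
    by (meson finite_Pow_iff finite_SigmaI finite_UnI finite_imageI finite_subset)
  then show "finite P'" using joincD(1)[OF P] by (simp add: P'_def)
  show "(\<kappa>, {}) \<in> P'" if "\<kappa> \<in> S" for \<kappa> using joincD(2)[OF P that] by (simp add: P'_def)
next
  fix \<kappa>' E' assume "(\<kappa>', E') \<in> P'"
  then consider "(\<kappa>', E') \<in> P" | "(\<kappa>', E') \<in> New" by (auto simp: P'_def)
  then show "\<kappa>' \<in> S \<and> finite E' \<and> E' \<subseteq> W"
  proof cases
    case 1
    then show ?thesis using joincD(3,4,5)[OF P] by blast
  next
    case 2
    then obtain E0 F \<kappa> E where *: "E' = E0 \<union> h ` F" "triple \<kappa> E F" "cface \<kappa>' \<kappa>" "E0 \<subseteq> E"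
      unfolding New_def by blast
    have "h f \<in> W" if "f \<in> F" for f
      unfolding h_def using joincD(5)[OF Q tripleD(3)[OF *(2)]] that by (intro W_add b(1) W_scale \<epsilon>(2)) auto
    then show ?thesis using *(1,4) tripleD(6,7)[OF *(2)] joincD(5)[OF P tripleD(1)[OF *(2)]]
        lfanD(6)[OF S tripleD(4)[OF *(2)] *(3)] by (auto intro: finite_subset)
  qed
next
  fix \<kappa>' E' \<kappa>'' E'' assume *: "(\<kappa>', E') \<in> P'" "cface \<kappa>'' \<kappa>'" "E'' \<subseteq> E'"
  then consider "(\<kappa>', E') \<in> P" | "(\<kappa>', E') \<in> New" by (auto simp: P'_def)
  then show "(\<kappa>'', E'') \<in> P'"
  proof cases
    case 1
    then show ?thesis using joincD(6)[OF P 1 *(2,3)] by (simp add: P'_def)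
  next
    case 2
    then obtain E0 F \<kappa> E where N: "E' = E0 \<union> h ` F" "triple \<kappa> E F" "cface \<kappa>' \<kappa>" "E0 \<subseteq> E"
      unfolding New_def by blast
    have "E'' \<subseteq> E \<union> h ` F" using N(1,4) *(3) by blast
    from New_face[OF N(2) cface_trans[OF *(2) N(3)] this] show ?thesis by (simp add: P'_def)
  qed
next
  fix \<kappa>1 E1 \<kappa>2 E2 s1 s2 a1 a2
  assume *: "(\<kappa>1, E1) \<in> P'" "(\<kappa>2, E2) \<in> P'" "s1 \<in> \<kappa>1" "s2 \<in> \<kappa>2" "a1 \<in> coef E1" "a2 \<in> coef E2" "s1 + vs a1 = s2 + vs a2"
  show "s1 = s2 \<and> a1 = a2"
  proof (cases rule: P'_cases[OF *(1,3,5)])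
    case A: (1 \<kappa> E F)
    show ?thesis
    proof (cases rule: P'_cases[OF *(2,4,6)])
      case (1 \<kappa>' E' F')
      show ?thesis by (rule inj_AA[OF A(1) 1(1) A(2) 1(2) A(3) 1(3) *(7)])
    next
      case 2
      show ?thesis by (rule inj_AB[OF A(1) 2 A(2) *(4) A(3) *(6,7)])
    qed
  next
    case B: 2
    show ?thesis
    proof (cases rule: P'_cases[OF *(2,4,6)])
      case (1 \<kappa>' E' F')
      show ?thesis using inj_AB[OF 1(1) B 1(2) *(3) 1(3) *(5) *(7)[symmetric]] by blast
    next
      case 2
      show ?thesis using joinc_inj[OF P B(1) 2(1) *(3-7)] by blast
    qed
  qed
qed

lemma P_subset: "P \<subseteq> P'"
  by (simp add: P'_def)

lemma based_P': "based L P'"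
  unfolding based_def
proof (intro allI impI)
  fix \<kappa>' E' assume *: "(\<kappa>', E') \<in> P'" "E' \<noteq> {}"
  then consider "(\<kappa>', E') \<in> P" | "(\<kappa>', E') \<in> New" by (auto simp: P'_def)
  then show "\<exists>\<kappa>. \<kappa> \<noteq> L \<and> cface \<kappa>' \<kappa> \<and> (\<kappa>, E') \<in> P'"
  proof cases
    case 1
    from based[unfolded based_def, rule_format, OF 1 *(2)] obtain \<kappa> where
      "\<kappa> \<noteq> L" "cface \<kappa>' \<kappa>" "(\<kappa>, E') \<in> P" by blast
    then show ?thesis by (auto simp: P'_def)
  next
    case 2
    then obtain E0 F \<kappa> E where N: "E' = E0 \<union> h ` F" "triple \<kappa> E F" "cface \<kappa>' \<kappa>" "E0 \<subseteq> E"
      unfolding New_def by blast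
    note T = tripleD[OF N(2)]
    have "E' \<subseteq> E \<union> h ` F" using N by blast
    from New_face[OF N(2) cface_refl[OF T(9)] this] have "(\<kappa>, E') \<in> P'" by (simp add: P'_def)
    moreover have "\<kappa> \<noteq> L" using T(2) \<tau>(2) lfanD(5)[OF S \<tau>(1)] by blast
    ultimately show ?thesis using N(3) by blast
  qed
qed

text \<open>If \<open>E0\<close> contains a lifted vector, each pair above it is new and lies over
  some \<kappa> with \<open>b \<in> \<kappa>\<close>; uniqueness turns \<open>- b\<close> in the
  tangent cone into \<open>- b \<in> \<kappa>\<close>, so \<open>- b\<close> witnesses the gap.
  Otherwise the old witness \<open>y E0\<close> survives: the form from \<open>sepy\<close> is
  negative there, nonnegative on the old tangent cone and positive on the lifted vectors.\<close>

lemma tight_P': "tight P'"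
  unfolding tight_def
proof (intro allI impI)
  fix \<kappa>0 E0 assume *: "(\<kappa>0, E0) \<in> P'" "E0 \<noteq> {}"
  show "\<exists>y\<in>V. \<forall>\<kappa>1 E1. (\<kappa>1, E1) \<in> P' \<longrightarrow> E0 \<subseteq> E1 \<longrightarrow> y \<notin> dset \<kappa>1 E1 E0"
  proof (cases "E0 \<inter> h ` FF = {}")
    case False
    then obtain f where f: "f \<in> FF" "h f \<in> E0" by blast
    have "- b \<notin> dset \<kappa>1 E1 E0" if 1: "(\<kappa>1, E1) \<in> P'" "E0 \<subseteq> E1" for \<kappa>1 E1
    proof
      assume "- b \<in> dset \<kappa>1 E1 E0"
      then obtain p q where pq: "- b = p - q" "p \<in> jset \<kappa>1 E1" "q \<in> convex_cone hull E0" unfolding dset_def by blast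
      obtain s a where sa: "s \<in> \<kappa>1" "a \<in> coef E1" "p = s + vs a" using pq(2) by (rule jsetE)
      obtain c where c: "c \<in> coef E0" "q = vs c"
        using pq(3) convex_cone_hull_finite[OF joincD(4)[OF joinc_P' *(1)]] by blast
      have "(\<kappa>1, E1) \<notin> P" using h_notin f 1(2) by blast
      then have "(\<kappa>1, E1) \<in> New" using 1(1) by (simp add: P'_def)
      then obtain E' F \<kappa> E where N: "E1 = E' \<union> h ` F" "triple \<kappa> E F" "cface \<kappa>1 \<kappa>" "E' \<subseteq> E"
        unfolding New_def by blast
      note T = tripleD[OF N(2)]
      have E1: "E1 \<subseteq> E \<union> h ` F" using N by blast
      have KP: "(\<kappa>, E1) \<in> P'" using New_face[OF N(2) cface_refl[OF T(9)] E1] by (simp add: P'_def)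
      have sb: "s + b \<in> \<kappa>" using convex_cone_add[OF T(9) _ T(8)] sa(1) cface_subset[OF N(3)] by blast
      have cE1: "c \<in> coef E1" using c(1) coef_mono[OF 1(2)] by blast
      have "(s + b) + vs a = 0 + vs c" using pq(1) sa(3) c(2) by (simp add: algebra_simps)
      from joinc_inj(1)[OF joinc_P' KP KP sb convex_cone_contains_0[OF T(9)] sa(2) cE1 this]
      have "s = - b" by (simp add: add_eq_0_iff2)
      then show False using neg_b_notin[OF T(4,2)] sa(1) cface_subset[OF N(3)] by blast
    qed
    moreover have "- b \<in> V" using b(1) W_subset_V subspace_neg[OF subspace_V] by blast
    ultimately show ?thesis by blast
  next
    case True
    have "\<exists>\<kappa>. (\<kappa>, E0) \<in> P"
    proof (cases "(\<kappa>0, E0) \<in> P")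
      case False
      then have "(\<kappa>0, E0) \<in> New" using *(1) by (simp add: P'_def)
      then obtain E' F \<kappa> E where N: "E0 = E' \<union> h ` F" "triple \<kappa> E F" "cface \<kappa>0 \<kappa>" "E' \<subseteq> E"
        unfolding New_def by blast
      have "F = {}" using True N(1) tripleD(5)[OF N(2)] by blast
      then show ?thesis using joincD(6)[OF P tripleD(1)[OF N(2)] N(3,4)] N(1) by auto
    qed blast
    then obtain \<kappa> where \<kappa>: "(\<kappa>, E0) \<in> P" by blast
    note Y = y[OF \<kappa> *(2)]
    have "y E0 \<notin> dset \<kappa>1 E1 E0" if 1: "(\<kappa>1, E1) \<in> P'" "E0 \<subseteq> E1" for \<kappa>1 E1
    proof (cases "(\<kappa>1, E1) \<in> P")
      case T: True
      then show ?thesis using Y 1(2) by blast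
    next
      case False
      then have "(\<kappa>1, E1) \<in> New" using 1(1) by (simp add: P'_def)
      then obtain E' F \<kappa> E where N: "E1 = E' \<union> h ` F" "triple \<kappa> E F" "cface \<kappa>1 \<kappa>" "E' \<subseteq> E"
        unfolding New_def by blast
      note T = tripleD[OF N(2)]
      have E0: "E0 \<subseteq> E" using True 1(2) N(1,4) T(5) by blast
      obtain u :: "'a \<Rightarrow> real" where u: "linear u" "\<forall>x\<in>dset \<kappa> E E0. 0 \<le> u x" "u (y E0) < 0" "\<forall>f\<in>FF. u (h f) > 0"
        using sepy[OF T(1,2) E0 *(2)] unfolding FF_def h_def by blast
      show ?thesis
      proof
        assume "y E0 \<in> dset \<kappa>1 E1 E0"
        then obtain p q where pq: "y E0 = p - q" "p \<in> jset \<kappa>1 E1" "q \<in> convex_cone hull E0" unfolding dset_def by blast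
        obtain s a where sa: "s \<in> \<kappa>1" "a \<in> coef E1" "p = s + vs a" using pq(2) by (rule jsetE)
        have s\<kappa>: "s \<in> \<kappa>" using sa(1) cface_subset[OF N(3)] by blast
        have "E1 \<subseteq> E \<union> h ` F" using N by blast
        then have a: "a \<in> coef (E \<union> h ` F)" using sa(2) coef_mono by blast
        note D = decompose[OF N(2) a]
        have "(s + vs (resE E a)) - q \<in> dset \<kappa> E E0"
          unfolding dset_def using jsetI[OF s\<kappa> D(1)] pq(3) by blast
        then have "0 \<le> u ((s + vs (resE E a)) - q)" using u(2) by blast
        moreover have "0 \<le> (\<Sum>f\<in>F. a (h f) * u (h f))"
          by (rule sum_nonneg) (use u(4) T(5) coef_nonneg[OF a] in \<open>auto simp: less_imp_le subset_iff\<close>)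
        moreover have "u (y E0) = u ((s + vs (resE E a)) - q) + (\<Sum>f\<in>F. a (h f) * u (h f))"
          unfolding pq(1) sa(3) D(3)
          by (simp add: linear_add[OF u(1)] linear_diff[OF u(1)] linear_sum[OF u(1)] linear_scale[OF u(1)])
        ultimately show False using u(3) by simp
      qed
    qed
    then show ?thesis using Y by blast
  qed
qed

text \<open>Each \<open>z\<close> lies in a cell of \<open>Q\<close>, whose vectors are
  \<open>f = (h f - b) / \<epsilon>\<close>. The negative multiple of \<open>b\<close> and the span
  of \<tau> inside the star cell are both compensated by a multiple of \<open>x\<close>, a core
  point of \<tau>.\<close>

lemma intpt_P':
  assumes "core x \<tau>"
  shows "intpt (cells P') x"
  unfolding intpt_def
proof
  fix z assume "z \<in> V"
  then obtain \<rho> where "z \<in> \<rho>" "\<rho> \<in> cells Q" using Qc by blast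
  then obtain \<sigma> F where F: "(\<sigma>, F) \<in> Q" "z \<in> jset \<sigma> F" by (auto elim!: cellsE)
  obtain r c where rc: "r \<in> \<sigma>" "c \<in> coef F" "z = r + vs c" using F(2) by (rule jsetE)
  have "\<sigma> \<in> star (cells P) \<tau>" by (rule joincD(3)[OF Q F(1)])
  then obtain \<rho> where \<rho>: "\<rho> \<in> cells P" "\<tau> \<subseteq> \<rho>" "\<sigma> = ext \<tau> \<rho>" unfolding star_def by blast
  obtain \<kappa> E where \<kappa>: "(\<kappa>, E) \<in> P" "\<rho> = jset \<kappa> E" using \<rho>(1) by (rule cellsE)
  have \<tau>\<kappa>: "\<tau> \<subseteq> \<kappa>" using joinc_base_subset[OF P \<tau>(1) \<kappa>(1)] \<rho>(2) \<kappa>(2) by simp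
  have T: "triple \<kappa> E F" unfolding triple_def using \<kappa> \<tau>\<kappa> F(1) \<rho>(3) by simp
  note D = tripleD[OF T]
  let ?J = "jset \<kappa> (E \<union> h ` F)"
  have inP: "(\<kappa>, E \<union> h ` F) \<in> P'" using New_face[OF T cface_refl[OF D(9)] order_refl] by (simp add: P'_def)
  have CJ: "convex_cone ?J" by (rule fg_convex_cone[OF joinc_fg[OF S joinc_P' inP]])
  have sub: "\<rho> \<subseteq> ?J" unfolding \<kappa>(2) by (rule jset_mono) auto
  have \<tau>J: "\<tau> \<subseteq> ?J" using \<rho>(2) sub by blast
  obtain M where M: "M \<ge> 0" "r + M *\<^sub>R x \<in> \<rho>"
    using ext_iff[OF lfanD(8)[OF lfan_cells_P \<rho>(1)] \<rho>(2) assms] rc(1) \<rho>(3) by blast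
  define d where "d = (\<Sum>f\<in>F. c f / \<epsilon>)"
  have "- d *\<^sub>R b \<in> span \<tau>" by (intro span_scale span_base b\<tau>)
  then obtain M' where M': "M' \<ge> 0" "- d *\<^sub>R b + M' *\<^sub>R x \<in> \<tau>" using assms unfolding core_def by blast
  have "vs c = (\<Sum>f\<in>F. (c f / \<epsilon>) *\<^sub>R h f) + - d *\<^sub>R b"
    unfolding vs_coef[OF D(7) rc(2)] d_def h_def scaleR_minus_left scaleR_sum_left scaleR_add_right sum.distrib
    using \<epsilon>(1) by simp
  then have eq: "z + (M + M') *\<^sub>R x = (r + M *\<^sub>R x) + (- d *\<^sub>R b + M' *\<^sub>R x) + (\<Sum>f\<in>F. (c f / \<epsilon>) *\<^sub>R h f)"
    unfolding rc(3) by (simp add: algebra_simps)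
  have sJ: "(\<Sum>f\<in>F. (c f / \<epsilon>) *\<^sub>R h f) \<in> ?J"
    using jset_vertex[OF convex_cone_contains_0[OF D(9)], of "E \<union> h ` F"] coef_nonneg[OF rc(2)] \<epsilon>(1)
    by (intro convex_cone_sum[OF CJ] convex_cone_scaleR[OF CJ]) auto
  have zJ: "z + (M + M') *\<^sub>R x \<in> ?J"
    unfolding eq by (rule convex_cone_add[OF CJ convex_cone_add[OF CJ subsetD[OF sub M(2)] subsetD[OF \<tau>J M'(2)]] sJ])
  have xJ: "x \<in> ?J" using assms \<tau>J by (auto simp: core_def)
  have M0: "M + M' \<ge> 0" using M M' by simp
  show "\<exists>\<rho>\<in>cells P'. x \<in> \<rho> \<and> (\<exists>M\<ge>0. z + M *\<^sub>R x \<in> \<rho>)"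
    by (intro bexI[OF _ cellsI[OF inP]] conjI exI[of _ "M + M'"] xJ M0 zJ)
qed

end

section \<open>Choice of the small parameter and induction over the cones\<close>

context rational_space
begin

text \<open>If \<open>- b = s - r\<close> with \<open>s\<close> and \<open>r\<close> in the two
  cells, then \<open>b + s\<close> lies in their intersection, a face of the first cell, so
  \<open>b\<close> and with it \<tau> lie in the second one. Hence \<open>- b\<close> is outside the
  difference cone, and the form separating it has the required signs.\<close>

lemma separating_form:
  assumes S: "lfan L S" and P: "joinc S P" and \<tau>: "\<tau> \<in> S" and b: "core b \<tau>"
    and 1: "(\<kappa>1, E1) \<in> P" "\<tau> \<subseteq> \<kappa>1" and 2: "(\<kappa>2, E2) \<in> P" "\<not> \<tau> \<subseteq> \<kappa>2"
  shows "\<exists>u::'a \<Rightarrow> real. linear u \<and> (\<forall>x\<in>jset \<kappa>1 E1. 0 \<le> u x) \<and> (\<forall>x\<in>jset \<kappa>2 E2. u x \<le> 0) \<and> u b > 0"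
proof -
  let ?J1 = "jset \<kappa>1 E1" and ?J2 = "jset \<kappa>2 E2"
  let ?D = "{x - y | x y. x \<in> ?J1 \<and> y \<in> ?J2}"
  have f: "fg ?J1" "fg ?J2" using joinc_fg[OF S P] 1(1) 2(1) by auto
  have 0: "0 \<in> ?J1" "0 \<in> ?J2" using f fg_convex_cone convex_cone_contains_0 by auto
  have N: "lfan L (cells P)" by (rule lfan_cells[OF S P])
  have b1: "b \<in> ?J1" using b 1(2) jset_base by (auto simp: core_def)
  have "- b \<notin> ?D"
  proof
    assume "- b \<in> ?D"
    then obtain s r where sr: "- b = s - r" "s \<in> ?J1" "r \<in> ?J2" by auto
    have r: "b + s = r" using sr(1) by (simp add: algebra_simps)
    then have "b + s \<in> ?J1 \<inter> ?J2" using convex_cone_add[OF fg_convex_cone[OF f(1)] b1 sr(2)] sr(3) by simp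
    then have "b \<in> ?J1 \<inter> ?J2" by (rule cface_left[OF lfanD(7)[OF N cellsI[OF 1(1)] cellsI[OF 2(1)]] b1 sr(2)])
    then have "\<tau> \<subseteq> ?J2 \<inter> \<tau>"
      using b cface_core_subset[OF lfanD(7)[OF N subsetD[OF cells_subset_base[OF P] \<tau>] cellsI[OF 2(1)]] b _ order_refl lfanD(8)[OF S \<tau>]]
      by (auto simp: core_def)
    then have "\<tau> \<subseteq> \<kappa>2" using joinc_base_subset[OF P \<tau> 2(1)] by simp
    then show False using 2(2) by simp
  qed
  moreover have "- b \<in> V" using b1 fg_subset[OF f(1)] subspace_neg[OF subspace_V] by blast
  ultimately have "\<exists>u::'a \<Rightarrow> real. linear u \<and> (\<forall>x\<in>?D. 0 \<le> u x) \<and> u (- b) < 0"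
    by (intro farkas[OF fg_diff[OF f]])
  then obtain u :: "'a \<Rightarrow> real" where u: "linear u" "\<forall>x\<in>?D. 0 \<le> u x" "u (- b) < 0" by (elim exE conjE)
  have "0 \<le> u x" if "x \<in> ?J1" for x
  proof -
    have "x - 0 \<in> ?D" using that 0(2) by blast
    then show ?thesis using u(2) by simp
  qed
  moreover have "u x \<le> 0" if "x \<in> ?J2" for x
  proof -
    have "0 - x \<in> ?D" using that 0(1) by blast
    then have "0 \<le> u (- x)" using u(2) by simp
    then show ?thesis by (simp add: linear_neg[OF u(1)])
  qed
  moreover have "u b > 0" using u(3) by (simp add: linear_neg[OF u(1)])
  ultimately show ?thesis using u(1) by (auto intro!: exI[of _ u])
qed

lemma fg_dset:
  assumes "lfan L S" "joinc S P" "(\<kappa>, E0) \<in> P" "E \<subseteq> E0"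
  shows "fg (dset \<kappa> E0 E)"
  unfolding dset_def
proof (rule fg_diff[OF joinc_fg[OF assms(1-3)] fg_hull])
  show "finite E" using finite_subset[OF assms(4) joincD(4)[OF assms(2,3)]] .
  show "E \<subseteq> W" using assms(4) joincD(5)[OF assms(2,3)] by blast
qed

text \<open>Two forms nonnegative on the tangent cone are combined: \<open>v\<close> is positive at
  \<open>b\<close>, since uniqueness and \<open>\<tau> \<noteq> L\<close> keep \<open>- b\<close>
  out of that cone, and \<open>w\<close> is negative at \<open>y\<close>.\<close>

lemma separating_form_dset:
  assumes S: "lfan L S" and P: "joinc S P" and \<tau>: "\<tau> \<in> S" "\<tau> \<noteq> L" and b: "core b \<tau>"
    and 1: "(\<kappa>, E0) \<in> P" "\<tau> \<subseteq> \<kappa>" "E \<subseteq> E0" and y: "y \<in> V" "y \<notin> dset \<kappa> E0 E"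
  shows "\<exists>u::'a \<Rightarrow> real. linear u \<and> (\<forall>x\<in>dset \<kappa> E0 E. 0 \<le> u x) \<and> u y < 0 \<and> u b > 0"
proof -
  let ?D = "dset \<kappa> E0 E"
  have f: "fg ?D" by (rule fg_dset[OF S P 1(1,3)])
  have \<kappa>: "\<kappa> \<in> S" by (rule joincD(3)[OF P 1(1)])
  have C: "convex_cone \<kappa>" by (rule lfanD(8)[OF S \<kappa>])
  have bt: "b \<in> \<tau>" using b by (simp add: core_def)
  then have bk: "b \<in> \<kappa>" using 1(2) by blast
  have "b - 0 \<in> ?D" unfolding dset_def using bk jset_base[of \<kappa> E0] convex_cone_hull_contains_0[of E] by blast
  then have bD: "b \<in> ?D" by simp
  have "- b \<notin> ?D"
  proof
    assume "- b \<in> ?D"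
    then obtain p q where pq: "- b = p - q" "p \<in> jset \<kappa> E0" "q \<in> convex_cone hull E" unfolding dset_def by blast
    obtain s a where sa: "s \<in> \<kappa>" "a \<in> coef E0" "p = s + vs a" using pq(2) by (rule jsetE)
    obtain c where c: "c \<in> coef E" "q = vs c"
      using pq(3) convex_cone_hull_finite[OF finite_subset[OF 1(3) joincD(4)[OF P 1(1)]]] by blast
    have c0: "c \<in> coef E0" using c(1) coef_mono[OF 1(3)] by blast
    have "(s + b) + vs a = 0 + vs c" using pq(1) sa(3) c(2) by (simp add: algebra_simps)
    from joinc_inj(1)[OF P 1(1) 1(1) convex_cone_add[OF C sa(1) bk] convex_cone_contains_0[OF C] sa(2) c0 this]
    have "- b \<in> \<kappa>" using sa(1) by (simp add: add_eq_0_iff2)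
    then have "b \<in> L" using lfan_lineality[OF S \<kappa> bk] by blast
    moreover have "cface L \<tau>" using lfan_face_iff[OF S lfanD(3)[OF S] \<tau>(1)] lfanD(5)[OF S \<tau>(1)] by simp
    ultimately have "\<tau> \<subseteq> L" using cface_core_subset[OF _ b, of L \<tau>] lfanD(8)[OF S \<tau>(1)] by blast
    then show False using lfanD(5)[OF S \<tau>(1)] \<tau>(2) by blast
  qed
  moreover have "- b \<in> V" using bD fg_subset[OF f] subspace_neg[OF subspace_V] by blast
  ultimately obtain v :: "'a \<Rightarrow> real" where v: "linear v" "\<forall>x\<in>?D. 0 \<le> v x" "v (- b) < 0"
    using farkas[OF f] by metis
  obtain w :: "'a \<Rightarrow> real" where w: "linear w" "\<forall>x\<in>?D. 0 \<le> w x" "w y < 0"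
    using farkas[OF f y] by metis
  \<comment> \<open>Chosen so that \<open>d * v y\<close> is at most \<open>- w y / 2\<close>; then
    \<open>w + d v\<close> is still negative at \<open>y\<close>.\<close>
  define d where "d = - w y / (2 * (\<bar>v y\<bar> + 1))"
  have d: "d > 0" unfolding d_def
    by (rule divide_pos_pos) (use w(3) in simp, intro mult_pos_pos add_nonneg_pos, simp_all)
  let ?u = "\<lambda>x. w x + d *\<^sub>R v x"
  have lu: "linear ?u" by (intro linear_compose_add linear_compose_scale_right w(1) v(1))
  have "d * v y \<le> d * \<bar>v y\<bar>" using d by (simp add: mult_left_mono)
  also have "\<dots> \<le> d * (\<bar>v y\<bar> + 1)" using d by simp
  also have "\<dots> = - w y / 2" by (simp add: d_def add_nonneg_pos field_simps)
  finally have "?u y < 0" using w(3) by simp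
  moreover have "?u b > 0" using w(2) bD d v(3) linear_neg[OF v(1)] by (simp add: add_nonneg_pos)
  moreover have "\<forall>x\<in>?D. 0 \<le> ?u x" using w(2) v(2) d by simp
  ultimately show ?thesis using lu by (intro exI[of _ ?u] conjI)
qed

text \<open>The conditions restricting \<epsilon> concern finitely many pairs of cells and subsets
  \<open>E\<close>. Each of them holds for all large \<open>n\<close>, so a single \<open>n\<close>
  satisfies the locale assumptions.\<close>

lemma exists_star_completion:
  assumes S: "lfan L S" and P: "joinc S P" and \<tau>: "\<tau> \<in> S" "\<tau> \<noteq> L"
    and Q: "joinc (star (cells P) \<tau>) Q" "\<Union>(cells Q) = V" and t: "tight P" "based L P"
  shows "\<exists>P'. P \<subseteq> P' \<and> joinc S P' \<and> tight P' \<and> based L P' \<and> (\<forall>x. core x \<tau> \<longrightarrow> intpt (cells P') x)"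
proof -
  obtain b where b: "b \<in> W" "core b \<tau>" using exists_rational_core[OF lfanD(4)[OF S \<tau>(1)]] by blast
  \<comment> \<open>The gap condition in \<open>tight\<close> involves \<open>E\<close> but not
    \<kappa>, so the witness can be chosen as a function of \<open>E\<close>.\<close>
  have "\<exists>y. \<forall>\<kappa>. (\<kappa>, E) \<in> P \<longrightarrow> E \<noteq> {} \<longrightarrow> y \<in> V \<and> (\<forall>\<kappa>1 E1. (\<kappa>1, E1) \<in> P \<longrightarrow> E \<subseteq> E1 \<longrightarrow> y \<notin> dset \<kappa>1 E1 E)" for E
    using t(1) unfolding tight_def by metis
  then obtain y where y: "\<And>E \<kappa>. (\<kappa>, E) \<in> P \<Longrightarrow> E \<noteq> {} \<Longrightarrow>
      y E \<in> V \<and> (\<forall>\<kappa>1 E1. (\<kappa>1, E1) \<in> P \<longrightarrow> E \<subseteq> E1 \<longrightarrow> y E \<notin> dset \<kappa>1 E1 E)" by metis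
  let ?F = "\<Union>(snd ` Q)"
  let ?h = "\<lambda>n f. b + (1 / real (Suc n)) *\<^sub>R f"
  have finF: "finite ?F" using joincD(1,4)[OF Q(1)] by auto
  have finP: "finite P" by (rule joincD(1)[OF P])
  let ?C = "\<lambda>n p q. \<tau> \<subseteq> fst p \<longrightarrow> \<not> \<tau> \<subseteq> fst q \<longrightarrow> (\<exists>u::'a \<Rightarrow> real. linear u \<and> (\<forall>x\<in>jset (fst p) (snd p). 0 \<le> u x) \<and>
    (\<forall>x\<in>jset (fst q) (snd q). u x \<le> 0) \<and> (\<forall>f\<in>?F. u (?h n f) > 0))"
  have "eventually (\<lambda>n. ?C n p q) sequentially" if "p \<in> P" "q \<in> P" for p q
  proof (cases "\<tau> \<subseteq> fst p \<and> \<not> \<tau> \<subseteq> fst q")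
    case True
    have "\<exists>u::'a \<Rightarrow> real. linear u \<and> (\<forall>x\<in>jset (fst p) (snd p). 0 \<le> u x) \<and>
        (\<forall>x\<in>jset (fst q) (snd q). u x \<le> 0) \<and> u b > 0"
      by (rule separating_form[OF S P \<tau>(1) b(2)]) (use that True in simp_all)
    then obtain u :: "'a \<Rightarrow> real" where u: "linear u" "\<forall>x\<in>jset (fst p) (snd p). 0 \<le> u x"
      "\<forall>x\<in>jset (fst q) (snd q). u x \<le> 0" "u b > 0"
      by (elim exE conjE)
    show ?thesis
    proof (rule eventually_mono[OF eventually_perturbed_pos[OF u(1,4) finF]])
      fix n assume "\<forall>f\<in>?F. u (?h n f) > 0"
      with u(1-3) show "?C n p q" by (intro impI exI[of _ u] conjI)
    qed
  qed auto
  then have "eventually (\<lambda>n. \<forall>p\<in>P. \<forall>q\<in>P. ?C n p q) sequentially"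
    using finP by (intro eventually_ball_finite ballI)
  moreover
  let ?D = "\<lambda>n p E. \<tau> \<subseteq> fst p \<longrightarrow> E \<noteq> {} \<longrightarrow> (\<exists>u::'a \<Rightarrow> real. linear u \<and> (\<forall>x\<in>dset (fst p) (snd p) E. 0 \<le> u x) \<and>
    u (y E) < 0 \<and> (\<forall>f\<in>?F. u (?h n f) > 0))"
  have "eventually (\<lambda>n. ?D n p E) sequentially" if "p \<in> P" "E \<in> Pow (snd p)" for p E
  proof (cases "\<tau> \<subseteq> fst p \<and> E \<noteq> {}")
    case True
    have p: "(fst p, snd p) \<in> P" using that by simp
    have E: "E \<subseteq> snd p" using that(2) by simp
    have "(fst p, E) \<in> P"
      using joincD(6)[OF P p cface_refl[OF lfanD(8)[OF S joincD(3)[OF P p]]] E] .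
    then have "y E \<in> V" "y E \<notin> dset (fst p) (snd p) E" using y[of "fst p" E] True E p by auto
    then have "\<exists>u::'a \<Rightarrow> real. linear u \<and> (\<forall>x\<in>dset (fst p) (snd p) E. 0 \<le> u x) \<and> u (y E) < 0 \<and> u b > 0"
      using True by (intro separating_form_dset[OF S P \<tau> b(2) p _ E]) simp_all
    then obtain u :: "'a \<Rightarrow> real" where u: "linear u" "\<forall>x\<in>dset (fst p) (snd p) E. 0 \<le> u x" "u (y E) < 0" "u b > 0"
      by (elim exE conjE)
    show ?thesis
    proof (rule eventually_mono[OF eventually_perturbed_pos[OF u(1,4) finF]])
      fix n assume "\<forall>f\<in>?F. u (?h n f) > 0"
      with u(1-3) show "?D n p E" by (intro impI exI[of _ u] conjI)
    qed
  qed auto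
  then have "eventually (\<lambda>n. \<forall>p\<in>P. \<forall>E\<in>Pow (snd p). ?D n p E) sequentially"
    using finP joincD(4)[OF P] by (intro eventually_ball_finite ballI) (auto simp: prod_eq_iff)
  ultimately have "eventually (\<lambda>n. (\<forall>p\<in>P. \<forall>q\<in>P. ?C n p q) \<and> (\<forall>p\<in>P. \<forall>E\<in>Pow (snd p). ?D n p E)) sequentially"
    by (rule eventually_conj)
  from eventually_happens'[OF sequentially_bot this] obtain n where
    n0: "\<forall>p\<in>P. \<forall>q\<in>P. ?C n p q" "\<forall>p\<in>P. \<forall>E\<in>Pow (snd p). ?D n p E"
    by (elim exE conjE)
  have n: "?C n p q" "E \<subseteq> snd p \<Longrightarrow> ?D n p E" if "p \<in> P" "q \<in> P" for p q E
    using bspec[OF bspec[OF n0(1) that(1)] that(2)] bspec[OF bspec[OF n0(2) that(1)] PowI[of E]] by auto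
  have eK: "1 / real (Suc n) \<in> K"
    using K_rules(6)[OF K_of_nat[of "Suc n"]] by (simp add: inverse_eq_divide del: of_nat_Suc)
  interpret sc: star_completion K B L S P \<tau> Q b "1 / real (Suc n)" y
  proof (unfold_locales)
    show "lfan L S" "joinc S P" "\<tau> \<in> S" "\<tau> \<noteq> L" "b \<in> W" "core b \<tau>" "joinc (star (cells P) \<tau>) Q"
      "\<Union>(cells Q) = V" "0 < 1 / real (Suc n)" "1 / real (Suc n) \<in> K" "based L P"
      using S P \<tau> b Q t eK by auto
  next
    fix \<kappa>1 E1 \<kappa>2 E2 assume *: "(\<kappa>1, E1) \<in> P" "\<tau> \<subseteq> \<kappa>1" "(\<kappa>2, E2) \<in> P" "\<not> \<tau> \<subseteq> \<kappa>2"
    show "\<exists>u::'a \<Rightarrow> real. linear u \<and> (\<forall>x\<in>jset \<kappa>1 E1. 0 \<le> u x) \<and> (\<forall>x\<in>jset \<kappa>2 E2. u x \<le> 0) \<and>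
        (\<forall>f\<in>\<Union>(snd ` Q). u (b + (1 / real (Suc n)) *\<^sub>R f) > 0)"
      using n(1)[OF *(1,3)] *(2,4) by simp
  next
    fix \<kappa> E assume "(\<kappa>, E) \<in> P" "E \<noteq> {}"
    then show "y E \<in> V \<and> (\<forall>\<kappa>1 E1. (\<kappa>1, E1) \<in> P \<longrightarrow> E \<subseteq> E1 \<longrightarrow> y E \<notin> dset \<kappa>1 E1 E)" by (rule y)
  next
    fix \<kappa> E0 E assume *: "(\<kappa>, E0) \<in> P" "\<tau> \<subseteq> \<kappa>" "E \<subseteq> E0" "E \<noteq> {}"
    show "\<exists>u::'a \<Rightarrow> real. linear u \<and> (\<forall>x\<in>dset \<kappa> E0 E. 0 \<le> u x) \<and> u (y E) < 0 \<and>
        (\<forall>f\<in>\<Union>(snd ` Q). u (b + (1 / real (Suc n)) *\<^sub>R f) > 0)"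
      using n(2)[OF *(1,1), of E] *(2-4) by simp
  qed
  show ?thesis
    using sc.P_subset sc.joinc_P' sc.tight_P' sc.based_P' sc.intpt_P' by blast
qed

lemma dim_less_span_face:
  assumes "lfan L S" "\<tau> \<in> S" "\<tau> \<noteq> L"
  shows "dim L < dim (span \<tau>)" "span \<tau> \<subseteq> V"
proof -
  have L: "span L = L" using lfanD(2)[OF assms(1)] by (rule span_eq_iff[THEN iffD2])
  have "L \<subset> span \<tau>" using lfanD(5)[OF assms(1,2)] assms(3) span_superset[of \<tau>] by blast
  then have "span L \<subset> span (span \<tau>)" by (simp only: L span_span)
  then show "dim L < dim (span \<tau>)" by (rule dim_psubset)
  show "span \<tau> \<subseteq> V" using fg_subset[OF lfanD(4)[OF assms(1,2)]] span_minimal subspace_V by blast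
qed

text \<open>The cones other than \<open>L\<close> are treated one after another, each star being
  completed over a larger lineality space. Earlier gains persist because the joins only grow and
  \<open>intpt\<close> is monotone; every point of the support outside \<open>L\<close> is a core
  point of one of the treated cones.\<close>

lemma exists_neighbourhood_join:
  assumes S: "lfan L S"
    and H: "\<And>L' S'. lfan L' S' \<Longrightarrow> dim L < dim L' \<Longrightarrow> \<exists>Q. joinc S' Q \<and> \<Union>(cells Q) = V"
  shows "\<exists>P. joinc S P \<and> tight P \<and> based L P \<and> (\<forall>x\<in>\<Union>S - L. intpt (cells P) x)"
proof -
  have "\<exists>P. joinc S P \<and> tight P \<and> based L P \<and> (\<forall>\<tau>\<in>T. \<forall>x. core x \<tau> \<longrightarrow> intpt (cells P) x)"
    if "finite T" "T \<subseteq> S - {L}" for T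
    using that
  proof (induction T rule: finite_induct)
    case empty
    let ?P = "(\<lambda>\<kappa>. (\<kappa>, {}::'a set)) ` S"
    have "joinc S ?P"
      by (rule joincI) (use lfanD(1,6)[OF S] in \<open>auto dest!: coef_empty\<close>)
    moreover have "tight ?P" "based L ?P" by (auto simp: tight_def based_def)
    ultimately show ?case by blast
  next
    case (insert \<tau> T)
    then obtain P where P: "joinc S P" "tight P" "based L P" "\<forall>\<tau>\<in>T. \<forall>x. core x \<tau> \<longrightarrow> intpt (cells P) x" by auto
    have \<tau>: "\<tau> \<in> S" "\<tau> \<noteq> L" using insert.prems by auto
    have "\<tau> \<in> cells P" using cells_subset_base[OF P(1)] \<tau>(1) by blast
    from lfan_star[OF lfan_cells[OF S P(1)] this] H[OF _ dim_less_span_face(1)[OF S \<tau>]]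
    obtain Q where Q: "joinc (star (cells P) \<tau>) Q" "\<Union>(cells Q) = V" by blast
    from exists_star_completion[OF S P(1) \<tau> Q P(2,3)] obtain P' where
      P': "P \<subseteq> P'" "joinc S P'" "tight P'" "based L P'" "\<forall>x. core x \<tau> \<longrightarrow> intpt (cells P') x" by blast
    have "cells P \<subseteq> cells P'" using P'(1) by (rule image_mono)
    then have "intpt (cells P') x" if "\<tau>' \<in> T" "core x \<tau>'" for \<tau>' x
      using P(4) that intpt_mono[of "cells P" x "cells P'"] by simp
    then have "\<forall>\<tau>'\<in>insert \<tau> T. \<forall>x. core x \<tau>' \<longrightarrow> intpt (cells P') x"
      using P'(5) by simp
    then show ?case using P'(2-4) by blast
  qed
  from this[of "S - {L}"] lfanD(1)[OF S] obtain P where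
    P: "joinc S P" "tight P" "based L P" "\<forall>\<tau>\<in>S - {L}. \<forall>x. core x \<tau> \<longrightarrow> intpt (cells P) x" by auto
  have "intpt (cells P) x" if x: "x \<in> \<Union>S - L" for x
  proof -
    obtain \<kappa> where \<kappa>: "\<kappa> \<in> S" "x \<in> \<kappa>" using x by blast
    obtain \<tau> where \<tau>: "cface \<tau> \<kappa>" "core x \<tau>" using exists_core_face[OF lfanD(8)[OF S \<kappa>(1)] \<kappa>(2)] by blast
    have "\<tau> \<noteq> L" using \<tau>(2) x by (auto simp: core_def)
    then show ?thesis using P(4) \<tau>(2) lfanD(6)[OF S \<kappa>(1) \<tau>(1)] by blast
  qed
  then show ?thesis using P by blast
qed

end

section \<open>Simplicial refinement of a hyperplane arrangement\<close>

text \<open>With \<open>y\<close> avoiding the earlier subspaces and \<open>z\<close> the new one,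
  each forbidden subspace excludes at most one parameter on the line through \<open>y\<close> in
  direction \<open>z\<close>.\<close>

lemma subspace_avoiding:
  fixes V :: "'a::euclidean_space set"
  assumes "subspace V" "finite X" "\<And>S. S \<in> X \<Longrightarrow> subspace S \<and> \<not> V \<subseteq> S"
  shows "\<exists>y\<in>V. y \<notin> \<Union>X"
  using assms(2,3)
proof (induction X rule: finite_induct)
  case empty
  then show ?case using subspace_0[OF assms(1)] by auto
next
  case (insert S X)
  then obtain y where y: "y \<in> V" "y \<notin> \<Union>X" by auto
  obtain z where z: "z \<in> V" "z \<notin> S" using insert.prems[of S] by auto
  have S: "subspace S" using insert.prems[of S] by simp
  let ?bad = "\<lambda>T. {t::real. y + t *\<^sub>R z \<in> T}"
  have one: "t = t'" if "y + t *\<^sub>R z \<in> T" "y + t' *\<^sub>R z \<in> T" "subspace T" "y \<notin> T \<or> z \<notin> T" for t t' T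
  proof (rule ccontr)
    assume tt: "t \<noteq> t'"
    have "(y + t *\<^sub>R z) - (y + t' *\<^sub>R z) \<in> T" by (rule subspace_diff[OF that(3,1,2)])
    then have "(t - t') *\<^sub>R z \<in> T" by (simp add: algebra_simps)
    then have "inverse (t - t') *\<^sub>R (t - t') *\<^sub>R z \<in> T" by (rule subspace_scale[OF that(3)])
    then have zT: "z \<in> T" using tt by simp
    have "(y + t *\<^sub>R z) - t *\<^sub>R z \<in> T" by (rule subspace_diff[OF that(3,1) subspace_scale[OF that(3) zT]])
    then show False using zT that(4) by simp
  qed
  have fin: "finite (?bad T)" if "subspace T" "y \<notin> T \<or> z \<notin> T" for T
  proof (cases "?bad T = {}")
    case False
    then obtain t0 where "t0 \<in> ?bad T" by blast
    then have "?bad T \<subseteq> {t0}" using one[OF _ _ that] by blast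
    then show ?thesis using finite_subset by blast
  qed simp
  have "finite (\<Union>T\<in>insert S X. ?bad T)"
  proof (rule finite_UN_I)
    show "finite (insert S X)" using insert.hyps by simp
    show "finite (?bad T)" if "T \<in> insert S X" for T
      using fin[of T] that insert.prems y(2) z(2) by blast
  qed
  then obtain t where t: "t \<notin> (\<Union>T\<in>insert S X. ?bad T)"
    using ex_new_if_finite[OF infinite_UNIV_char_0] by blast
  have "y + t *\<^sub>R z \<in> V" using y(1) z(1) assms(1) by (simp add: subspace_add subspace_scale)
  then show ?case using t by blast
qed

context rational_space
begin

section \<open>Sign vectors and the cells of the arrangement\<close>

definition pos :: "('a \<Rightarrow> real) set \<Rightarrow> 'a \<Rightarrow> ('a \<Rightarrow> real) set" where "pos U x = {u\<in>U. 0 < u x}"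
definition neg :: "('a \<Rightarrow> real) set \<Rightarrow> 'a \<Rightarrow> ('a \<Rightarrow> real) set" where "neg U x = {u\<in>U. u x < 0}"
text \<open>\<open>below U x y\<close>: the arrangement cell of \<open>x\<close> is a face of the cell of \<open>y\<close>.\<close>

definition below :: "('a \<Rightarrow> real) set \<Rightarrow> 'a \<Rightarrow> 'a \<Rightarrow> bool" where
  "below U x y \<longleftrightarrow> pos U x \<subseteq> pos U y \<and> neg U x \<subseteq> neg U y"
definition rank :: "('a \<Rightarrow> real) set \<Rightarrow> 'a \<Rightarrow> nat" where "rank U x = card (pos U x) + card (neg U x)"

lemma below_refl: "below U x x" and below_trans: "below U x y \<Longrightarrow> below U y z \<Longrightarrow> below U x z"
  unfolding below_def by auto

lemma below_iff: "below U x y \<longleftrightarrow> (\<forall>u\<in>U. (0 \<le> u y \<longrightarrow> 0 \<le> u x) \<and> (u y \<le> 0 \<longrightarrow> u x \<le> 0))"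
proof -
  have "pos U x \<subseteq> pos U y \<longleftrightarrow> (\<forall>u\<in>U. u y \<le> 0 \<longrightarrow> u x \<le> 0)" unfolding pos_def by force
  moreover have "neg U x \<subseteq> neg U y \<longleftrightarrow> (\<forall>u\<in>U. 0 \<le> u y \<longrightarrow> 0 \<le> u x)" unfolding neg_def by force
  ultimately show ?thesis unfolding below_def by blast
qed

text \<open>The points whose signs are weakly those of \<open>x\<close> form a rational cone. Its
  rational core point \<open>w\<close> has the strict signs as well: since
  \<open>M *\<^sub>R w - x\<close> is in the cone for some \<open>M\<close>, no form can vanish at
  \<open>w\<close> that does not vanish at \<open>x\<close>.\<close>

lemma exists_rational_sign:
  assumes U: "finite U" "\<forall>u\<in>U. rform u" and x: "x \<in> V"
  shows "\<exists>w\<in>W. pos U w = pos U x \<and> neg U w = neg U x"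
proof -
  let ?Z = "{u\<in>U. u x = 0}"
  let ?m = "\<lambda>(u::'a \<Rightarrow> real) z. - u z"
  let ?U = "pos U x \<union> ?m ` neg U x \<union> ?Z \<union> ?m ` ?Z"
  have "finite ?U" using U(1) by (auto simp: pos_def neg_def)
  moreover have "\<forall>u\<in>?U. rform u" using U(2) rform_minus by (auto simp: pos_def neg_def)
  ultimately have "fg (hcone ?U)" unfolding fg_iff_hcone by (intro exI[of _ ?U] conjI refl)
  then obtain w where w: "w \<in> W" "core w (hcone ?U)" using exists_rational_core by blast
  have "x \<in> hcone ?U" by (rule hconeI[OF x]) (auto simp: pos_def neg_def)
  then have "- x \<in> span (hcone ?U)" by (intro span_neg span_base)
  then obtain M where M: "M \<ge> 0" "- x + M *\<^sub>R w \<in> hcone ?U" using w(2) unfolding core_def by blast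
  have wU: "w \<in> hcone ?U" using w(2) by (simp add: core_def)
  have lin: "u (- x + M *\<^sub>R w) = - u x + M * u w" if "u \<in> U" for u
  proof -
    have lu: "linear u" using U(2) that by (simp add: rform_def)
    show ?thesis by (simp add: linear_add[OF lu] linear_diff[OF lu] linear_scale[OF lu] linear_neg[OF lu])
  qed
  have p: "0 < u w" if "u \<in> pos U x" for u
  proof -
    have "0 \<le> u (- x + M *\<^sub>R w)" "0 \<le> u w" by (rule hconeD(1)[OF M(2)] hconeD(1)[OF wU]; use that in simp)+
    then show ?thesis using that lin[of u] M(1) by (cases "u w = 0") (auto simp: pos_def)
  qed
  have n: "u w < 0" if "u \<in> neg U x" for u
  proof -
    have "?m u \<in> ?U" using that by blast
    then have "0 \<le> ?m u (- x + M *\<^sub>R w)" "0 \<le> ?m u w" by (rule hconeD(1)[OF M(2)], rule hconeD(1)[OF wU])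
    then show ?thesis using that lin[of u] M(1) by (cases "u w = 0") (auto simp: neg_def)
  qed
  have z: "u w = 0" if "u \<in> ?Z" for u
  proof -
    have "u \<in> ?U" "?m u \<in> ?U" using that by auto
    from this[THEN hconeD(1)[OF wU]] show ?thesis by simp
  qed
  have tri: "u \<in> pos U x \<or> u \<in> neg U x \<or> u \<in> ?Z" if "u \<in> U" for u
    using that by (auto simp: pos_def neg_def)
  have "pos U w = pos U x"
  proof (intro Set.set_eqI iffI)
    fix u assume "u \<in> pos U w"
    then have "u \<in> U" "0 < u w" by (auto simp: pos_def)
    then show "u \<in> pos U x" using tri[of u] n[of u] z[of u] by fastforce
  qed (use p in \<open>auto simp: pos_def\<close>)
  moreover have "neg U w = neg U x"
  proof (intro Set.set_eqI iffI)
    fix u assume "u \<in> neg U w"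
    then have "u \<in> U" "u w < 0" by (auto simp: neg_def)
    then show "u \<in> neg U x" using tri[of u] p[of u] z[of u] by fastforce
  qed (use n in \<open>auto simp: neg_def\<close>)
  ultimately show ?thesis using w(1) by blast
qed

lemma vs_remove:
  assumes "finite F" "a \<in> coef F" "0 \<le> t" "t \<le> a v"
  shows "a(v := a v - t) \<in> coef F" "vs (a(v := a v - t)) = vs a - t *\<^sub>R v"
proof -
  show 1: "a(v := a v - t) \<in> coef F" using assms by (auto simp: coef_def)
  define c where "c = a(v := a v - t)"
  have c: "c \<in> coef F" unfolding c_def by (rule 1)
  have "a = (\<lambda>w. c w + t * ucoef v w)" by (auto simp: c_def ucoef_def)
  then have "vs a = vs (\<lambda>w. c w + t * ucoef v w)" by simp
  also have "\<dots> = vs c + vs (\<lambda>w. t * ucoef v w)"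
    by (rule vs_add[OF coef_finite[OF assms(1) c]]) (auto simp: ucoef_def)
  also have "vs (\<lambda>w. t * ucoef v w) = t *\<^sub>R vs (ucoef v)"
    by (rule vs_scale) (auto simp: ucoef_def)
  finally have "vs c = vs a - t *\<^sub>R v" by simp
  then show "vs (a(v := a v - t)) = vs a - t *\<^sub>R v" unfolding c_def .
qed

lemma vs_form:
  assumes "linear u" "finite F" "a \<in> coef F"
  shows "(u :: 'a \<Rightarrow> real) (vs a) = (\<Sum>f\<in>F. a f * u f)"
  unfolding vs_coef[OF assms(2,3)] by (simp add: linear_sum[OF assms(1)] linear_scale[OF assms(1)])

text \<open>A positive combination of a chain of cells lies in the relative interior of the largest one.\<close>

lemma chain_sign:
  assumes U: "finite U" "\<forall>u\<in>U. rform u" and l: "\<forall>u\<in>U. u l = 0"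
    and F: "finite F" "a \<in> coef F" "v \<in> F" "0 < a v" and top: "\<And>f. f \<in> F \<Longrightarrow> 0 < a f \<Longrightarrow> below U f v"
  shows "pos U (l + vs a) = pos U v" "neg U (l + vs a) = neg U v"
proof -
  have eq: "u (l + vs a) = (\<Sum>f\<in>F. a f * u f)" if "u \<in> U" for u
    using U(2) that l vs_form[OF _ F(1,2), of u] by (simp add: rform_def linear_add)
  have nn: "0 \<le> a f" for f by (rule coef_nonneg[OF F(2)])
  have b: "(0 \<le> u v \<longrightarrow> 0 \<le> a f * u f) \<and> (u v \<le> 0 \<longrightarrow> a f * u f \<le> 0)" if "u \<in> U" "f \<in> F" for u f
  proof (cases "a f = 0")
    case False
    then have "0 < a f" using nn[of f] by simp
    then show ?thesis using top[OF that(2)] that(1) unfolding below_iff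
      by (auto simp: mult_nonneg_nonpos)
  qed simp
  have sp: "(\<Sum>f\<in>F. a f * u f) = a v * u v + (\<Sum>f\<in>F-{v}. a f * u f)" for u
    using F(1,3) by (rule sum.remove)
  have P: "0 < (\<Sum>f\<in>F. a f * u f)" if "u \<in> U" "0 < u v" for u
    unfolding sp using b[OF that(1)] that(2) F(4) by (intro add_pos_nonneg sum_nonneg) auto
  have N: "(\<Sum>f\<in>F. a f * u f) < 0" if "u \<in> U" "u v < 0" for u
    unfolding sp using b[OF that(1)] that(2) F(4) by (intro add_neg_nonpos sum_nonpos) (auto simp: mult_pos_neg)
  have Z: "(\<Sum>f\<in>F. a f * u f) = 0" if "u \<in> U" "u v = 0" for u
  proof (rule sum.neutral, rule ballI)
    fix f assume "f \<in> F"
    from b[OF that(1) this] that(2) have "0 \<le> a f * u f" "a f * u f \<le> 0" by simp_all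
    then show "a f * u f = 0" by (rule antisym[rotated])
  qed
  show "pos U (l + vs a) = pos U v"
    unfolding pos_def using eq P N Z by (auto simp: not_less) (metis less_asym less_irrefl linorder_cases)
  show "neg U (l + vs a) = neg U v"
    unfolding neg_def using eq P N Z by (auto simp: not_less) (metis less_asym less_irrefl linorder_cases)
qed

lemma chain_top:
  assumes "finite U" "finite F" "F \<noteq> {}" "\<forall>v\<in>F. \<forall>w\<in>F. below U v w \<or> below U w v"
  shows "\<exists>v\<in>F. \<forall>f\<in>F. below U f v"
  using assms(2-4)
proof (induction F rule: finite_ne_induct)
  case (singleton x)
  then show ?case using below_refl by blast
next
  case (insert x F)
  then obtain v where v: "v \<in> F" "\<forall>f\<in>F. below U f v" by blast
  have "below U x v \<or> below U v x" using insert.prems v(1) by blast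
  then show ?case
  proof
    assume "below U x v"
    then show ?thesis using v by blast
  next
    assume "below U v x"
    then show ?thesis using v below_refl below_trans by blast
  qed
qed

text \<open>The barycentric subdivision: one rational point is chosen in each cell other than \<open>L\<close>, and the
  simplices are the sets of points belonging to a chain of cells.\<close>

lemma arrangement_complex:
  assumes U: "finite U" "\<forall>u\<in>U. rform u" and L: "L = {x\<in>V. \<forall>u\<in>U. u x = 0}"
  shows "\<exists>T. finite T \<and> (\<forall>F\<in>T. finite F \<and> F \<subseteq> W \<and> (\<forall>F'. F' \<subseteq> F \<longrightarrow> F' \<in> T)) \<and>
    (\<forall>F1 F2 l1 l2 a1 a2. F1 \<in> T \<longrightarrow> F2 \<in> T \<longrightarrow> l1 \<in> L \<longrightarrow> l2 \<in> L \<longrightarrow> a1 \<in> coef F1 \<longrightarrow> a2 \<in> coef F2 \<longrightarrow>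
       l1 + vs a1 = l2 + vs a2 \<longrightarrow> l1 = l2 \<and> a1 = a2) \<and>
    (\<forall>x\<in>V. \<exists>F\<in>T. \<exists>l\<in>L. \<exists>a\<in>coef F. x = l + vs a \<and> (\<forall>f\<in>F. below U f x))"
proof -
  let ?s = "\<lambda>x. (pos U x, neg U x)"
  define X where "X = ?s ` (V - L)"
  have fX: "finite X"
  proof (rule finite_subset[of _ "Pow U \<times> Pow U"])
    show "X \<subseteq> Pow U \<times> Pow U" by (auto simp: X_def pos_def neg_def)
  qed (use U(1) in simp)
  have "\<exists>w. w \<in> W \<and> ?s w = p" if p: "p \<in> X" for p
  proof -
    obtain x where x: "x \<in> V" "p = ?s x" using p unfolding X_def by blast
    obtain w where "w \<in> W" "pos U w = pos U x" "neg U w = neg U x" using exists_rational_sign[OF U x(1)] by blast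
    then show ?thesis unfolding x(2) by auto
  qed
  then obtain r where r: "\<And>p. p \<in> X \<Longrightarrow> r p \<in> W \<and> ?s (r p) = p" by metis
  define R where "R = r ` X"
  have RW: "R \<subseteq> W" "finite R" using r fX by (auto simp: R_def)
  have Rinj: "v = w" if vw: "v \<in> R" "w \<in> R" "pos U v = pos U w" "neg U v = neg U w" for v w
  proof -
    obtain p q where "p \<in> X" "v = r p" "q \<in> X" "w = r q" using vw(1,2) unfolding R_def by blast
    then have "?s v = p" "?s w = q" using r by blast+
    then have "p = q" using vw(3,4) by simp
    then show ?thesis using \<open>v = r p\<close> \<open>w = r q\<close> by simp
  qed
  have Rex: "\<exists>v\<in>R. pos U v = pos U x \<and> neg U v = neg U x" if "x \<in> V - L" for x
  proof -
    have "?s x \<in> X" using that by (simp add: X_def)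
    then show ?thesis using r[of "?s x"] unfolding R_def by auto
  qed
  have notL: "pos U x \<noteq> {} \<or> neg U x \<noteq> {}" if "x \<in> V - L" for x
    using that unfolding L pos_def neg_def by force
  have L0: "u l = 0" if "l \<in> L" "u \<in> U" for l u using that L by simp
  have inL: "pos U l = {}" "neg U l = {}" if "l \<in> L" for l
  proof -
    have "u \<notin> pos U l \<and> u \<notin> neg U l" for u using L0[OF that, of u] by (auto simp: pos_def neg_def)
    then show "pos U l = {}" "neg U l = {}" by auto
  qed
  have RL: "pos U v \<noteq> {} \<or> neg U v \<noteq> {}" if v: "v \<in> R" for v
  proof -
    obtain x where x: "x \<in> V - L" "v = r (?s x)" using v by (auto simp: R_def X_def)
    have "?s x \<in> X" using x(1) by (simp add: X_def)
    then have "?s v = ?s x" using r x(2) by simp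
    then show ?thesis using notL[OF x(1)] by simp
  qed
  define T where "T = {F. F \<subseteq> R \<and> (\<forall>v\<in>F. \<forall>w\<in>F. below U v w \<or> below U w v)}"
  have TF: "finite F" "F \<subseteq> W" "F \<subseteq> R" if "F \<in> T" for F
    using that RW finite_subset by (auto simp: T_def)
  have "finite T" by (rule finite_subset[of _ "Pow R"]) (use RW(2) in \<open>auto simp: T_def\<close>)
  moreover have "\<forall>F\<in>T. finite F \<and> F \<subseteq> W \<and> (\<forall>F'. F' \<subseteq> F \<longrightarrow> F' \<in> T)"
  proof (intro ballI conjI allI impI)
    fix F F' assume F: "F \<in> T"
    show "finite F" "F \<subseteq> W" using TF[OF F] by auto
    assume "F' \<subseteq> F"
    then show "F' \<in> T" using F unfolding T_def by blast
  qed
  moreover have "\<forall>F1 F2 l1 l2 a1 a2. F1 \<in> T \<longrightarrow> F2 \<in> T \<longrightarrow> l1 \<in> L \<longrightarrow> l2 \<in> L \<longrightarrow> a1 \<in> coef F1 \<longrightarrow> a2 \<in> coef F2 \<longrightarrow>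
       l1 + vs a1 = l2 + vs a2 \<longrightarrow> l1 = l2 \<and> a1 = a2"
  proof -
    let ?c = "\<lambda>a. card {v. a v \<noteq> (0::real)}"
    \<comment> \<open>The signs of a point are those of the largest vertex it uses. As
      \<open>R\<close> has one representative per sign vector, two representations of a point share
      their top vertex.\<close>
    have topv: "\<exists>v\<in>F. 0 < a v \<and> pos U (l + vs a) = pos U v \<and> neg U (l + vs a) = neg U v"
      if F: "F \<in> T" "l \<in> L" "a \<in> coef F" and ne: "a \<noteq> (\<lambda>v. 0)" for F l a
    proof -
      let ?F = "{f\<in>F. 0 < a f}"
      obtain v0 where "a v0 \<noteq> 0" using ne by auto
      then have "v0 \<in> ?F" using coef_outside[OF F(3)] coef_nonneg[OF F(3), of v0] by force
      then have "?F \<noteq> {}" by blast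
      moreover have "\<forall>v\<in>?F. \<forall>w\<in>?F. below U v w \<or> below U w v" using F(1) unfolding T_def by blast
      ultimately obtain v where v: "v \<in> ?F" "\<forall>f\<in>?F. below U f v"
        using chain_top[OF U(1), of ?F] TF(1)[OF F(1)] by auto
      have "pos U (l + vs a) = pos U v" "neg U (l + vs a) = neg U v"
        using chain_sign[OF U _ TF(1)[OF F(1)] F(3), of l v] v L0[OF F(2)] by auto
      then show ?thesis using v(1) by blast
    qed
    have "l1 = l2 \<and> a1 = a2"
      if "?c a1 + ?c a2 = n" "F1 \<in> T" "F2 \<in> T" "l1 \<in> L" "l2 \<in> L" "a1 \<in> coef F1" "a2 \<in> coef F2" "l1 + vs a1 = l2 + vs a2"
      for n F1 F2 l1 l2 a1 a2
      using that
    proof (induction n arbitrary: F1 F2 l1 l2 a1 a2 rule: less_induct)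
      case (less n)
      note a = less.prems
      show ?case
      proof (cases "a1 = (\<lambda>v. 0) \<or> a2 = (\<lambda>v. 0)")
        case True
        have "a1 = (\<lambda>v. 0) \<and> a2 = (\<lambda>v. 0)"
        proof (rule ccontr)
          assume no: "\<not> ?thesis"
          have e: "l1 + vs a1 \<in> L \<or> l2 + vs a2 \<in> L" using True a(4,5) by auto
          then have e: "pos U (l1 + vs a1) = {}" "neg U (l1 + vs a1) = {}" using inL a(8) by auto
          consider "a1 \<noteq> (\<lambda>v. 0)" | "a2 \<noteq> (\<lambda>v. 0)" using no by blast
          then show False
          proof cases
            case 1
            from topv[OF a(2,4,6) 1] obtain v where
              v: "v \<in> F1" "pos U (l1 + vs a1) = pos U v" "neg U (l1 + vs a1) = neg U v" by blast
            then show False using e RL[of v] TF(3)[OF a(2)] by blast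
          next
            case 2
            from topv[OF a(3,5,7) 2] obtain v where
              v: "v \<in> F2" "pos U (l2 + vs a2) = pos U v" "neg U (l2 + vs a2) = neg U v" by blast
            then show False using e[unfolded a(8)] RL[of v] TF(3)[OF a(3)] by blast
          qed
        qed
        then show ?thesis using a(8) by simp
      next
        case False
        obtain v where v: "v \<in> F1" "0 < a1 v" "pos U (l1 + vs a1) = pos U v" "neg U (l1 + vs a1) = neg U v"
          using topv[OF a(2,4,6)] False by blast
        obtain w where w: "w \<in> F2" "0 < a2 w" "pos U (l2 + vs a2) = pos U w" "neg U (l2 + vs a2) = neg U w"
          using topv[OF a(3,5,7)] False by blast
        have "v \<in> R" "w \<in> R" using TF(3)[OF a(2)] TF(3)[OF a(3)] v(1) w(1) by auto
        then have vw: "w = v" using Rinj[of w v] v(3,4) w(3,4) a(8) by simp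
        \<comment> \<open>Removing the common top vertex with the smaller of its two coefficients
          makes one of them zero, so the total number of nonzero coefficients drops.\<close>
        define t where "t = min (a1 v) (a2 v)"
        have t: "0 \<le> t" "t \<le> a1 v" "t \<le> a2 v" "0 < t" using v(2) w(2) vw by (auto simp: t_def)
        let ?b1 = "a1(v := a1 v - t)" and ?b2 = "a2(v := a2 v - t)"
        note r1 = vs_remove[OF TF(1)[OF a(2)] a(6) t(1,2)] and r2 = vs_remove[OF TF(1)[OF a(3)] a(7) t(1,3)]
        have s1: "{x. ?b1 x \<noteq> 0} \<subseteq> {x. a1 x \<noteq> 0}" and s2: "{x. ?b2 x \<noteq> 0} \<subseteq> {x. a2 x \<noteq> 0}"
          using v(2) w(2) vw by auto
        have f1: "finite {x. a1 x \<noteq> 0}" and f2: "finite {x. a2 x \<noteq> 0}"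
          using coef_finite TF(1) a(2,3,6,7) by blast+
        have le: "?c ?b1 \<le> ?c a1" "?c ?b2 \<le> ?c a2" using card_mono s1 s2 f1 f2 by blast+
        have "?c ?b1 < ?c a1 \<or> ?c ?b2 < ?c a2"
        proof (cases "t = a1 v")
          case True
          then have "{x. ?b1 x \<noteq> 0} \<subset> {x. a1 x \<noteq> 0}" using s1 v(2) by auto
          then show ?thesis using psubset_card_mono[OF f1] by blast
        next
          case F: False
          then have "t = a2 v" by (auto simp: t_def min_def split: if_splits)
          then have "{x. ?b2 x \<noteq> 0} \<subset> {x. a2 x \<noteq> 0}" using s2 w(2) vw by auto
          then show ?thesis using psubset_card_mono[OF f2] by blast
        qed
        then have lt: "?c ?b1 + ?c ?b2 < n" using le a(1) by linarith
        have "l1 + vs ?b1 = l2 + vs ?b2" unfolding r1(2) r2(2) using a(8) by simp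
        note IH = less.IH[OF lt refl a(2-5) r1(1) r2(1) this]
        have "a1 x = a2 x" for x
          using fun_cong[OF IH[THEN conjunct2], of x] by (cases "x = v") auto
        then show ?thesis using IH[THEN conjunct1] by auto
      qed
    qed
    then show ?thesis by simp
  qed
  moreover have "\<forall>x\<in>V. \<exists>F\<in>T. \<exists>l\<in>L. \<exists>a\<in>coef F. x = l + vs a \<and> (\<forall>f\<in>F. below U f x)"
  proof
    fix x assume "x \<in> V"
    then show "\<exists>F\<in>T. \<exists>l\<in>L. \<exists>a\<in>coef F. x = l + vs a \<and> (\<forall>f\<in>F. below U f x)"
    proof (induction "rank U x" arbitrary: x rule: less_induct)
      case less
      show ?case
      proof (cases "x \<in> L")
        case True
        have "{} \<in> T" by (simp add: T_def)
        then show ?thesis using True by (intro bexI[of _ "{}"] bexI[of _ x] bexI[of _ "\<lambda>v. 0"]) auto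
      next
        case False
        then obtain v where v: "v \<in> R" "pos U v = pos U x" "neg U v = neg U x" using Rex less.prems by blast
        have vV: "v \<in> V" using v(1) RW(1) W_subset_V by blast
        \<comment> \<open>\<open>x\<close> and its representative \<open>v\<close> have equal signs,
          so the ratios are positive. Their minimum is the largest multiple of \<open>v\<close> that
          can be subtracted without any form passing to the opposite sign; a form attaining it then
          vanishes, which lowers the rank.\<close>
        define N where "N = (\<lambda>u. u x / u v) ` (pos U x \<union> neg U x)"
        have N: "finite N" "N \<noteq> {}"
          using U(1) notL[of x] False less.prems by (auto simp: N_def pos_def neg_def)
        define t where "t = Min N"
        have sgn: "0 < u v \<longleftrightarrow> 0 < u x" "u v < 0 \<longleftrightarrow> u x < 0" "u v = 0 \<longleftrightarrow> u x = 0" if "u \<in> U" for u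
        proof -
          have "u \<in> pos U v \<longleftrightarrow> u \<in> pos U x" "u \<in> neg U v \<longleftrightarrow> u \<in> neg U x" using v(2,3) by auto
          then show "0 < u v \<longleftrightarrow> 0 < u x" "u v < 0 \<longleftrightarrow> u x < 0" "u v = 0 \<longleftrightarrow> u x = 0"
            using that by (auto simp: pos_def neg_def)
        qed
        have "t \<in> N" unfolding t_def by (rule Min_in[OF N])
        then obtain u0 where u0: "u0 \<in> U" "u0 x \<noteq> 0" "t = u0 x / u0 v" by (auto simp: N_def pos_def neg_def)
        have t0: "t > 0" unfolding u0(3) using sgn[OF u0(1)] u0(2) by (auto simp: zero_less_divide_iff neq_iff)
        have tle: "t \<le> u x / u v" if "u \<in> U" "u x \<noteq> 0" for u
          unfolding t_def by (rule Min_le[OF N(1)]) (use that in \<open>auto simp: N_def pos_def neg_def neq_iff\<close>)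
        let ?x = "x - t *\<^sub>R v"
        have lin: "u ?x = u x - t * u v" if "u \<in> U" for u
          using U(2) that by (simp add: rform_def linear_diff linear_scale)
        have xV: "?x \<in> V" using less.prems vV subspace_V by (simp add: subspace_diff subspace_scale)
        have bel: "below U ?x x"
          unfolding below_iff
        proof
          fix u assume u: "u \<in> U"
          consider "u x = 0" | "u x > 0" | "u x < 0" by linarith
          then show "(0 \<le> u x \<longrightarrow> 0 \<le> u ?x) \<and> (u x \<le> 0 \<longrightarrow> u ?x \<le> 0)"
          proof cases
            case 1
            then show ?thesis using sgn(3)[OF u] lin[OF u] by simp
          next
            case 2
            then have "t * u v \<le> u x" using tle[OF u] sgn(1)[OF u] by (simp add: pos_le_divide_eq)
            then show ?thesis using 2 lin[OF u] by simp
          next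
            case 3
            then have "u x \<le> t * u v" using tle[OF u] sgn(2)[OF u] by (simp add: neg_le_divide_eq)
            then show ?thesis using 3 lin[OF u] by simp
          qed
        qed
        have u00: "u0 ?x = 0" using lin[OF u0(1)] u0(2,3) sgn(3)[OF u0(1)] by simp
        have "rank U ?x < rank U x"
        proof -
          have f: "finite (pos U x)" "finite (neg U x)" using U(1) by (auto simp: pos_def neg_def)
          have s: "pos U ?x \<subseteq> pos U x" "neg U ?x \<subseteq> neg U x" using bel by (auto simp: below_def)
          have le: "card (pos U ?x) \<le> card (pos U x)" "card (neg U ?x) \<le> card (neg U x)"
            using card_mono f s by blast+
          have n: "u0 \<notin> pos U ?x" "u0 \<notin> neg U ?x" using u00 by (auto simp: pos_def neg_def)
          have "u0 \<in> pos U x \<or> u0 \<in> neg U x" using u0(1,2) by (auto simp: pos_def neg_def)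
          then have "pos U ?x \<subset> pos U x \<or> neg U ?x \<subset> neg U x" using s n by blast
          then have "card (pos U ?x) < card (pos U x) \<or> card (neg U ?x) < card (neg U x)"
            using psubset_card_mono f by blast
          then show ?thesis using le unfolding rank_def by linarith
        qed
        from less.hyps[OF this xV] obtain F l a where
          F: "F \<in> T" "l \<in> L" "a \<in> coef F" "?x = l + vs a" "\<forall>f\<in>F. below U f ?x" by blast
        have bv: "below U f v" if "f \<in> F" for f
          using below_trans[OF _ bel] F(5) that v(2,3) unfolding below_def by blast
        have "insert v F \<in> T" using F(1) v(1) bv below_refl unfolding T_def by blast
        moreover have "\<forall>f\<in>insert v F. below U f x" using bv v(2,3) unfolding below_def by auto
        moreover have "(\<lambda>w. a w + t * ucoef v w) \<in> coef (insert v F)"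
          using F(3) t0 by (auto simp: coef_def ucoef_def)
        moreover have "x = l + vs (\<lambda>w. a w + t * ucoef v w)"
        proof -
          have "vs (\<lambda>w. a w + t * ucoef v w) = vs a + vs (\<lambda>w. t * ucoef v w)"
            by (rule vs_add[OF coef_finite[OF TF(1)[OF F(1)] F(3)]]) (auto simp: ucoef_def)
          also have "vs (\<lambda>w. t * ucoef v w) = t *\<^sub>R vs (ucoef v)"
            by (rule vs_scale) (auto simp: ucoef_def)
          finally show ?thesis using F(4) by (simp add: algebra_simps)
        qed
        ultimately show ?thesis using F(2) by blast
      qed
    qed
  qed
  ultimately show ?thesis by (intro exI[of _ T] conjI)
qed


section \<open>Completions\<close>

text \<open>A simplex of \<open>Q\<close> outside \<open>P'\<close> contains no interior point of
  the support. If it shares a point with a cell, the base part of that point lies in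
  \<open>L\<close>, since otherwise \<open>ip\<close> and \<open>intpt_add\<close> make the point
  interior; over \<open>L\<close> both representations come from the same simplicial complex. The
  last clause serves to transfer \<open>tight\<close> and \<open>based\<close> from \<open>P\<close>
  to \<open>P'\<close>.\<close>

lemma completion_exists:
  assumes S: "lfan L S" and P: "joinc S P" and ip: "\<forall>x\<in>\<Union>S - L. intpt (cells P) x"
  shows "\<exists>P' Q. joinc S P' \<and> joinc S Q \<and> P' \<subseteq> Q \<and> \<Union>(cells P') = \<Union>(cells P) \<and> \<Union>(cells Q) = V \<and>
    (\<forall>\<kappa> F. (\<kappa>, F) \<in> P' \<longrightarrow> (\<exists>E. (\<kappa>, E) \<in> P \<and> F \<subseteq> jset L E \<and> (\<forall>\<kappa>'. (\<kappa>', E) \<in> P \<longrightarrow> (\<kappa>', F) \<in> P')))"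
proof -
  note N = lfan_cells[OF S P]
  have LS: "L \<in> S" and L: "subspace L" using lfanD[OF S] by auto
  have "\<exists>U. finite U \<and> (\<forall>u\<in>U. rform u) \<and> \<rho> = hcone U" if "\<rho> \<in> cells P" for \<rho>
    using lfanD(4)[OF N that] unfolding fg_iff_hcone .
  then have "\<forall>\<rho>\<in>cells P. \<exists>U. finite U \<and> (\<forall>u\<in>U. rform u) \<and> \<rho> = hcone U" by simp
  from bchoice[OF this] obtain f where
    f0: "\<forall>\<rho>\<in>cells P. finite (f \<rho>) \<and> (\<forall>u\<in>f \<rho>. rform u) \<and> \<rho> = hcone (f \<rho>)" by (elim exE)
  note f = bspec[OF f0]
  \<comment> \<open>All forms of all cells together, so that a sign class of the arrangement lies
    inside or outside each cell as a whole.\<close>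
  define U where "U = \<Union>(f ` cells P)"
  have U: "finite U" "\<forall>u\<in>U. rform u" using f joincD(1)[OF P] by (auto simp: U_def)
  have fU: "u \<in> U" if "\<rho> \<in> cells P" "u \<in> f \<rho>" for u \<rho>
    unfolding U_def by (rule UnionI[of "f \<rho>"], rule imageI, rule that(1), rule that(2))
  have hc: "x \<in> \<rho> \<longleftrightarrow> (\<forall>u\<in>f \<rho>. 0 \<le> u x)" if "\<rho> \<in> cells P" "x \<in> V" for x \<rho>
  proof -
    have "\<rho> = hcone (f \<rho>)" using f[OF that(1)] by simp
    then have "x \<in> \<rho> \<longleftrightarrow> x \<in> hcone (f \<rho>)" by simp
    then show ?thesis using that(2) by (simp add: hcone_def)
  qed
  have LV: "L \<subseteq> V" by (rule fg_subset[OF lfanD(4)[OF S LS]])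
  have LN: "L \<in> cells P" by (rule lfanD(3)[OF N])
  \<comment> \<open>Every cell contains \<open>L\<close> along with its negatives, so all forms
    vanish on \<open>L\<close>; the forms cutting out the cell \<open>L\<close> itself exclude
    further common zeros.\<close>
  have LU: "L = {x\<in>V. \<forall>u\<in>U. u x = 0}"
  proof (intro Set.set_eqI iffI)
    fix x assume x: "x \<in> L"
    have "u x = 0" if u: "u \<in> U" for u
    proof -
      obtain \<rho> where \<rho>: "\<rho> \<in> cells P" "u \<in> f \<rho>" using u by (auto simp: U_def)
      have "x \<in> \<rho>" "- x \<in> \<rho>" using lfanD(5)[OF N \<rho>(1)] x subspace_neg[OF L x] by auto
      then have "0 \<le> u x" "0 \<le> u (- x)"
        using hc[OF \<rho>(1), of x] hc[OF \<rho>(1), of "- x"] \<rho>(2) x LV subspace_neg[OF L x] by auto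
      moreover have "linear u" using U(2) u by (simp add: rform_def)
      ultimately show ?thesis using linear_neg[of u x] by simp
    qed
    then show "x \<in> {x\<in>V. \<forall>u\<in>U. u x = 0}" using x LV by blast
  next
    fix x assume x: "x \<in> {x\<in>V. \<forall>u\<in>U. u x = 0}"
    then have z: "\<forall>u\<in>U. u x = 0" by simp
    have "0 \<le> u x" if "u \<in> f L" for u using bspec[OF z fU[OF LN that]] by simp
    then show "x \<in> L" using hc[OF LN, of x] x by simp
  qed
  from arrangement_complex[OF U LU] obtain T where T: "finite T"
      "\<forall>F\<in>T. finite F \<and> F \<subseteq> W \<and> (\<forall>F'. F' \<subseteq> F \<longrightarrow> F' \<in> T)"
    and T_inj: "\<forall>F1 F2 l1 l2 a1 a2. F1 \<in> T \<longrightarrow> F2 \<in> T \<longrightarrow> l1 \<in> L \<longrightarrow> l2 \<in> L \<longrightarrow> a1 \<in> coef F1 \<longrightarrow> a2 \<in> coef F2 \<longrightarrow>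
       l1 + vs a1 = l2 + vs a2 \<longrightarrow> l1 = l2 \<and> a1 = a2"
    and T_cov: "\<forall>x\<in>V. \<exists>F\<in>T. \<exists>l\<in>L. \<exists>a\<in>coef F. x = l + vs a \<and> (\<forall>f\<in>F. below U f x)"
    by (elim exE conjE)
  have T: "finite T" "\<And>F. F \<in> T \<Longrightarrow> finite F \<and> F \<subseteq> W" "\<And>F F'. F \<in> T \<Longrightarrow> F' \<subseteq> F \<Longrightarrow> F' \<in> T"
    using T by simp_all
  note Tinj = T_inj[rule_format] and Tcov = T_cov[rule_format]
  have LE: "(L, E) \<in> P" if "(\<kappa>, E) \<in> P" for \<kappa> E
  proof -
    have \<kappa>: "\<kappa> \<in> S" by (rule joincD(3)[OF P that])
    have "cface L \<kappa>" using lfan_face_iff[OF S LS \<kappa>] lfanD(5)[OF S \<kappa>] by simp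
    then show ?thesis using joincD(6)[OF P that] by blast
  qed
  have minL: "\<kappa> = L" if "cface \<kappa> L" for \<kappa>
    using lfanD(5)[OF S lfanD(6)[OF S LS that]] cface_subset[OF that] by blast
  define P' where "P' = {(\<kappa>, F). \<exists>E. (\<kappa>, E) \<in> P \<and> F \<in> T \<and> F \<subseteq> jset L E}"
  define out where "out = {F\<in>T. \<forall>y\<in>jset L F. \<not> topin (cells P) y}"
  define Q where "Q = P' \<union> {(L, F) | F. F \<in> out}"
  have conv: "\<exists>l\<in>L. \<exists>m\<in>coef E. vs a = l + vs m \<and> l + vs m \<in> jset L E"
    if E: "(\<kappa>, E) \<in> P" and F: "F \<in> T" "F \<subseteq> jset L E" and a: "a \<in> coef F" for \<kappa> E F a
  proof -
    have "convex_cone (jset L E)" by (rule fg_convex_cone[OF joinc_fg[OF S P LE[OF E]]])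
    then have "vs a \<in> jset L E" using vs_mem_convex_cone[OF _ F(2)] T(2)[OF F(1)] a by blast
    then obtain l m where "l \<in> L" "m \<in> coef E" "vs a = l + vs m" by (rule jsetE)
    then show ?thesis using jsetI by blast
  qed
  have kL: "s + l \<in> \<kappa>" if "\<kappa> \<in> S" "s \<in> \<kappa>" "l \<in> L" for s l \<kappa>
    using convex_cone_add[OF lfanD(8)[OF S that(1)] that(2)] lfanD(5)[OF S that(1)] that(3) by blast
  have P'mem: "\<kappa> \<in> S \<and> F \<in> T" if "(\<kappa>, F) \<in> P'" for \<kappa> F
    using that joincD(3)[OF P] by (auto simp: P'_def)
  have P'inj: "s1 = s2 \<and> a1 = a2"
    if *: "(\<kappa>1, F1) \<in> P'" "(\<kappa>2, F2) \<in> P'" "s1 \<in> \<kappa>1" "s2 \<in> \<kappa>2" "a1 \<in> coef F1" "a2 \<in> coef F2" "s1 + vs a1 = s2 + vs a2"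
    for \<kappa>1 F1 \<kappa>2 F2 s1 s2 a1 a2
  proof -
    obtain E1 where E1: "(\<kappa>1, E1) \<in> P" "F1 \<in> T" "F1 \<subseteq> jset L E1" using *(1) by (auto simp: P'_def)
    obtain E2 where E2: "(\<kappa>2, E2) \<in> P" "F2 \<in> T" "F2 \<subseteq> jset L E2" using *(2) by (auto simp: P'_def)
    obtain l1 m1 where 1: "l1 \<in> L" "m1 \<in> coef E1" "vs a1 = l1 + vs m1" using conv[OF E1 *(5)] by blast
    obtain l2 m2 where 2: "l2 \<in> L" "m2 \<in> coef E2" "vs a2 = l2 + vs m2" using conv[OF E2 *(6)] by blast
    have "(s1 + l1) + vs m1 = (s2 + l2) + vs m2" using *(7) 1(3) 2(3) by (simp add: algebra_simps)
    note J = joinc_inj[OF P E1(1) E2(1) kL[OF joincD(3)[OF P E1(1)] *(3) 1(1)] kL[OF joincD(3)[OF P E2(1)] *(4) 2(1)] 1(2) 2(2) this]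
    have "- l1 + vs a1 = - l2 + vs a2" using 1(3) 2(3) J(2) by simp
    from Tinj[OF E1(2) E2(2) subspace_neg[OF L 1(1)] subspace_neg[OF L 2(1)] *(5,6) this]
    show ?thesis using J(1) by simp
  qed
  have P'face: "(\<kappa>', F') \<in> P'" if *: "(\<kappa>, F) \<in> P'" "cface \<kappa>' \<kappa>" "F' \<subseteq> F" for \<kappa> F \<kappa>' F'
  proof -
    obtain E where E: "(\<kappa>, E) \<in> P" "F \<in> T" "F \<subseteq> jset L E" using *(1) by (auto simp: P'_def)
    have "(\<kappa>', E) \<in> P" by (rule joincD(6)[OF P E(1) *(2)]) simp
    moreover have "F' \<in> T" "F' \<subseteq> jset L E" using T(3)[OF E(2) *(3)] E(3) *(3) by auto
    ultimately show ?thesis by (auto simp: P'_def)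
  qed
  have T0: "{} \<in> T" using Tcov[OF subspace_0[OF subspace_V]] T(3) by blast
  have P'base: "(\<kappa>, {}) \<in> P'" if "\<kappa> \<in> S" for \<kappa> using joincD(2)[OF P that] T0 by (auto simp: P'_def)
  have finP': "finite P'"
    by (rule finite_subset[of _ "S \<times> T"]) (use P'mem lfanD(1)[OF S] T(1) in auto)
  have P'wf: "\<kappa> \<in> S \<and> finite F \<and> F \<subseteq> W" if "(\<kappa>, F) \<in> P'" for \<kappa> F
    using P'mem[OF that] T(2)[of F] by simp
  have jP': "joinc S P'"
    by (rule joincI) (fact finP' P'base P'wf P'face P'inj)+
  have P'D: "\<exists>E. (\<kappa>, E) \<in> P \<and> F \<in> T \<and> F \<subseteq> jset L E" if "(\<kappa>, F) \<in> P'" for \<kappa> F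
    using that by (simp add: P'_def)
  have PQ: "s = l \<and> a = c"
    if *: "(\<kappa>, F1) \<in> P'" "F2 \<in> out" "s \<in> \<kappa>" "l \<in> L" "a \<in> coef F1" "c \<in> coef F2" "s + vs a = l + vs c"
    for \<kappa> F1 F2 s l a c
  proof -
    obtain E where E: "(\<kappa>, E) \<in> P" "F1 \<in> T" "F1 \<subseteq> jset L E" using P'D[OF *(1)] by (elim exE conjE)
    have F2: "F2 \<in> T" "\<And>y. y \<in> jset L F2 \<Longrightarrow> \<not> topin (cells P) y" using *(2) by (auto simp: out_def)
    have \<kappa>: "\<kappa> \<in> S" by (rule joincD(3)[OF P E(1)])
    let ?x = "s + vs a"
    have nt: "\<not> topin (cells P) ?x" unfolding *(7) by (rule F2(2)[OF jsetI[OF *(4,6)]])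
    have vaL: "vs a \<in> jset L E" using conv[OF E *(5)] by auto
    have va: "vs a \<in> jset \<kappa> E" using subsetD[OF jset_mono[OF lfanD(5)[OF S \<kappa>] order_refl] vaL] .
    have s: "s \<in> jset \<kappa> E" using jset_base *(3) by blast
    have "s \<in> L"
    proof (rule ccontr)
      assume "s \<notin> L"
      then have "intpt (cells P) s" using ip *(3) \<kappa> by blast
      from intpt_add[OF N this cellsI[OF E(1)] s va] have i: "intpt (cells P) ?x" .
      have "?x \<in> V"
        using fg_subset[OF joinc_fg[OF S P E(1)]] s va subspace_add[OF subspace_V] by blast
      from intpt_imp_topin[OF lfanD(1)[OF N] lfanD(4)[OF N] this i] nt show False by blast
    qed
    from Tinj[OF E(2) F2(1) this *(4,5,6,7)] show ?thesis .
  qed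
  have Qcases: "(\<kappa>, F) \<in> P' \<or> (\<kappa> = L \<and> F \<in> out)" if "(\<kappa>, F) \<in> Q" for \<kappa> F using that by (auto simp: Q_def)
  have jQ: "joinc S Q"
  proof (rule joincI)
    have "finite {(L, F) | F. F \<in> out}"
      by (rule finite_subset[of _ "{L} \<times> T"]) (use T(1) in \<open>auto simp: out_def\<close>)
    then show "finite Q" using finP' by (simp add: Q_def)
    show "(\<kappa>, {}) \<in> Q" if "\<kappa> \<in> S" for \<kappa> using P'base[OF that] by (simp add: Q_def)
  next
    fix \<kappa> F assume "(\<kappa>, F) \<in> Q"
    then have "\<kappa> \<in> S \<and> F \<in> T" using Qcases P'mem LS by (auto simp: out_def)
    then show "\<kappa> \<in> S \<and> finite F \<and> F \<subseteq> W" using T(2) by blast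
  next
    fix \<kappa> F \<kappa>' F' assume *: "(\<kappa>, F) \<in> Q" "cface \<kappa>' \<kappa>" "F' \<subseteq> F"
    from Qcases[OF *(1)] show "(\<kappa>', F') \<in> Q"
    proof
      assume "(\<kappa>, F) \<in> P'"
      then show ?thesis using P'face *(2,3) by (simp add: Q_def)
    next
      assume k: "\<kappa> = L \<and> F \<in> out"
      then have "\<kappa>' = L" using minL *(2) by blast
      moreover have "F' \<in> out" using k T(3)[OF _ *(3)] jset_mono[OF order_refl *(3), of L] unfolding out_def by blast
      ultimately show ?thesis by (simp add: Q_def)
    qed
  next
    fix \<kappa>1 F1 \<kappa>2 F2 s1 s2 a1 a2
    assume *: "(\<kappa>1, F1) \<in> Q" "(\<kappa>2, F2) \<in> Q" "s1 \<in> \<kappa>1" "s2 \<in> \<kappa>2" "a1 \<in> coef F1" "a2 \<in> coef F2" "s1 + vs a1 = s2 + vs a2"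
    from Qcases[OF *(1)] Qcases[OF *(2)]
    consider "(\<kappa>1, F1) \<in> P'" "(\<kappa>2, F2) \<in> P'" | "(\<kappa>1, F1) \<in> P'" "\<kappa>2 = L" "F2 \<in> out"
      | "\<kappa>1 = L" "F1 \<in> out" "(\<kappa>2, F2) \<in> P'" | "\<kappa>1 = L" "F1 \<in> out" "\<kappa>2 = L" "F2 \<in> out" by blast
    then show "s1 = s2 \<and> a1 = a2"
    proof cases
      case 1
      then show ?thesis by (rule P'inj[OF _ _ *(3-7)])
    next
      case 2
      show ?thesis by (rule PQ[OF 2(1,3) *(3) _ *(5-7)]) (use *(4) 2(2) in simp)
    next
      case 3
      have "s2 = s1 \<and> a2 = a1" by (rule PQ[OF 3(3,2) *(4) _ *(6,5) *(7)[symmetric]]) (use *(3) 3(1) in simp)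
      then show ?thesis by simp
    next
      case 4
      then show ?thesis using Tinj[of F1 F2 s1 s2 a1 a2] *(3-7) by (simp add: out_def)
    qed
  qed
  have cov: "\<Union>(cells P') = \<Union>(cells P)"
  proof
    show "\<Union>(cells P') \<subseteq> \<Union>(cells P)"
    proof
      fix x assume "x \<in> \<Union>(cells P')"
      then obtain \<kappa> F where F: "(\<kappa>, F) \<in> P'" "x \<in> jset \<kappa> F" by (auto elim!: cellsE)
      obtain s a where sa: "s \<in> \<kappa>" "a \<in> coef F" "x = s + vs a" using F(2) by (rule jsetE)
      obtain E where E: "(\<kappa>, E) \<in> P" "F \<in> T" "F \<subseteq> jset L E" using F(1) by (auto simp: P'_def)
      obtain l m where lm: "l \<in> L" "m \<in> coef E" "vs a = l + vs m" using conv[OF E sa(2)] by blast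
      have "(s + l) + vs m \<in> jset \<kappa> E" by (rule jsetI[OF kL[OF joincD(3)[OF P E(1)] sa(1) lm(1)] lm(2)])
      then have "x \<in> jset \<kappa> E" using sa(3) lm(3) by (simp add: algebra_simps)
      then show "x \<in> \<Union>(cells P)" using UnionI[OF cellsI[OF E(1)]] by simp
    qed
    show "\<Union>(cells P) \<subseteq> \<Union>(cells P')"
    proof
      fix x assume "x \<in> \<Union>(cells P)"
      then obtain \<kappa> E where E: "(\<kappa>, E) \<in> P" "x \<in> jset \<kappa> E" by (auto elim!: cellsE)
      obtain s a where sa: "s \<in> \<kappa>" "a \<in> coef E" "x = s + vs a" using E(2) by (rule jsetE)
      let ?J = "jset L E"
      have J: "?J \<in> cells P" by (rule cellsI[OF LE[OF E(1)]])
      have vJ: "vs a \<in> ?J" by (rule jset_vs[OF subspace_0[OF L] sa(2)])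
      have vV: "vs a \<in> V" using vJ fg_subset[OF lfanD(4)[OF N J]] by blast
      obtain F l c where F: "F \<in> T" "l \<in> L" "c \<in> coef F" "vs a = l + vs c" "\<forall>f\<in>F. below U f (vs a)"
        using Tcov[OF vV] by blast
      \<comment> \<open>The forms of this cell are nonnegative at \<open>vs a\<close>, hence by
        \<open>below\<close> at each vertex of the arrangement simplex through that point.\<close>
      have "F \<subseteq> ?J"
      proof
        fix g assume g: "g \<in> F"
        have gV: "g \<in> V" using T(2)[OF F(1)] g W_subset_V by blast
        have "0 \<le> u g" if "u \<in> f ?J" for u
          using bspec[OF F(5) g, unfolded below_iff] fU[OF J that] hc[OF J vV] vJ that by blast
        then show "g \<in> ?J" using hc[OF J gV] by blast
      qed
      then have "(\<kappa>, F) \<in> P'" using E(1) F(1) by (auto simp: P'_def)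
      moreover have "(s + l) + vs c \<in> jset \<kappa> F" by (rule jsetI[OF kL[OF joincD(3)[OF P E(1)] sa(1) F(2)] F(3)])
      then have "x \<in> jset \<kappa> F" using sa(3) F(4) by (simp add: algebra_simps)
      ultimately show "x \<in> \<Union>(cells P')" using cellsI by blast
    qed
  qed
  have "V \<subseteq> \<Union>(cells Q)"
  proof
    fix x assume x: "x \<in> V"
    show "x \<in> \<Union>(cells Q)"
    proof (cases "x \<in> \<Union>(cells P)")
      case True
      then have "x \<in> \<Union>(cells P')" using cov by simp
      then show ?thesis unfolding Q_def by auto
    next
      case False
      obtain F l a where F: "F \<in> T" "l \<in> L" "a \<in> coef F" "x = l + vs a" "\<forall>f\<in>F. below U f x" using Tcov[OF x] by blast
      \<comment> \<open>If \<open>y\<close> were interior, some cell \<rho> would contain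
        \<open>y + d x\<close> for a small \<open>d\<close>. As \<open>x\<close> is outside \<rho>,
        a form of \<rho> is negative at \<open>x\<close>; by \<open>below\<close> it is nonpositive
        on \<open>F\<close>, and it vanishes on \<open>L\<close>, so it is negative at
        \<open>y + d x\<close>.\<close>
      have "\<not> topin (cells P) y" if y: "y \<in> jset L F" for y
      proof
        assume "topin (cells P) y"
        then obtain e where e: "e > 0" "\<forall>z\<in>V. norm (z - y) < e \<longrightarrow> z \<in> \<Union>(cells P)" unfolding topin_def by blast
        obtain l' c where c: "l' \<in> L" "c \<in> coef F" "y = l' + vs c" using y by (rule jsetE)
        define d where "d = e / (norm x + 1)"
        have "norm x + 1 > 0" by (simp add: add_nonneg_pos)
        then have d: "d > 0" "d * norm x < e" using e(1) by (simp_all add: d_def field_simps)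
        have yV: "y \<in> V"
        proof -
          have "vs c \<in> V"
            using vs_mem_convex_cone[OF subspace_imp_convex_cone[OF subspace_V] _ _ c(2)] T(2)[OF F(1)] W_subset_V by blast
          then show ?thesis using c(1,3) LV subspace_add[OF subspace_V] by blast
        qed
        have zV: "y + d *\<^sub>R x \<in> V" using yV x subspace_V by (simp add: subspace_add subspace_scale)
        have "norm (y + d *\<^sub>R x - y) < e" using d by simp
        then obtain \<rho> where \<rho>: "\<rho> \<in> cells P" "y + d *\<^sub>R x \<in> \<rho>" using e(2) zV by blast
        have "x \<notin> \<rho>" using False \<rho>(1) by blast
        then obtain u where u: "u \<in> f \<rho>" "u x < 0" using hc[OF \<rho>(1) x] by (meson not_le)
        have uU: "u \<in> U" by (rule fU[OF \<rho>(1) u(1)])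
        have lu: "linear u" using U(2) uU by (simp add: rform_def)
        have "u l' = 0" using c(1) uU LU by blast
        then have "u y = (\<Sum>g\<in>F. c g * u g)"
          using vs_form[OF lu _ c(2)] T(2)[OF F(1)] c(3) by (simp add: linear_add[OF lu])
        also have "\<dots> \<le> 0"
        proof (rule sum_nonpos)
          fix g assume "g \<in> F"
          then have "u g \<le> 0" using F(5) uU u(2) unfolding below_iff by (meson less_imp_le)
          then show "c g * u g \<le> 0" using coef_nonneg[OF c(2)] by (simp add: mult_nonneg_nonpos)
        qed
        finally have "u (y + d *\<^sub>R x) < 0"
          using u(2) d(1) mult_pos_neg[of d "u x"] by (simp add: linear_add[OF lu] linear_scale[OF lu])
        then show False using hc[OF \<rho>(1) zV] \<rho>(2) u(1) by (meson not_le)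
      qed
      then have "F \<in> out" using F(1) by (simp add: out_def)
      then have "(L, F) \<in> Q" by (simp add: Q_def)
      moreover have "x \<in> jset L F" unfolding F(4) by (rule jsetI[OF F(2,3)])
      ultimately show ?thesis using cellsI by blast
    qed
  qed
  moreover have "\<Union>(cells Q) \<subseteq> V" using fg_subset[OF lfanD(4)[OF lfan_cells[OF S jQ]]] by blast
  ultimately have "\<Union>(cells Q) = V" by blast
  moreover have "P' \<subseteq> Q" by (simp add: Q_def)
  moreover have "\<forall>\<kappa> F. (\<kappa>, F) \<in> P' \<longrightarrow> (\<exists>E. (\<kappa>, E) \<in> P \<and> F \<subseteq> jset L E \<and> (\<forall>\<kappa>'. (\<kappa>', E) \<in> P \<longrightarrow> (\<kappa>', F) \<in> P'))"
    unfolding P'_def by blast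
  ultimately show ?thesis using jP' jQ cov by blast
qed

text \<open>The stars used for the neighbourhood live over lineality spaces of larger dimension, so
  the codimension of \<open>L\<close> decreases. In codimension 0 there is no star to treat, and the
  same argument serves as the base case.\<close>

lemma complete_join_exists:
  "lfan L S \<Longrightarrow> \<exists>Q. joinc S Q \<and> \<Union>(cells Q) = V"
proof (induction "dim V - dim L" arbitrary: L S rule: less_induct)
  case less
  have "\<exists>Q. joinc S' Q \<and> \<Union>(cells Q) = V" if "lfan L' S'" "dim L < dim L'" for L' S'
  proof (rule less.hyps[OF _ that(1)])
    have "dim L' \<le> dim V" using fg_subset[OF lfanD(4)[OF that(1) lfanD(3)[OF that(1)]]] by (rule dim_subset)
    then show "dim V - dim L' < dim V - dim L" using that(2) by linarith
  qed
  then have "\<exists>P. joinc S P \<and> tight P \<and> based L P \<and> (\<forall>x\<in>\<Union>S - L. intpt (cells P) x)"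
    by (rule exists_neighbourhood_join[OF less.prems])
  then obtain P where P: "joinc S P" "\<forall>x\<in>\<Union>S - L. intpt (cells P) x" by (elim exE conjE)
  from completion_exists[OF less.prems P]
  obtain P' Q where "joinc S Q" "\<Union>(cells Q) = V" by (elim exE conjE)
  then show ?case by (intro exI[of _ Q] conjI)
qed

end

section \<open>Bases of \<open>K\<close>-structures\<close>

text \<open>The homomorphism out of the free abelian group with values \<open>g\<close> on
  generators. Two instances matter: the canonical map of the tensor product, and the map induced by
  a K-linear functional, which detects nonzero tensors.\<close>

definition frag_eval :: "('b \<Rightarrow> 'v::real_vector) \<Rightarrow> ('b \<Rightarrow>\<^sub>0 int) \<Rightarrow> 'v" where
  "frag_eval g c = (\<Sum>p\<in>Poly_Mapping.keys c. of_int (Poly_Mapping.lookup c p) *\<^sub>R g p)"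

lemma frag_eval_superset:
  assumes "finite A" "Poly_Mapping.keys c \<subseteq> A"
  shows "frag_eval g c = (\<Sum>p\<in>A. of_int (Poly_Mapping.lookup c p) *\<^sub>R g p)"
  unfolding frag_eval_def by (rule sum.mono_neutral_left) (use assms in \<open>auto simp: in_keys_iff\<close>)

lemma frag_eval_zero [simp]: "frag_eval g 0 = 0"
  by (simp add: frag_eval_def)

lemma frag_eval_uminus: "frag_eval g (- c) = - frag_eval g c"
  unfolding frag_eval_def by (simp add: sum_negf)

lemma frag_eval_add: "frag_eval g (c + d) = frag_eval g c + frag_eval g d"
proof -
  let ?A = "Poly_Mapping.keys c \<union> Poly_Mapping.keys d"
  have A: "finite ?A" by simp
  have "Poly_Mapping.keys (c + d) \<subseteq> ?A" by (rule Poly_Mapping.keys_add)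
  from frag_eval_superset[OF A this, of g] frag_eval_superset[OF A, of c g] frag_eval_superset[OF A, of d g]
  show ?thesis by (simp add: lookup_add scaleR_add_left sum.distrib)
qed

lemma frag_eval_diff: "frag_eval g (c - d) = frag_eval g c - frag_eval g d"
  using frag_eval_add[of g c "- d"] frag_eval_uminus[of g d] by simp

lemma frag_eval_of: "frag_eval g (frag_of p) = g p"
  by (simp add: frag_eval_def)

lemma frag_eval_sum: "frag_eval g (\<Sum>i\<in>I. f i) = (\<Sum>i\<in>I. frag_eval g (f i))"
  by (induction I rule: infinite_finite_induct) (simp_all add: frag_eval_add)

lemma tensor_eval_eq: "tensor_eval = frag_eval (\<lambda>p. fst p *\<^sub>R snd p)"
  by (rule ext) (simp add: tensor_eval_def frag_eval_def)

lemma tensor_relations_subset: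
  assumes "scalar_subspace K W"
  shows "tensor_relations K W \<subseteq> carrier (free_Abelian_group (UNIV \<times> W))"
proof
  fix x assume "x \<in> tensor_relations K W"
  then consider r s w where "x = frag_of (r + s, w) - frag_of (r, w) - frag_of (s, w)" "w \<in> W"
    | r w w' where "x = frag_of (r, w + w') - frag_of (r, w) - frag_of (r, w')" "w \<in> W" "w' \<in> W"
    | r k w where "x = frag_of (r * k, w) - frag_of (r, k *\<^sub>R w)" "k \<in> K" "w \<in> W"
    unfolding tensor_relations_def by blast
  then show "x \<in> carrier (free_Abelian_group (UNIV \<times> W))"
  proof cases
    case 1
    then show ?thesis using keys_diff[of "frag_of (r + s, w) - frag_of (r, w)" "frag_of (s, w)"]
        keys_diff[of "frag_of (r + s, w)" "frag_of (r, w)"] by auto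
  next
    case 2
    then have "w + w' \<in> W" using assms by (simp add: scalar_subspace_def)
    with 2 show ?thesis using keys_diff[of "frag_of (r, w + w') - frag_of (r, w)" "frag_of (r, w')"]
        keys_diff[of "frag_of (r, w + w')" "frag_of (r, w)"] by auto
  next
    case 3
    then have "k *\<^sub>R w \<in> W" using assms by (simp add: scalar_subspace_def)
    with 3 show ?thesis using keys_diff[of "frag_of (r * k, w)" "frag_of (r, k *\<^sub>R w)"] by auto
  qed
qed

lemma frag_eval_generate:
  assumes "scalar_subspace K W" "\<And>x. x \<in> tensor_relations K W \<Longrightarrow> frag_eval g x = 0"
    and "c \<in> generate (free_Abelian_group (UNIV \<times> W)) (tensor_relations K W)"
  shows "frag_eval g c = 0"
  using assms(3)
proof (induction rule: generate.induct)
  case (inv h)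
  then have "h \<in> carrier (free_Abelian_group (UNIV \<times> W))" using tensor_relations_subset[OF assms(1)] by blast
  then show ?case using assms(2)[OF inv] by (simp add: frag_eval_uminus)
qed (simp_all add: assms(2) frag_eval_add)

text \<open>The universal property of the tensor product in the direction used: biadditive
  K-balanced maps kill the relations.\<close>

lemma frag_eval_relations:
  assumes "\<And>r s w. w \<in> W \<Longrightarrow> g (r + s, w) = g (r, w) + g (s, w)"
    "\<And>r w w'. w \<in> W \<Longrightarrow> w' \<in> W \<Longrightarrow> g (r, w + w') = g (r, w) + g (r, w')"
    "\<And>r k w. k \<in> K \<Longrightarrow> w \<in> W \<Longrightarrow> g (r * k, w) = g (r, k *\<^sub>R w)"
    and "x \<in> tensor_relations K W"
  shows "frag_eval g x = 0"
  using assms(4) unfolding tensor_relations_def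
  by (auto simp: frag_eval_diff frag_eval_of assms(1-3))

lemma tensor_eval_relations: "x \<in> tensor_relations K W \<Longrightarrow> tensor_eval x = 0"
  unfolding tensor_eval_eq by (rule frag_eval_relations) (auto simp: algebra_simps)

lemma tensor_canonical_coset:
  assumes "scalar_subspace K W" and "c \<in> carrier (free_Abelian_group (UNIV \<times> W))"
  defines "C \<equiv> generate (free_Abelian_group (UNIV \<times> W)) (tensor_relations K W) #>\<^bsub>free_Abelian_group (UNIV \<times> W)\<^esub> c"
  shows "C \<in> carrier (real_tensor K W)" "c \<in> C" "tensor_canonical C = tensor_eval c"
proof -
  let ?G = "free_Abelian_group (UNIV \<times> W) :: (real \<times> 'a \<Rightarrow>\<^sub>0 int) monoid"
  let ?H = "generate ?G (tensor_relations K W)"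
  show "C \<in> carrier (real_tensor K W)"
    unfolding real_tensor_def C_def FactGroup_def RCOSETS_def using assms(2) by auto
  have mem: "x \<in> C \<longleftrightarrow> (\<exists>h\<in>?H. x = h + c)" for x unfolding C_def r_coset_def by auto
  have "0 \<in> ?H" using generate.one[of ?G] by simp
  then show "c \<in> C" unfolding mem by (intro bexI[of _ 0]) auto
  have "tensor_eval x = tensor_eval c" if "x \<in> C" for x
  proof -
    from \<open>x \<in> C\<close> obtain h where h: "h \<in> ?H" "x = h + c" unfolding mem by (elim bexE)
    have "frag_eval (\<lambda>p. fst p *\<^sub>R snd p) h = 0"
      using frag_eval_generate[OF assms(1) _ h(1)] tensor_eval_relations[of _ K W] unfolding tensor_eval_eq by blast
    then show ?thesis unfolding h(2) tensor_eval_eq by (simp add: frag_eval_add)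
  qed
  then have "tensor_eval ` C = {tensor_eval c}" using \<open>c \<in> C\<close> by blast
  then show "tensor_canonical C = tensor_eval c" by (simp add: tensor_canonical_def)
qed

lemma tensor_kernel:
  assumes W: "scalar_subspace K W" and inj: "inj_on tensor_canonical (carrier (real_tensor K W))"
    and c: "c \<in> carrier (free_Abelian_group (UNIV \<times> W))" "tensor_eval c = 0"
  shows "c \<in> generate (free_Abelian_group (UNIV \<times> W)) (tensor_relations K W)"
proof -
  let ?G = "free_Abelian_group (UNIV \<times> W) :: (real \<times> 'a \<Rightarrow>\<^sub>0 int) monoid"
  let ?H = "generate ?G (tensor_relations K W)"
  have 0: "(0 :: real \<times> 'a \<Rightarrow>\<^sub>0 int) \<in> carrier ?G" by simp
  have "tensor_canonical (?H #>\<^bsub>?G\<^esub> c) = tensor_canonical (?H #>\<^bsub>?G\<^esub> 0)"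
    using tensor_canonical_coset(3)[OF W c(1)] tensor_canonical_coset(3)[OF W 0] c(2)
    by (simp add: tensor_eval_eq)
  then have "?H #>\<^bsub>?G\<^esub> c = ?H #>\<^bsub>?G\<^esub> 0"
    using inj tensor_canonical_coset(1)[OF W c(1)] tensor_canonical_coset(1)[OF W 0] by (auto dest: inj_onD)
  then have "c \<in> ?H #>\<^bsub>?G\<^esub> 0" using tensor_canonical_coset(2)[OF W c(1)] by simp
  then show ?thesis unfolding r_coset_def by auto
qed

text \<open>A \<open>K\<close>-linear functional on \<open>W\<close> that separates \<open>w\<close> from \<open>N\<close>, obtained from a maximal
  \<open>K\<close>-subspace containing \<open>N\<close> but not \<open>w\<close>.\<close>

lemma scalar_functional:
  assumes K: "real_subfield K" and W: "scalar_subspace K W" and N: "scalar_subspace K N" "N \<subseteq> W"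
    and w: "w \<in> W" "w \<notin> N"
  shows "\<exists>\<phi>::'a::real_vector \<Rightarrow> real. (\<forall>x\<in>W. \<forall>y\<in>W. \<phi> (x + y) = \<phi> x + \<phi> y) \<and>
    (\<forall>k\<in>K. \<forall>x\<in>W. \<phi> (k *\<^sub>R x) = k * \<phi> x) \<and> (\<forall>x\<in>N. \<phi> x = 0) \<and> \<phi> w = 1"
proof -
  define \<A> where "\<A> = {M. scalar_subspace K M \<and> N \<subseteq> M \<and> M \<subseteq> W \<and> w \<notin> M}"
  have "\<exists>M\<in>\<A>. \<forall>X\<in>\<A>. M \<subseteq> X \<longrightarrow> X = M"
  proof (rule subset_Zorn_nonempty)
    show "\<A> \<noteq> {}" using N w by (auto simp: \<A>_def)
    fix \<C> assume C: "\<C> \<noteq> {}" "subset.chain \<A> \<C>"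
    have CA: "\<C> \<subseteq> \<A>" and ch: "\<And>X Y. X \<in> \<C> \<Longrightarrow> Y \<in> \<C> \<Longrightarrow> X \<subseteq> Y \<or> Y \<subseteq> X"
      using C(2) by (auto simp: subset_chain_def)
    have sub: "scalar_subspace K X" if "X \<in> \<C>" for X using that CA by (auto simp: \<A>_def)
    have "scalar_subspace K (\<Union>\<C>)"
      unfolding scalar_subspace_def
    proof (intro conjI ballI)
      show "0 \<in> \<Union>\<C>" using C(1) sub by (auto simp: scalar_subspace_def)
      fix x y assume "x \<in> \<Union>\<C>" "y \<in> \<Union>\<C>"
      then obtain X Y where XY: "X \<in> \<C>" "x \<in> X" "Y \<in> \<C>" "y \<in> Y" by blast
      then obtain Z where "Z \<in> \<C>" "x \<in> Z" "y \<in> Z" using ch[OF XY(1,3)] by blast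
      then show "x + y \<in> \<Union>\<C>" using sub[of Z] unfolding scalar_subspace_def by blast
    next
      fix k x assume "k \<in> K" "x \<in> \<Union>\<C>"
      then show "k *\<^sub>R x \<in> \<Union>\<C>" using sub unfolding scalar_subspace_def by blast
    qed
    then show "\<Union>\<C> \<in> \<A>" using CA C(1) unfolding \<A>_def by blast
  qed
  then obtain M where M0: "M \<in> \<A>" "\<forall>X\<in>\<A>. M \<subseteq> X \<longrightarrow> X = M" by (elim bexE)
  have M: "scalar_subspace K M" "N \<subseteq> M" "M \<subseteq> W" "w \<notin> M" using M0(1) by (simp_all add: \<A>_def)
  have max: "X = M" if "scalar_subspace K X" "M \<subseteq> X" "X \<subseteq> W" "w \<notin> X" for X
  proof -
    have "X \<in> \<A>" using that M(2) by (simp add: \<A>_def)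
    then show ?thesis using M0(2) that(2) by simp
  qed
  have K': "0 \<in> K" "1 \<in> K" "\<And>x y. x \<in> K \<Longrightarrow> y \<in> K \<Longrightarrow> x + y \<in> K" "\<And>x y. x \<in> K \<Longrightarrow> y \<in> K \<Longrightarrow> x * y \<in> K"
    "\<And>x. x \<in> K \<Longrightarrow> - x \<in> K" "\<And>x. x \<in> K \<Longrightarrow> inverse x \<in> K"
    using K by (simp_all add: real_subfield_def)
  have Madd: "x + y \<in> M" if "x \<in> M" "y \<in> M" for x y using M(1) that by (auto simp: scalar_subspace_def)
  have Msc: "k *\<^sub>R x \<in> M" if "k \<in> K" "x \<in> M" for k x using M(1) that by (auto simp: scalar_subspace_def)
  have Mneg: "- x \<in> M" if "x \<in> M" for x using Msc[OF K'(5)[OF K'(2)] that] by simp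
  have Mdiff: "x - y \<in> M" if "x \<in> M" "y \<in> M" for x y using Madd[OF that(1) Mneg[OF that(2)]] by simp
  have uniq: "k = l" if "k \<in> K" "l \<in> K" "v - k *\<^sub>R w \<in> M" "v - l *\<^sub>R w \<in> M" for k l v
  proof (rule ccontr)
    assume kl: "k \<noteq> l"
    have "(v - l *\<^sub>R w) - (v - k *\<^sub>R w) \<in> M" by (rule Mdiff[OF that(4,3)])
    then have "(k - l) *\<^sub>R w \<in> M" by (simp add: algebra_simps)
    moreover have "inverse (k - l) \<in> K" using K'(6)[OF K'(3)[OF that(1) K'(5)[OF that(2)]]] by simp
    ultimately have "inverse (k - l) *\<^sub>R (k - l) *\<^sub>R w \<in> M" by (rule Msc[rotated])
    then show False using kl M(4) by simp
  qed
  \<comment> \<open>By maximality, adjoining any \<open>v\<close> outside \<open>M\<close> produces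
    \<open>w\<close>; solving for \<open>v\<close> shows that \<open>W\<close> is \<open>M\<close>
    plus the K-multiples of \<open>w\<close>.\<close>
  have ex: "\<exists>k\<in>K. v - k *\<^sub>R w \<in> M" if v: "v \<in> W" for v
  proof (cases "v \<in> M")
    case True
    then show ?thesis using K'(1) by (intro bexI[of _ 0]) auto
  next
    case False
    let ?X = "{m + k *\<^sub>R v | m k. m \<in> M \<and> k \<in> K}"
    have sX: "scalar_subspace K ?X"
      unfolding scalar_subspace_def
    proof (intro conjI ballI)
      have "0 + 0 *\<^sub>R v \<in> ?X" using K'(1) M(1) unfolding scalar_subspace_def by blast
      then show "0 \<in> ?X" by simp
      fix x y assume "x \<in> ?X" "y \<in> ?X"
      then obtain m k m' k' where *: "x = m + k *\<^sub>R v" "y = m' + k' *\<^sub>R v" "m \<in> M" "k \<in> K" "m' \<in> M" "k' \<in> K" by blast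
      then have "x + y = (m + m') + (k + k') *\<^sub>R v" by (simp add: algebra_simps)
      then show "x + y \<in> ?X" using Madd[OF *(3,5)] K'(3)[OF *(4,6)] by blast
    next
      fix l x assume l: "l \<in> K" and "x \<in> ?X"
      then obtain m k where *: "x = m + k *\<^sub>R v" "m \<in> M" "k \<in> K" by blast
      then have "l *\<^sub>R x = l *\<^sub>R m + (l * k) *\<^sub>R v" by (simp add: algebra_simps)
      then show "l *\<^sub>R x \<in> ?X" using Msc[OF l *(2)] K'(4)[OF l *(3)] by blast
    qed
    have MX: "M \<subseteq> ?X"
    proof
      fix m assume "m \<in> M"
      then have "m + 0 *\<^sub>R v \<in> ?X" using K'(1) by blast
      then show "m \<in> ?X" by simp
    qed
    have XW: "?X \<subseteq> W"
    proof
      fix x assume "x \<in> ?X"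
      then obtain m k where *: "x = m + k *\<^sub>R v" "m \<in> M" "k \<in> K" by blast
      then show "x \<in> W" using W v M(3) unfolding scalar_subspace_def by blast
    qed
    have "0 + 1 *\<^sub>R v \<in> ?X" using K'(2) M(1) unfolding scalar_subspace_def by blast
    then have "?X \<noteq> M" using False by auto
    then have "w \<in> ?X" using max[OF sX MX XW] by blast
    then obtain m k where mk: "w = m + k *\<^sub>R v" "m \<in> M" "k \<in> K" by blast
    have k0: "k \<noteq> 0" using mk(1,2) M(4) by auto
    have "v - inverse k *\<^sub>R w = - (inverse k *\<^sub>R m)" using k0 by (simp add: mk(1) algebra_simps)
    also have "\<dots> \<in> M" using Mneg[OF Msc[OF K'(6)[OF mk(3)] mk(2)]] .
    finally show ?thesis using K'(6)[OF mk(3)] by blast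
  qed
  \<comment> \<open>The coordinate along \<open>w\<close> modulo \<open>M\<close>.\<close>
  define \<phi> where "\<phi> v = (THE k. k \<in> K \<and> v - k *\<^sub>R w \<in> M)" for v
  have \<phi>: "\<phi> v = k" if "k \<in> K" "v - k *\<^sub>R w \<in> M" for k v
    unfolding \<phi>_def by (rule the_equality) (use that uniq in blast)+
  have \<phi>': "\<phi> v \<in> K" "v - \<phi> v *\<^sub>R w \<in> M" if "v \<in> W" for v
    using ex[OF that] \<phi> by auto
  have "\<phi> (x + y) = \<phi> x + \<phi> y" if "x \<in> W" "y \<in> W" for x y
  proof (rule \<phi>)
    show "\<phi> x + \<phi> y \<in> K" using \<phi>'(1) that K'(3) by blast
    have "(x - \<phi> x *\<^sub>R w) + (y - \<phi> y *\<^sub>R w) \<in> M" using \<phi>'(2) that Madd by blast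
    then show "x + y - (\<phi> x + \<phi> y) *\<^sub>R w \<in> M" by (simp add: algebra_simps)
  qed
  moreover have "\<phi> (k *\<^sub>R x) = k * \<phi> x" if "k \<in> K" "x \<in> W" for k x
  proof (rule \<phi>)
    show "k * \<phi> x \<in> K" using \<phi>'(1) that K'(4) by blast
    have "k *\<^sub>R (x - \<phi> x *\<^sub>R w) \<in> M" using \<phi>'(2) that Msc by blast
    then show "k *\<^sub>R x - (k * \<phi> x) *\<^sub>R w \<in> M" by (simp add: algebra_simps)
  qed
  moreover have "\<phi> x = 0" if "x \<in> N" for x by (rule \<phi>) (use that M(2) K'(1) in auto)
  moreover have "\<phi> w = 1" by (rule \<phi>) (use K'(2) M(1) in \<open>auto simp: scalar_subspace_def\<close>)
  ultimately show ?thesis by (intro exI[of _ \<phi>] conjI ballI)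
qed

text \<open>For \<open>w \<in> W\<close> with coordinates \<open>r b\<close> the tensor of \<open>1\<close> and \<open>w\<close> minus the sum of those of \<open>r b\<close> and
  \<open>b\<close> is in the kernel of the canonical map, hence zero; a \<open>K\<close>-linear functional vanishing on the
  \<open>K\<close>-span of the basis, but not at \<open>w\<close>, contradicts this.\<close>

lemma K_structure_basis:
  fixes V W :: "'a::euclidean_space set"
  assumes V: "subspace V" and K: "real_subfield K" and KS: "K_structure K V W"
  shows "\<exists>B. independent B \<and> V = span B \<and> W = {x\<in>span B. \<forall>b. representation B x b \<in> K}"
proof -
  have WV: "W \<subseteq> V" and W: "scalar_subspace K W"
    and bij: "bij_betw tensor_canonical (carrier (real_tensor K W)) V"
    using KS by (auto simp: K_structure_def)
  have inj: "inj_on tensor_canonical (carrier (real_tensor K W))" using bij by (rule bij_betw_imp_inj_on)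
  let ?G = "free_Abelian_group (UNIV \<times> W) :: (real \<times> 'a \<Rightarrow>\<^sub>0 int) monoid"
  have te: "tensor_eval c \<in> span W" if "c \<in> carrier ?G" for c
  proof -
    have "snd p \<in> W" if "p \<in> Poly_Mapping.keys c" for p
      using \<open>c \<in> carrier ?G\<close> that by auto
    then show ?thesis unfolding tensor_eval_def by (intro span_sum span_scale span_base)
  qed
  have "V \<subseteq> span W"
  proof
    fix x assume "x \<in> V"
    then obtain C where C: "C \<in> carrier (real_tensor K W)" "x = tensor_canonical C"
      using bij unfolding bij_betw_def by blast
    then obtain c where c: "c \<in> carrier ?G" "C = generate ?G (tensor_relations K W) #>\<^bsub>?G\<^esub> c"
      unfolding real_tensor_def FactGroup_def RCOSETS_def by auto
    then show "x \<in> span W" using C(2) tensor_canonical_coset(3)[OF W c(1)] te[OF c(1)] by simp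
  qed
  then have VW: "V = span W" using span_minimal[OF WV V] by blast
  obtain B where B: "B \<subseteq> W" "independent B" "W \<subseteq> span B" using maximal_independent_subset[of W] by blast
  have VB: "V = span B" unfolding VW using B(1,3) by (metis span_mono span_span subset_antisym)
  have fB: "finite B" by (rule finiteI_independent[OF B(2)])
  let ?r = "representation B"
  \<comment> \<open>The K-span of \<open>B\<close>. It lies in \<open>W\<close> because
    \<open>W\<close> is closed under K-combinations; the reverse inclusion is where injectivity of
    the canonical map enters.\<close>
  define N where "N = {x\<in>span B. \<forall>b. ?r x b \<in> K}"
  have K': "0 \<in> K" "1 \<in> K" "\<And>x y. x \<in> K \<Longrightarrow> y \<in> K \<Longrightarrow> x + y \<in> K" "\<And>x y. x \<in> K \<Longrightarrow> y \<in> K \<Longrightarrow> x * y \<in> K"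
    using K by (auto simp: real_subfield_def)
  have N: "scalar_subspace K N"
    unfolding scalar_subspace_def N_def
    by (auto simp: representation_zero span_zero span_add span_scale representation_add[OF B(2)]
        representation_scale[OF B(2)] intro: K')
  have NW: "N \<subseteq> W"
  proof
    fix x assume "x \<in> N"
    then have x: "x \<in> span B" "\<And>b. ?r x b \<in> K" by (auto simp: N_def)
    have "(\<Sum>b\<in>A. ?r x b *\<^sub>R b) \<in> W" if "A \<subseteq> B" for A
      using finite_subset[OF that fB] that
    proof (induction A rule: finite_induct)
      case empty
      then show ?case using W by (simp add: scalar_subspace_def)
    next
      case (insert b A)
      then show ?case using W B(1) x(2) by (auto simp: scalar_subspace_def)
    qed
    from this[of B] show "x \<in> W" using sum_representation_eq[OF B(2) x(1) fB order_refl] by simp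
  qed
  have BN: "B \<subseteq> N" by (auto simp: N_def span_base representation_basis[OF B(2)] K')
  have "W \<subseteq> N"
  proof
    fix w assume w: "w \<in> W"
    show "w \<in> N"
    proof (rule ccontr)
      assume "w \<notin> N"
      from scalar_functional[OF K W N NW w this] obtain \<phi> :: "'a \<Rightarrow> real" where
        add: "\<forall>x\<in>W. \<forall>y\<in>W. \<phi> (x + y) = \<phi> x + \<phi> y" and sc: "\<forall>k\<in>K. \<forall>x\<in>W. \<phi> (k *\<^sub>R x) = k * \<phi> x"
        and \<phi>N: "\<forall>x\<in>N. \<phi> x = 0" and \<phi>w: "\<phi> w = 1" by blast
      let ?c = "frag_of (1, w) - (\<Sum>b\<in>B. frag_of (?r w b, b)) :: real \<times> 'a \<Rightarrow>\<^sub>0 int"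
      \<comment> \<open>Sends the tensor of \<open>r\<close> and \<open>x\<close> to
        \<open>r * \<phi> x\<close>. It has value 1 on \<open>?c\<close>, as \<phi> is 1 at
        \<open>w\<close> and vanishes on \<open>B\<close>, although it must be 0 on the subgroup
        generated by the relations.\<close>
      let ?\<psi> = "\<lambda>p. fst p * \<phi> (snd p)"
      have "(\<Sum>b\<in>B. frag_of (?r w b, b)) \<in> carrier ?G"
        by (rule sum_closed_free_Abelian_group) (use B(1) in auto)
      then have cG: "?c \<in> carrier ?G"
        using keys_diff[of "frag_of (1::real, w)" "\<Sum>b\<in>B. frag_of (?r w b, b)"] w by auto
      have "w \<in> span B" using w B(3) by blast
      then have "tensor_eval ?c = 0"
        unfolding tensor_eval_eq using sum_representation_eq[OF B(2) _ fB order_refl, of w]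
        by (simp add: frag_eval_diff frag_eval_sum frag_eval_of)
      from tensor_kernel[OF W inj cG this] have gen: "?c \<in> generate ?G (tensor_relations K W)" .
      have "frag_eval ?\<psi> ?c = 0"
        by (rule frag_eval_generate[OF W frag_eval_relations gen]) (auto simp: add sc algebra_simps)
      moreover have "(\<Sum>b\<in>B. ?r w b * \<phi> b) = 0" using \<phi>N BN by (intro sum.neutral) auto
      then have "frag_eval ?\<psi> ?c = 1"
        by (simp add: frag_eval_diff frag_eval_sum frag_eval_of \<phi>w)
      ultimately show False by simp
    qed
  qed
  then have "W = N" using NW by blast
  then show ?thesis using B(2) VB unfolding N_def by blast
qed

context rational_space
begin

section \<open>Comparison with the definitions of polycones and fans\<close>

lemma dim_kernel_hyperplane:
  fixes u :: "'a \<Rightarrow> real"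
  assumes u: "linear u" and w: "w \<in> V" "u w \<noteq> 0"
  shows "subspace {x\<in>V. u x = 0}" "dim {x\<in>V. u x = 0} + 1 = dim V"
proof -
  let ?H = "{x\<in>V. u x = 0}"
  show H: "subspace ?H"
    using subspace_V by (auto simp: subspace_def linear_0[OF u] linear_add[OF u] linear_scale[OF u])
  have "span (insert w ?H) = V"
  proof
    show "span (insert w ?H) \<subseteq> V" by (rule span_minimal) (use w subspace_V in auto)
    show "V \<subseteq> span (insert w ?H)"
    proof
      fix x assume x: "x \<in> V"
      have "x - (u x / u w) *\<^sub>R w \<in> ?H"
        using x w subspace_V by (auto simp: subspace_diff subspace_scale linear_diff[OF u] linear_scale[OF u])
      then have "(x - (u x / u w) *\<^sub>R w) + (u x / u w) *\<^sub>R w \<in> span (insert w ?H)"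
        by (intro span_add span_scale span_base) auto
      then show "x \<in> span (insert w ?H)" by simp
    qed
  qed
  then have "dim V = dim (insert w ?H)" by (metis dim_span)
  moreover have sp: "span ?H = ?H" using H by (rule span_eq_iff[THEN iffD2])
  have "w \<notin> span ?H" unfolding sp using w(2) by simp
  ultimately show "dim ?H + 1 = dim V" by (simp add: dim_insert)
qed

lemma fg_rational_subspace:
  assumes "fg H" "subspace H"
  shows "rational_subspace W H"
proof -
  obtain G where G: "finite G" "G \<subseteq> W" "H = convex_cone hull G" using assms(1) unfolding fg_def by blast
  obtain C where C: "C \<subseteq> G" "independent C" "G \<subseteq> span C" using maximal_independent_subset[of G] by blast
  have "G \<subseteq> H" unfolding G(3) by (rule hull_subset)
  then have "span C \<subseteq> H" using C(1) by (intro span_minimal[OF _ assms(2)]) blast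
  moreover have "H \<subseteq> span C" unfolding G(3) by (rule hull_minimal[where S = convex_cone, OF C(3) convex_cone_span])
  ultimately show ?thesis unfolding rational_subspace_def using C(1,2) G(2) by blast
qed

lemma rational_subspace_fg:
  assumes "rational_subspace W H"
  shows "fg H"
proof -
  obtain C where C: "C \<subseteq> W" "independent C" "span C = H" using assms unfolding rational_subspace_def by blast
  have fC: "finite C" by (rule finiteI_independent[OF C(2)])
  have f: "fg (convex_cone hull C)" by (rule fg_hull[OF fC C(1)])
  let ?E = "ext (convex_cone hull C) (convex_cone hull C)"
  have "fg ?E" by (rule fg_ext[OF f f])
  moreover have "?E = span (convex_cone hull C)" by (rule ext_self[OF convex_cone_convex_cone_hull])
  moreover have "span (convex_cone hull C) = H"
  proof
    have "convex_cone hull C \<subseteq> span C" by (rule hull_minimal[where S = convex_cone, OF span_superset convex_cone_span])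
    then show "span (convex_cone hull C) \<subseteq> H" unfolding C(3)[symmetric] using span_minimal subspace_span by blast
    show "H \<subseteq> span (convex_cone hull C)" unfolding C(3)[symmetric] by (rule span_mono[OF hull_subset])
  qed
  ultimately show ?thesis by simp
qed

text \<open>A hyperplane has, up to scaling, only one defining form, so one of the rational forms that cut
  out the finitely generated cone \<open>u = 0\<close> is a multiple of \<open>u\<close>.\<close>

lemma rational_halfspace_rform:
  assumes "rational_halfspace V W S"
  shows "\<exists>u. rform u \<and> S = {x\<in>V. 0 \<le> u x}"
proof -
  obtain u :: "'a \<Rightarrow> real" where u: "linear u" "rational_hyperplane V W {x\<in>V. u x = 0}" "S = {x\<in>V. 0 \<le> u x}"
    using assms unfolding rational_halfspace_def by blast
  let ?H = "{x\<in>V. u x = 0}"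
  have H: "subspace ?H" "dim ?H + 1 = dim V" "rational_subspace W ?H" using u(2) unfolding rational_hyperplane_def by auto
  obtain U where U: "\<forall>u\<in>U. rform u" "?H = hcone U" using rational_subspace_fg[OF H(3)] unfolding fg_iff_hcone by blast
  have "?H \<noteq> V" using H(2) by auto
  then obtain v where v: "v \<in> V" "v \<notin> hcone U" using U(2) by blast
  then obtain t where t: "t \<in> U" "t v < 0" using hconeI[OF v(1), of U] by (meson not_le)
  have rt: "rform t" using U(1) t(1) by simp
  then have lt: "linear t" by (rule rform_linear)
  have tH: "t x = 0" if x: "x \<in> ?H" for x
  proof -
    have "0 \<le> t x" using x t(1) unfolding U(2) by (intro hconeD(1))
    moreover have "- x \<in> ?H" by (rule subspace_neg[OF H(1) x])
    then have "0 \<le> t (- x)" using t(1) unfolding U(2) by (intro hconeD(1))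
    ultimately show ?thesis by (simp add: linear_neg[OF lt])
  qed
  have uv: "u v \<noteq> 0" using v U(2) by blast
  define c where "c = t v / u v"
  have tu: "t x = c * u x" if x: "x \<in> V" for x
  proof -
    have "x - (u x / u v) *\<^sub>R v \<in> ?H"
      using x v(1) uv subspace_V by (auto simp: subspace_diff subspace_scale linear_diff[OF u(1)] linear_scale[OF u(1)])
    from tH[OF this] show ?thesis by (simp add: linear_diff[OF lt] linear_scale[OF lt] c_def)
  qed
  have c0: "c \<noteq> 0" using t(2) uv by (simp add: c_def)
  show ?thesis
  proof (cases "c > 0")
    case True
    then have "S = {x\<in>V. 0 \<le> t x}" unfolding u(3) using tu by (auto simp: zero_le_mult_iff)
    then show ?thesis using rt by blast
  next
    case False
    then have "c < 0" using c0 by simp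
    then have "S = {x\<in>V. 0 \<le> - t x}" unfolding u(3) using tu by (auto simp: mult_le_0_iff)
    then show ?thesis using rform_minus[OF rt] by blast
  qed
qed

lemma polycone_iff_fg: "polycone V W \<sigma> \<longleftrightarrow> fg \<sigma>"
proof
  assume "polycone V W \<sigma>"
  then obtain F where F: "finite F" "\<forall>S\<in>F. rational_halfspace V W S" "\<sigma> = V \<inter> \<Inter>F" unfolding polycone_def by blast
  have "\<forall>S\<in>F. \<exists>u. rform u \<and> S = {x\<in>V. 0 \<le> u x}" using F(2) rational_halfspace_rform by simp
  from bchoice[OF this] obtain g where g: "\<forall>S\<in>F. rform (g S) \<and> S = {x\<in>V. 0 \<le> g S x}" by (elim exE)
  have "\<sigma> = hcone (g ` F)"
  proof (intro Set.set_eqI iffI)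
    fix x assume x: "x \<in> \<sigma>"
    show "x \<in> hcone (g ` F)"
    proof (rule hconeI)
      show "x \<in> V" using x F(3) by simp
      fix u assume "u \<in> g ` F"
      then obtain S where S: "S \<in> F" "u = g S" by blast
      have "x \<in> S" using x F(3) S(1) by blast
      then show "0 \<le> u x" using bspec[OF g S(1)] S(2) by blast
    qed
  next
    fix x assume x: "x \<in> hcone (g ` F)"
    have "x \<in> S" if S: "S \<in> F" for S
      using bspec[OF g S] hconeD(1)[OF x imageI[OF S]] hconeD(2)[OF x] by blast
    then show "x \<in> \<sigma>" using F(3) hconeD(2)[OF x] by blast
  qed
  moreover have "\<forall>u\<in>g ` F. rform u" using g by simp
  ultimately show "fg \<sigma>" unfolding fg_iff_hcone using F(1) by (intro exI[of _ "g ` F"] conjI) simp_all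
next
  assume "fg \<sigma>"
  then obtain U where U: "finite U" "\<forall>u\<in>U. rform u" "\<sigma> = hcone U" unfolding fg_iff_hcone by blast
  \<comment> \<open>A form vanishing on all of \<open>V\<close> bounds no halfspace, so only the
    others are kept; the inequalities dropped hold throughout \<open>V\<close>.\<close>
  let ?U = "{u\<in>U. \<exists>w\<in>V. u w \<noteq> 0}"
  let ?F = "(\<lambda>u. {x\<in>V. 0 \<le> u x}) ` ?U"
  have "rational_halfspace V W S" if SF: "S \<in> ?F" for S
  proof -
    obtain u where u: "u \<in> ?U" "S = {x\<in>V. 0 \<le> u x}" using SF by blast
    then obtain w where w: "w \<in> V" "u w \<noteq> 0" by blast
    have ru: "rform u" using U(2) u(1) by simp
    have lu: "linear u" by (rule rform_linear[OF ru])
    let ?H = "{x\<in>V. u x = 0}"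
    note D = dim_kernel_hyperplane[OF lu w]
    have "?H = hcone {u, \<lambda>x. - u x}" by (auto simp: hcone_def)
    moreover have "fg (hcone {u, \<lambda>x. - u x})"
      unfolding fg_iff_hcone using ru rform_minus[OF ru] by (intro exI[of _ "{u, \<lambda>x. - u x}"]) simp
    ultimately have "rational_subspace W ?H" using fg_rational_subspace[OF _ D(1)] by simp
    then have "rational_hyperplane V W ?H" unfolding rational_hyperplane_def using D by auto
    then show ?thesis unfolding rational_halfspace_def using lu u(2) by blast
  qed
  moreover have "\<sigma> = V \<inter> \<Inter>?F"
  proof (intro Set.set_eqI iffI)
    fix x assume "x \<in> \<sigma>"
    then have x: "x \<in> hcone U" using U(3) by simp
    show "x \<in> V \<inter> \<Inter>?F" using hconeD(2)[OF x] hconeD(1)[OF x] by auto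
  next
    fix x assume x: "x \<in> V \<inter> \<Inter>?F"
    have "x \<in> hcone U"
    proof (rule hconeI)
      show xV: "x \<in> V" using x by simp
      fix u assume u: "u \<in> U"
      show "0 \<le> u x"
      proof (cases "u x = 0")
        case False
        then have "u \<in> ?U" using u xV by blast
        then have "{x\<in>V. 0 \<le> u x} \<in> ?F" by (rule imageI)
        then show ?thesis using x by blast
      qed simp
    qed
    then show "x \<in> \<sigma>" using U(3) by simp
  qed
  moreover have "finite ?F" using U(1) by simp
  ultimately show "polycone V W \<sigma>" unfolding polycone_def by blast
qed

lemma cone_face_iff:
  assumes "fg \<sigma>"
  shows "cone_face \<tau> \<sigma> \<longleftrightarrow> cface \<tau> \<sigma>"
proof
  assume "cone_face \<tau> \<sigma>"
  then obtain u :: "'a \<Rightarrow> real" where u: "linear u" "\<forall>x\<in>\<sigma>. 0 \<le> u x" "\<tau> = {x\<in>\<sigma>. u x = 0}" unfolding cone_face_def by blast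
  have C: "convex_cone \<sigma>" by (rule fg_convex_cone[OF assms])
  show "cface \<tau> \<sigma>"
    unfolding cface_def
  proof (intro conjI ballI impI)
    show "convex_cone \<tau>"
      by (rule convex_coneI) (auto simp: u(3) convex_cone_contains_0[OF C] convex_cone_add[OF C] convex_cone_scaleR[OF C]
          linear_0[OF u(1)] linear_add[OF u(1)] linear_scale[OF u(1)])
    show "\<tau> \<subseteq> \<sigma>" by (auto simp: u(3))
    fix x y assume xy: "x \<in> \<sigma>" "y \<in> \<sigma>" "x + y \<in> \<tau>"
    then have "u x + u y = 0" by (simp add: u(3) linear_add[OF u(1)])
    moreover have "0 \<le> u x" "0 \<le> u y" using u(2) xy by auto
    ultimately have "u x = 0" by linarith
    then show "x \<in> \<tau>" using xy by (simp add: u(3))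
  qed
next
  assume "cface \<tau> \<sigma>"
  then show "cone_face \<tau> \<sigma>" unfolding cone_face_def by (rule fg_exposed[OF assms])
qed

lemma sharp_iff:
  assumes "convex_cone (\<sigma> :: 'a set)"
  shows "sharp \<sigma> \<longleftrightarrow> (\<forall>x. x \<in> \<sigma> \<longrightarrow> - x \<in> \<sigma> \<longrightarrow> x = 0)"
proof
  assume sh: "sharp \<sigma>"
  show "\<forall>x. x \<in> \<sigma> \<longrightarrow> - x \<in> \<sigma> \<longrightarrow> x = 0"
  proof (intro allI impI)
    fix x assume x: "x \<in> \<sigma>" "- x \<in> \<sigma>"
    show "x = 0"
    proof (rule ccontr)
      assume x0: "x \<noteq> 0"
      have "span {x} \<subseteq> \<sigma>"
      proof
        fix y assume "y \<in> span {x}"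
        then obtain k where k: "y = k *\<^sub>R x" by (auto simp: span_singleton)
        show "y \<in> \<sigma>"
        proof (cases "k \<ge> 0")
          case True
          then show ?thesis unfolding k by (rule convex_cone_scaleR[OF assms _ x(1)])
        next
          case False
          then have "(- k) *\<^sub>R (- x) \<in> \<sigma>" by (intro convex_cone_scaleR[OF assms _ x(2)]) simp
          then show ?thesis unfolding k by simp
        qed
      qed
      moreover have "dim (span {x}) = 1" using x0 dim_insert[of x "{}"] by simp
      ultimately show False using sh subspace_span unfolding sharp_def by blast
    qed
  qed
next
  assume *: "\<forall>x. x \<in> \<sigma> \<longrightarrow> - x \<in> \<sigma> \<longrightarrow> x = 0"
  show "sharp \<sigma>"
    unfolding sharp_def
  proof
    assume "\<exists>L. subspace L \<and> dim L = 1 \<and> L \<subseteq> \<sigma>"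
    then obtain L where L: "subspace L" "dim L = 1" "L \<subseteq> \<sigma>" by blast
    have "L \<subseteq> {0}" using * L(3) subspace_neg[OF L(1)] by blast
    then have "dim L = 0" by (simp add: dim_eq_0)
    then show False using L(2) by simp
  qed
qed

lemma fg_zero: "fg {0}"
  using fg_hull[of "{}"] by (simp add: convex_cone_hull_empty)

text \<open>The zero cone is inserted because \<Sigma> may be empty, whereas \<open>lfan\<close>
  demands its lineality space as a member. Sharpness makes it a face of every cone of
  \<Sigma>.\<close>

lemma fan_imp_lfan:
  assumes "fan V W \<Sigma>"
  shows "lfan {0} (insert {0} \<Sigma>)"
proof -
  have sf: "finite \<Sigma>" "\<And>\<sigma>. \<sigma> \<in> \<Sigma> \<Longrightarrow> polycone V W \<sigma>" "\<And>\<sigma> \<tau>. \<sigma> \<in> \<Sigma> \<Longrightarrow> cone_face \<tau> \<sigma> \<Longrightarrow> \<tau> \<in> \<Sigma>"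
    "\<And>\<sigma> \<tau>. \<sigma> \<in> \<Sigma> \<Longrightarrow> \<tau> \<in> \<Sigma> \<Longrightarrow> cone_face (\<sigma> \<inter> \<tau>) \<sigma>" "\<And>\<sigma>. \<sigma> \<in> \<Sigma> \<Longrightarrow> sharp \<sigma>"
    using assms by (auto simp: fan_def semifan_def)
  have fgS: "fg \<sigma>" if "\<sigma> \<in> \<Sigma>" for \<sigma> using sf(2)[OF that] polycone_iff_fg by blast
  have C: "convex_cone \<sigma>" if "\<sigma> \<in> \<Sigma>" for \<sigma> by (rule fg_convex_cone[OF fgS[OF that]])
  have z: "cface {0} \<sigma>" if \<sigma>: "\<sigma> \<in> \<Sigma>" for \<sigma>
    unfolding cface_def
  proof (intro conjI ballI impI)
    show "{0} \<subseteq> \<sigma>" using convex_cone_contains_0[OF C[OF \<sigma>]] by simp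
    fix x y assume xy: "x \<in> \<sigma>" "y \<in> \<sigma>" "x + y \<in> {0}"
    then have "y = - x" by (simp add: add_eq_0_iff)
    then show "x \<in> {0}" using sharp_iff[OF C[OF \<sigma>]] sf(5)[OF \<sigma>] xy by blast
  qed simp
  show ?thesis
    unfolding lfan_def
  proof (intro conjI ballI allI impI)
    show "finite (insert {0} \<Sigma>)" "subspace {0::'a}" "{0} \<in> insert {0} \<Sigma>" using sf(1) by auto
    fix \<sigma> assume \<sigma>: "\<sigma> \<in> insert {0} \<Sigma>"
    show "fg \<sigma>" using \<sigma> fgS fg_zero by blast
    show z\<sigma>: "{0} \<subseteq> \<sigma>" using \<sigma> convex_cone_contains_0[OF C] by auto
    { fix \<tau> assume F: "cface \<tau> \<sigma>"
      show "\<tau> \<in> insert {0} \<Sigma>"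
      proof (cases "\<sigma> \<in> \<Sigma>")
        case True
        then show ?thesis using sf(3)[OF True] cone_face_iff[OF fgS[OF True]] F by blast
      next
        case False
        then have "\<tau> = {0}" using \<sigma> cface_subset[OF F] convex_cone_contains_0[OF cface_convex_cone[OF F]] by blast
        then show ?thesis by simp
      qed }
    fix \<tau> assume \<tau>: "\<tau> \<in> insert {0} \<Sigma>"
    have z\<tau>: "0 \<in> \<tau>" using \<tau> convex_cone_contains_0[OF C] by auto
    show "cface (\<sigma> \<inter> \<tau>) \<sigma>"
    proof (cases "\<sigma> \<in> \<Sigma> \<and> \<tau> \<in> \<Sigma>")
      case True
      then show ?thesis using sf(4) cone_face_iff[OF fgS] by blast
    next
      case False
      then have "\<sigma> \<inter> \<tau> = {0}" using \<sigma> \<tau> z\<sigma> z\<tau> by blast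
      moreover have "cface {0} \<sigma>" using \<sigma> z cface_refl[OF convex_cone_singleton] by blast
      ultimately show ?thesis by simp
    qed
  qed
qed

lemma lfan_imp_semifan:
  assumes "lfan L N"
  shows "semifan V W N"
  unfolding semifan_def
  using lfanD(1,4,6,7)[OF assms] polycone_iff_fg cone_face_iff by (intro conjI ballI allI impI) blast+

lemma topin_iff_interior:
  assumes "\<Union>N \<subseteq> V" "x \<in> V"
  shows "topin N x \<longleftrightarrow> x \<in> top_of_set V interior_of (\<Union>N)"
proof
  assume "topin N x"
  then obtain e where e: "e > 0" "\<forall>y\<in>V. norm (y - x) < e \<longrightarrow> y \<in> \<Union>N" unfolding topin_def by blast
  have "V \<inter> ball x e \<subseteq> \<Union>N" using e(2) by (auto simp: dist_norm norm_minus_commute)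
  moreover have "openin (top_of_set V) (V \<inter> ball x e)" by (simp add: openin_open_Int)
  ultimately show "x \<in> top_of_set V interior_of (\<Union>N)" unfolding interior_of_def using assms(2) e(1) by auto
next
  assume "x \<in> top_of_set V interior_of (\<Union>N)"
  then obtain T where T: "openin (top_of_set V) T" "x \<in> T" "T \<subseteq> \<Union>N" unfolding interior_of_def by blast
  then obtain e where "e > 0" "\<forall>y\<in>V. dist y x < e \<longrightarrow> y \<in> T" unfolding openin_euclidean_subtopology_iff by blast
  then show "topin N x" unfolding topin_def dist_norm using T(3) by blast
qed

end

section \<open>Packings and strong completions\<close>

context rational_space
begin

lemma join_hull_mem:
  assumes S: "lfan {0} S" and P: "joinc S P" and F: "(\<kappa>, F) \<in> P"
  shows "({0}, F) \<in> P" "jset {0} F = convex_cone hull F" "fg (convex_cone hull F)"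
proof -
  have \<kappa>: "\<kappa> \<in> S" by (rule joincD(3)[OF P F])
  have "cface {0} \<kappa>" using lfan_face_iff[OF S lfanD(3)[OF S] \<kappa>] lfanD(5)[OF S \<kappa>] by simp
  then show "({0}, F) \<in> P" by (rule joincD(6)[OF P F]) simp
  show "jset {0} F = convex_cone hull F" unfolding jset_eq_sum[OF joincD(4)[OF P F]] by auto
  show "fg (convex_cone hull F)" by (rule fg_hull[OF joincD(4,5)[OF P F]])
qed

lemma join_independent:
  assumes S: "lfan {0} S" and P: "joinc S P" and F: "(\<kappa>, F) \<in> P"
  shows "independent F"
proof (rule independent_if_scalars_zero[OF joincD(4)[OF P F]])
  fix f v assume f: "(\<Sum>x\<in>F. f x *\<^sub>R x) = 0" and v: "v \<in> F"
  \<comment> \<open>The positive and negative parts of a linear relation are two nonnegative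
    combinations with the same value, which uniqueness identifies.\<close>
  let ?a = "\<lambda>x. if x \<in> F then max (f x) 0 else 0" and ?c = "\<lambda>x. if x \<in> F then max (- f x) 0 else 0"
  have fF: "finite F" by (rule joincD(4)[OF P F])
  have ac: "?a \<in> coef F" "?c \<in> coef F" by (auto simp: coef_def)
  have "vs ?a - vs ?c = (\<Sum>x\<in>F. (max (f x) 0 - max (- f x) 0) *\<^sub>R x)"
    unfolding vs_coef[OF fF ac(1)] vs_coef[OF fF ac(2)] by (simp add: scaleR_diff_left sum_subtractf)
  also have "\<dots> = (\<Sum>x\<in>F. f x *\<^sub>R x)" by (rule sum.cong) (auto simp: max_def)
  finally have "0 + vs ?a = 0 + vs ?c" using f by simp
  from joinc_inj(2)[OF P join_hull_mem(1)[OF S P F] join_hull_mem(1)[OF S P F] _ _ ac this]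
  have "?a = ?c" by simp
  from fun_cong[OF this, of v] v show "f v = 0" by (auto simp: max_def split: if_splits)
qed

text \<open>Comparing with a pair \<open>(\<tau>, {})\<close> gives freeness, comparing two
  representations over the same pair gives directness; both are uniqueness in \<open>P\<close>.
  Sharpness holds because the lineality space of \<open>cells P\<close> is zero.\<close>

lemma join_separation:
  assumes S: "lfan {0} (insert {0} \<Sigma>)" and P: "joinc (insert {0} \<Sigma>) P" and F: "(\<kappa>, F) \<in> P"
  shows "separation V W \<Sigma> (jset \<kappa> F) \<kappa> (convex_cone hull F)"
proof -
  note h = join_hull_mem[OF S P F]
  let ?F = "convex_cone hull F"
  have fF: "finite F" by (rule joincD(4)[OF P F])
  have hF: "?F = vs ` coef F" by (rule convex_cone_hull_finite[OF fF])
  have \<kappa>: "\<kappa> \<in> insert {0} \<Sigma>" by (rule joincD(3)[OF P F])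
  have C: "convex_cone \<kappa>" by (rule lfanD(8)[OF S \<kappa>])
  have F\<tau>: "x = 0" if x: "x \<in> ?F" "x \<in> \<tau>" "\<tau> \<in> insert {0} \<Sigma>" for x \<tau>
  proof -
    obtain a where a: "a \<in> coef F" "x = vs a" using x(1) unfolding hF by blast
    have "0 + vs a = x + vs (\<lambda>v. 0)" using a(2) by simp
    from joinc_inj(1)[OF P h(1) joincD(2)[OF P x(3)] _ x(2) a(1) coef_zero this] show ?thesis by simp
  qed
  have "sharp ?F"
    unfolding sharp_iff[OF convex_cone_convex_cone_hull]
  proof (intro allI impI)
    fix x assume x: "x \<in> ?F" "- x \<in> ?F"
    have "?F \<in> cells P" using cellsI[OF h(1)] h(2) by simp
    from lfan_lineality[OF lfan_cells[OF S P] this x] show "x = 0" by simp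
  qed
  moreover have "free_over \<Sigma> ?F"
    unfolding free_over_def
  proof
    fix \<tau> assume \<tau>: "\<tau> \<in> \<Sigma>"
    then have "0 \<in> \<tau>" using lfanD(9)[OF S] by blast
    then show "?F \<inter> \<tau> = {0}" using F\<tau>[of _ \<tau>] \<tau> convex_cone_hull_contains_0[of F] by blast
  qed
  moreover have "span \<kappa> \<inter> span ?F = {0}"
  proof
    show "span \<kappa> \<inter> span ?F \<subseteq> {0}"
    proof
      fix z assume "z \<in> span \<kappa> \<inter> span ?F"
      then obtain p q x y where *: "p \<in> \<kappa>" "q \<in> \<kappa>" "z = p - q" "x \<in> ?F" "y \<in> ?F" "z = x - y"
        using convex_cone_span_diff[OF C] convex_cone_span_diff[OF convex_cone_convex_cone_hull[of F]] by blast
      obtain a c where ac: "a \<in> coef F" "x = vs a" "c \<in> coef F" "y = vs c" using *(4,5) unfolding hF by blast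
      have "p + vs c = q + vs a" using *(3,6) ac(2,4) by (simp add: algebra_simps)
      from joinc_inj(1)[OF P F F *(1,2) ac(3,1) this] show "z \<in> {0}" using *(3) by simp
    qed
  qed (simp add: span_zero)
  ultimately show ?thesis
    unfolding separation_def direct_sum_of_def using \<kappa> polycone_iff_fg h(3) jset_eq_sum[OF fF] by auto
qed

text \<open>First \<tau> equals \<kappa>: points of \<tau> have no \<open>F\<close>-part, and the
  \<open>\<tau>'\<close>-part of a point of \<kappa> lies in \<kappa>, where freeness kills it. The
  complements then agree because the sums are direct. This gives the description in
  \<open>ex_part\<close> its value.\<close>

lemma separation_unique:
  assumes S: "lfan {0} (insert {0} \<Sigma>)" and P: "joinc (insert {0} \<Sigma>) P" and F: "(\<kappa>, F) \<in> P"
    and sep: "separation V W \<Sigma> (jset \<kappa> F) \<tau> \<tau>'"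
  shows "\<tau>' = convex_cone hull F"
proof -
  note h = join_hull_mem[OF S P F]
  let ?F = "convex_cone hull F" and ?J = "jset \<kappa> F"
  have fF: "finite F" by (rule joincD(4)[OF P F])
  have hF: "?F = vs ` coef F" by (rule convex_cone_hull_finite[OF fF])
  have \<kappa>: "\<kappa> \<in> insert {0} \<Sigma>" by (rule joincD(3)[OF P F])
  have C\<kappa>: "convex_cone \<kappa>" by (rule lfanD(8)[OF S \<kappa>])
  have \<tau>: "\<tau> \<in> insert {0} \<Sigma>" and pc: "polycone V W \<tau>'" and fr: "free_over \<Sigma> \<tau>'"
    and J: "?J = {x + y | x y. x \<in> \<tau> \<and> y \<in> \<tau>'}" and dir: "span \<tau> \<inter> span \<tau>' = {0}"
    using sep unfolding separation_def direct_sum_of_def by auto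
  have C\<tau>: "convex_cone \<tau>" by (rule lfanD(8)[OF S \<tau>])
  have C\<tau>': "convex_cone \<tau>'" using pc polycone_iff_fg fg_convex_cone by blast
  have z: "0 \<in> \<tau>" "0 \<in> \<tau>'" "0 \<in> \<kappa>" using convex_cone_contains_0 C\<tau> C\<tau>' C\<kappa> by auto
  have \<tau>J: "x \<in> ?J" if "x \<in> \<tau>" for x
  proof -
    have "x + 0 \<in> ?J" unfolding J using that z(2) by blast
    then show ?thesis by simp
  qed
  have \<tau>'J: "x \<in> ?J" if "x \<in> \<tau>'" for x
  proof -
    have "0 + x \<in> ?J" unfolding J using that z(1) by blast
    then show ?thesis by simp
  qed
  have \<tau>\<kappa>: "\<tau> \<subseteq> \<kappa>" by (rule joinc_base_subset[OF P \<tau> F]) (use \<tau>J in blast)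
  have \<kappa>0: "x = 0" if "x \<in> \<kappa>" "x \<in> \<tau>'" for x
    using that fr \<kappa> unfolding free_over_def by blast
  have \<kappa>\<tau>: "\<kappa> \<subseteq> \<tau>"
  proof
    fix k assume k: "k \<in> \<kappa>"
    then have "k \<in> ?J" using jset_base by blast
    then obtain t t' where t: "k = t + t'" "t \<in> \<tau>" "t' \<in> \<tau>'" unfolding J by blast
    obtain k2 a where ka: "k2 \<in> \<kappa>" "a \<in> coef F" "t' = k2 + vs a" using \<tau>'J[OF t(3)] by (rule jsetE)
    have "(t + k2) + vs a = k + vs (\<lambda>v. 0)" using t(1) ka(3) by (simp add: add.assoc)
    from joinc_inj[OF P F F convex_cone_add[OF C\<kappa> subsetD[OF \<tau>\<kappa> t(2)] ka(1)] k ka(2) coef_zero this]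
    have "vs a = 0" by simp
    then have "t' \<in> \<kappa>" using ka(1,3) by simp
    then have "t' = 0" using \<kappa>0 t(3) by blast
    then show "k \<in> \<tau>" using t(1,2) by simp
  qed
  have sub: "\<tau>' \<subseteq> ?F"
  proof
    fix x assume x: "x \<in> \<tau>'"
    obtain k a where ka: "k \<in> \<kappa>" "a \<in> coef F" "x = k + vs a" using \<tau>'J[OF x] by (rule jsetE)
    have "vs a \<in> ?J" by (rule jset_vs[OF z(3) ka(2)])
    then obtain t t' where t: "vs a = t + t'" "t \<in> \<tau>" "t' \<in> \<tau>'" unfolding J by blast
    have "x - t' = k + t" using ka(3) t(1) by simp
    moreover have "k + t \<in> span \<tau>" using ka(1) t(2) \<kappa>\<tau> by (intro span_add span_base) auto
    moreover have "x - t' \<in> span \<tau>'" using x t(3) by (intro span_diff span_base)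
    ultimately have kt: "k + t = 0" using dir by auto
    then have "- k \<in> \<kappa>" using t(2) \<tau>\<kappa> by (simp add: add_eq_0_iff subset_iff)
    then have "k = 0" using lfan_lineality[OF S \<kappa> ka(1)] by simp
    then show "x \<in> ?F" unfolding hF using ka(2,3) by simp
  qed
  have "span \<kappa> \<inter> span ?F = {0}"
    using join_separation[OF S P F] unfolding separation_def direct_sum_of_def by simp
  moreover have "?F \<subseteq> \<tau>'"
  proof
    fix x assume x: "x \<in> ?F"
    have "x \<in> ?J" using x jset_mono[of "{0}" \<kappa> F F] z(3) h(2) by auto
    then obtain t t' where t: "x = t + t'" "t \<in> \<tau>" "t' \<in> \<tau>'" unfolding J by blast
    have "x - t' = t" using t(1) by simp
    moreover have "x - t' \<in> span ?F" using x t(3) sub by (intro span_diff span_base) auto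
    moreover have "t \<in> span \<kappa>" using t(2) \<tau>\<kappa> span_base by blast
    ultimately have "t = 0" using \<open>span \<kappa> \<inter> span ?F = {0}\<close> by auto
    then show "x \<in> \<tau>'" using t(1,3) by simp
  qed
  ultimately show ?thesis using sub by blast
qed

lemma join_ex_part:
  assumes "lfan {0} (insert {0} \<Sigma>)" "joinc (insert {0} \<Sigma>) P" "(\<kappa>, F) \<in> P"
  shows "ex_part V W \<Sigma> (jset \<kappa> F) = convex_cone hull F"
  unfolding ex_part_def
  by (rule the_equality) (use join_separation[OF assms] separation_unique[OF assms] in blast)+

lemma join_relatively_simplicial:
  assumes S: "lfan {0} (insert {0} \<Sigma>)" and P: "joinc (insert {0} \<Sigma>) P"
  shows "relatively_simplicial \<Sigma> (cells P)"
  unfolding relatively_simplicial_def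
proof (intro ballI impI)
  fix \<sigma> assume "\<sigma> \<in> cells P" and fr: "free_over \<Sigma> \<sigma>"
  then obtain \<kappa> F where F: "(\<kappa>, F) \<in> P" "\<sigma> = jset \<kappa> F" by (auto elim!: cellsE)
  have \<kappa>: "\<kappa> \<in> insert {0} \<Sigma>" by (rule joincD(3)[OF P F(1)])
  have "\<kappa> = {0}"
  proof (cases "\<kappa> \<in> \<Sigma>")
    case True
    then have "\<sigma> \<inter> \<kappa> = {0}" using fr unfolding free_over_def by blast
    then show ?thesis using jset_base[of \<kappa> F] F(2) by blast
  qed (use \<kappa> in simp)
  then have "\<sigma> = convex_cone hull F" using F(2) join_hull_mem(2)[OF S P F(1)] by simp
  then show "simplicial_cone \<sigma>" unfolding simplicial_cone_def using join_independent[OF S P F(1)] by blast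
qed

text \<open>Tight separability takes frontiers relative to the span of the support; one interior
  point identifies this span with \<open>V\<close>.\<close>

lemma topin_span:
  assumes "\<Union>N \<subseteq> V" "x \<in> V" "topin N x"
  shows "span (\<Union>N) = V"
proof
  show "span (\<Union>N) \<subseteq> V" using span_minimal[OF assms(1) subspace_V] .
  obtain e where e: "e > 0" "\<forall>y\<in>V. norm (y - x) < e \<longrightarrow> y \<in> \<Union>N" using assms(3) unfolding topin_def by blast
  have xN: "x \<in> \<Union>N" using e assms(2) by simp
  show "V \<subseteq> span (\<Union>N)"
  proof
    fix y assume y: "y \<in> V"
    define d where "d = e / (norm y + 1)"
    have "norm y + 1 > 0" by (simp add: add_nonneg_pos)
    then have d: "d > 0" "d * norm y < e" using e(1) by (simp_all add: d_def field_simps)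
    have "x + d *\<^sub>R y \<in> V" using assms(2) y subspace_V by (simp add: subspace_add subspace_scale)
    then have "x + d *\<^sub>R y \<in> \<Union>N" using e(2) d by simp
    then have "inverse d *\<^sub>R ((x + d *\<^sub>R y) - x) \<in> span (\<Union>N)"
      using xN by (intro span_scale span_diff span_base)
    then show "y \<in> span (\<Union>N)" using d(1) by simp
  qed
qed

text \<open>If all cells through \<open>x\<close> had proper spans, a direction avoiding these
  finitely many subspaces would lie in no tangent cone at \<open>x\<close>.\<close>

lemma intpt_full_dimensional:
  assumes N: "lfan L N" and x: "intpt N x"
  shows "\<exists>\<rho>\<in>N. x \<in> \<rho> \<and> span \<rho> = V"
proof (rule ccontr)
  assume no: "\<not> ?thesis"
  let ?X = "span ` {\<rho>\<in>N. x \<in> \<rho>}"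
  have sp: "span \<rho> \<subseteq> V" if "\<rho> \<in> N" for \<rho> using span_minimal[OF fg_subset[OF lfanD(4)[OF N that]] subspace_V] .
  have "\<exists>y\<in>V. y \<notin> \<Union>?X"
  proof (rule subspace_avoiding[OF subspace_V])
    show "finite ?X" using lfanD(1)[OF N] by simp
    fix T assume "T \<in> ?X"
    then obtain \<rho> where "\<rho> \<in> N" "x \<in> \<rho>" "T = span \<rho>" by blast
    then show "subspace T \<and> \<not> V \<subseteq> T" using no sp[of \<rho>] subspace_span by blast
  qed
  then obtain y where y: "y \<in> V" "y \<notin> \<Union>?X" by blast
  obtain \<rho> M where \<rho>: "\<rho> \<in> N" "x \<in> \<rho>" "y + M *\<^sub>R x \<in> \<rho>" using x y(1) unfolding intpt_def by blast
  have "(y + M *\<^sub>R x) - M *\<^sub>R x \<in> span \<rho>" using \<rho>(2,3) by (intro span_diff span_scale span_base)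
  then show False using y(2) \<rho>(1,2) by auto
qed

lemma join_core:
  assumes S: "lfan L S" and P: "joinc S P" and F: "(\<kappa>, F) \<in> P" and k: "core k \<kappa>"
  shows "core (k + (\<Sum>f\<in>F. f)) (jset \<kappa> F)"
proof (rule coreI)
  have fF: "finite F" by (rule joincD(4)[OF P F])
  show C: "convex_cone (jset \<kappa> F)" by (rule fg_convex_cone[OF joinc_fg[OF S P F]])
  have C\<kappa>: "convex_cone \<kappa>" by (rule lfanD(8)[OF S joincD(3)[OF P F]])
  let ?s = "\<Sum>f\<in>F. f"
  have J: "x + y \<in> jset \<kappa> F" if "x \<in> \<kappa>" "y \<in> convex_cone hull F" for x y
    unfolding jset_eq_sum[OF fF] using that by blast
  have cs: "core ?s (convex_cone hull F)" by (rule core_sum_hull[OF fF])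
  show "k + ?s \<in> jset \<kappa> F" using J k cs by (simp add: core_def)
  fix z assume "z \<in> jset \<kappa> F"
  then obtain x y where xy: "x \<in> \<kappa>" "y \<in> convex_cone hull F" "z = x + y" unfolding jset_eq_sum[OF fF] by blast
  obtain M1 where M1: "M1 \<ge> 0" "- x + M1 *\<^sub>R k \<in> \<kappa>"
    using k span_neg[OF span_base[OF xy(1)]] unfolding core_def by blast
  obtain M2 where M2: "M2 \<ge> 0" "- y + M2 *\<^sub>R ?s \<in> convex_cone hull F"
    using cs span_neg[OF span_base[OF xy(2)]] unfolding core_def by blast
  have "- x + max M1 M2 *\<^sub>R k \<in> \<kappa>"
    by (rule ext_larger[OF C\<kappa> _ M1(2)]) (use k in \<open>auto simp: core_def\<close>)
  moreover have "- y + max M1 M2 *\<^sub>R ?s \<in> convex_cone hull F"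
    by (rule ext_larger[OF convex_cone_convex_cone_hull _ M2(2)]) (use cs in \<open>auto simp: core_def\<close>)
  ultimately have "(- x + max M1 M2 *\<^sub>R k) + (- y + max M1 M2 *\<^sub>R ?s) \<in> jset \<kappa> F" by (rule J)
  moreover have "(- x + max M1 M2 *\<^sub>R k) + (- y + max M1 M2 *\<^sub>R ?s) = max M1 M2 *\<^sub>R (k + ?s) - z"
    by (simp add: xy(3) scaleR_add_right)
  moreover have "max M1 M2 \<ge> 0" using M1(1) by simp
  ultimately show "\<exists>M\<ge>0. M *\<^sub>R (k + ?s) - z \<in> jset \<kappa> F" by metis
qed

theorem strong_completion_exists:
  assumes fan: "fan V W \<Sigma>"
  shows "\<exists>\<Sigma>_bar \<Sigma>_hat. strong_completion V W \<Sigma> (\<Sigma>_bar, \<Sigma>_hat)"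
proof -
  let ?S = "insert {0} \<Sigma>"
  have S: "lfan {0} ?S" by (rule fan_imp_lfan[OF fan])
  have "\<exists>P. joinc ?S P \<and> tight P \<and> based {0} P \<and> (\<forall>x\<in>\<Union>?S - {0}. intpt (cells P) x)"
    by (rule exists_neighbourhood_join[OF S]) (rule complete_join_exists)
  then obtain P where P: "joinc ?S P" "tight P" "based {0} P" "\<forall>x\<in>\<Union>?S - {0}. intpt (cells P) x"
    by (elim exE conjE)
  from completion_exists[OF S P(1,4)] obtain P' Q where P': "joinc ?S P'" and Q: "joinc ?S Q" and P'Q: "P' \<subseteq> Q"
    and cov: "\<Union>(cells P') = \<Union>(cells P)" and Qc: "\<Union>(cells Q) = V"
    and ref: "\<forall>\<kappa> F. (\<kappa>, F) \<in> P' \<longrightarrow> (\<exists>E. (\<kappa>, E) \<in> P \<and> F \<subseteq> jset {0} E \<and> (\<forall>\<kappa>'. (\<kappa>', E) \<in> P \<longrightarrow> (\<kappa>', F) \<in> P'))"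
    by (elim exE conjE)
  note N = lfan_cells[OF S P(1)] and N' = lfan_cells[OF S P'] and NQ = lfan_cells[OF S Q]
  have NV: "\<Union>(cells P) \<subseteq> V" using fg_subset[OF lfanD(4)[OF N]] by blast
  have top_eq: "topin (cells P') x \<longleftrightarrow> topin (cells P) x" for x unfolding topin_def cov ..
  have ipt: "topin (cells P') x" if x: "x \<in> \<Union>?S - {0}" for x
  proof -
    have "x \<in> V" using x fg_subset[OF lfanD(4)[OF S]] by blast
    then show ?thesis
      unfolding top_eq using intpt_imp_topin[OF lfanD(1)[OF N] lfanD(4)[OF N]] P(4) x by blast
  qed
  \<comment> \<open>Transfers \<open>based\<close> from \<open>P\<close> to \<open>P'\<close>. A
    nonempty \<open>F\<close> cannot refine an empty \<open>E\<close>, since an independent set does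
    not contain 0.\<close>
  have nonzero: "\<exists>\<kappa>'. \<kappa>' \<noteq> {0} \<and> (\<kappa>', F) \<in> P' \<and> cface \<kappa> \<kappa>'" if F: "(\<kappa>, F) \<in> P'" "F \<noteq> {}" for \<kappa> F
  proof -
    obtain E where E: "(\<kappa>, E) \<in> P" "F \<subseteq> jset {0} E" "\<forall>\<kappa>'. (\<kappa>', E) \<in> P \<longrightarrow> (\<kappa>', F) \<in> P'"
      using ref F(1) by blast
    have "E \<noteq> {}"
    proof
      assume "E = {}"
      then have "0 \<in> F" using E(2) F(2) by (auto simp: jset_empty)
      then show False using join_independent[OF S P' F(1)] dependent_zero by blast
    qed
    from P(3)[unfolded based_def, rule_format, OF E(1) this] show ?thesis using E(3) by blast
  qed
  have nz_point: "\<exists>x\<in>\<kappa>. x \<in> \<Union>?S - {0}" if "\<kappa> \<in> ?S" "\<kappa> \<noteq> {0}" for \<kappa>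
    using that lfanD(9)[OF S that(1)] by blast
  have bdry: "\<not> topin (cells P') x" if F: "(\<kappa>, F) \<in> P'" and x: "x \<in> convex_cone hull F" "x \<noteq> 0" for \<kappa> F x
  proof
    assume "topin (cells P') x"
    then have tp: "topin (cells P) x" using top_eq by simp
    obtain E where E: "(\<kappa>, E) \<in> P" "F \<subseteq> jset {0} E" using ref F by blast
    note hE = join_hull_mem[OF S P(1) E(1)]
    have "F \<subseteq> convex_cone hull E" using E(2) hE(2) by simp
    then have "convex_cone hull F \<subseteq> convex_cone hull E"
      by (rule hull_minimal) (rule convex_cone_convex_cone_hull)
    then obtain a where a: "a \<in> coef E" "x = vs a"
      using x(1) convex_cone_hull_finite[OF joincD(4)[OF P(1) E(1)]] by blast
    \<comment> \<open>Passing to the support of \<open>a\<close> puts \<open>x\<close> in the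
      relative interior of cone \<open>?E\<close>, so by uniqueness every cell through
      \<open>x\<close> has \<open>?E\<close> among its vectors. For such cells \<open>tight\<close>
      excludes the direction \<open>y\<close>, which interiority of \<open>x\<close> would
      require.\<close>
    let ?E = "{v. a v \<noteq> 0}"
    have EE: "?E \<subseteq> E" using coef_outside[OF a(1)] by blast
    have aE: "a \<in> coef ?E" using a(1) by (auto simp: coef_def)
    have "?E \<noteq> {}"
    proof
      assume "?E = {}"
      then have "a = (\<lambda>v. 0)" by auto
      then show False using a(2) x(2) by simp
    qed
    moreover have zE: "({0}, ?E) \<in> P" by (rule joincD(6)[OF P(1) hE(1) cface_refl[OF convex_cone_singleton] EE])
    ultimately obtain y where y: "y \<in> V" "\<forall>\<kappa>1 E1. (\<kappa>1, E1) \<in> P \<longrightarrow> ?E \<subseteq> E1 \<longrightarrow> y \<notin> dset \<kappa>1 E1 ?E"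
      using P(2)[unfolded tight_def, rule_format, of "{0}" ?E] by blast
    have xV: "x \<in> V"
      using fg_subset[OF hE(3)] \<open>convex_cone hull F \<subseteq> convex_cone hull E\<close> x(1) by blast
    have "intpt (cells P) x" by (rule topin_imp_intpt[OF lfanD(1)[OF N] lfanD(4)[OF N] xV tp])
    then obtain \<rho> M where \<rho>: "\<rho> \<in> cells P" "x \<in> \<rho>" "M \<ge> 0" "y + M *\<^sub>R x \<in> \<rho>" using y(1) unfolding intpt_def by blast
    obtain \<kappa>1 E1 where E1: "(\<kappa>1, E1) \<in> P" "\<rho> = jset \<kappa>1 E1" using \<rho>(1) by (rule cellsE)
    obtain s c where sc: "s \<in> \<kappa>1" "c \<in> coef E1" "x = s + vs c" using \<rho>(2) unfolding E1(2) by (rule jsetE)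
    have "0 + vs a = s + vs c" using a(2) sc(3) by simp
    from joinc_inj(2)[OF P(1) zE E1(1) _ sc(1) aE sc(2) this] have "a = c" by simp
    then have sub: "?E \<subseteq> E1" using coef_outside[OF sc(2)] by auto
    have "M *\<^sub>R x \<in> convex_cone hull ?E"
      using a(2) aE convex_cone_hull_finite[OF joincD(4)[OF P(1) zE]] \<rho>(3) convex_cone_hull_mul by blast
    then have "(y + M *\<^sub>R x) - M *\<^sub>R x \<in> dset \<kappa>1 E1 ?E" unfolding dset_def using \<rho>(4) E1(2) by blast
    then show False using y(2) E1(1) sub by simp
  qed
  have NV': "\<Union>(cells P') \<subseteq> V" using NV cov by simp
  have sub': "?S \<subseteq> cells P'" by (rule cells_subset_base[OF P'])
  have fx: "fan_extension V W \<Sigma> (cells P')"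
    unfolding fan_extension_def using lfan_imp_semifan[OF N'] sub' by simp
  moreover have "\<Union>\<Sigma> - {0} \<subseteq> top_of_set V interior_of (\<Union>(cells P'))"
  proof
    fix x assume x: "x \<in> \<Union>\<Sigma> - {0}"
    then have "x \<in> V" using fg_subset[OF lfanD(4)[OF S]] by blast
    then show "x \<in> top_of_set V interior_of (\<Union>(cells P'))"
      using topin_iff_interior[OF NV'] ipt x by blast
  qed
  ultimately have qp: "quasipacking V W \<Sigma> (cells P')" unfolding quasipacking_def by simp
  have tight': "tightly_separable V W \<Sigma> (cells P')"
    unfolding tightly_separable_def separable_over_def
  proof (intro conjI ballI)
    fix \<sigma> assume "\<sigma> \<in> cells P'"
    then obtain \<kappa> F where F: "(\<kappa>, F) \<in> P'" "\<sigma> = jset \<kappa> F" by (rule cellsE)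
    show "separable_cone V W \<Sigma> \<sigma>"
      unfolding separable_cone_def F(2) using join_separation[OF S P' F(1)] by blast
    show "ex_part V W \<Sigma> \<sigma> - {0} \<subseteq> top_of_set (span (\<Union>(cells P'))) frontier_of (\<Union>(cells P'))"
      unfolding F(2) join_ex_part[OF S P' F(1)]
    proof
      fix x assume x: "x \<in> convex_cone hull F - {0}"
      then have "F \<noteq> {}" by (auto simp: convex_cone_hull_empty)
      then obtain \<kappa>' where \<kappa>': "\<kappa>' \<noteq> {0}" "(\<kappa>', F) \<in> P'" using nonzero[OF F(1)] by blast
      then obtain k where k: "k \<in> \<Union>?S - {0}" using nz_point[OF joincD(3)[OF P' \<kappa>'(2)]] by blast
      have "k \<in> V" using k fg_subset[OF lfanD(4)[OF S]] by blast
      from topin_span[OF NV' this ipt[OF k]] have sp: "span (\<Union>(cells P')) = V" .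
      have "jset {0} F \<in> cells P'" by (rule cellsI[OF join_hull_mem(1)[OF S P' F(1)]])
      then have xN: "x \<in> \<Union>(cells P')" using x join_hull_mem(2)[OF S P' F(1)] by auto
      then have xV: "x \<in> V" using NV' by blast
      have "x \<in> top_of_set V closure_of (\<Union>(cells P'))"
        using closure_of_subset[of "\<Union>(cells P')" "top_of_set V"] NV' xN by auto
      moreover have "x \<notin> top_of_set V interior_of (\<Union>(cells P'))"
        using topin_iff_interior[OF NV' xV] bdry[OF F(1), of x] x by blast
      ultimately show "x \<in> top_of_set (span (\<Union>(cells P'))) frontier_of (\<Union>(cells P'))"
        unfolding sp frontier_of_def by blast
    qed
  qed
  have "equifulldimensional V (cells P')" if ne: "cones_of_dim 1 (cells P') \<noteq> {}"
  proof -
    obtain \<kappa>0 F0 where F0: "(\<kappa>0, F0) \<in> P'" "dim (jset \<kappa>0 F0) = 1"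
      using ne unfolding cones_of_dim_def by auto
    \<comment> \<open>The zero cone needs a nonzero base cone to be enlarged to; the presence of a
      one-dimensional cell guarantees that there is one.\<close>
    obtain \<kappa>1 where \<kappa>1: "\<kappa>1 \<in> ?S" "\<kappa>1 \<noteq> {0}"
    proof (cases "F0 = {}")
      case True
      then have "dim \<kappa>0 = 1" using F0(2) by (simp add: jset_empty)
      then have "\<kappa>0 \<noteq> {0}" by auto
      then show ?thesis using joincD(3)[OF P' F0(1)] that by blast
    next
      case False
      then show ?thesis using nonzero[OF F0(1)] joincD(3)[OF P'] that by blast
    qed
    have full: "\<exists>\<rho>\<in>cells P'. cface \<sigma> \<rho> \<and> dim \<rho> = dim V" if \<sigma>: "\<sigma> \<in> cells P'" for \<sigma>
    proof -
      obtain \<kappa> F where F: "(\<kappa>, F) \<in> P'" "\<sigma> = jset \<kappa> F" using \<sigma> by (rule cellsE)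
      have "\<exists>\<kappa>'. \<kappa>' \<noteq> {0} \<and> (\<kappa>', F) \<in> P' \<and> cface \<kappa> \<kappa>'"
      proof (cases "F = {} \<and> \<kappa> = {0}")
        case True
        have "cface {0} \<kappa>1" using lfan_face_iff[OF S lfanD(3)[OF S] \<kappa>1(1)] lfanD(5)[OF S \<kappa>1(1)] by simp
        then show ?thesis using True \<kappa>1 joincD(2)[OF P' \<kappa>1(1)] by blast
      next
        case False
        then show ?thesis
          using nonzero[OF F(1)] F(1) cface_refl[OF lfanD(8)[OF S joincD(3)[OF P' F(1)]]] by blast
      qed
      then obtain \<kappa>' where \<kappa>': "\<kappa>' \<noteq> {0}" "(\<kappa>', F) \<in> P'" "cface \<kappa> \<kappa>'" by blast
      let ?\<sigma> = "jset \<kappa>' F"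
      have \<kappa>'S: "\<kappa>' \<in> ?S" by (rule joincD(3)[OF P' \<kappa>'(2)])
      obtain k where k: "core k \<kappa>'" using exists_rational_core[OF lfanD(4)[OF S \<kappa>'S]] by blast
      have k0: "k \<noteq> 0"
      proof
        assume "k = 0"
        moreover obtain z where "z \<in> \<kappa>'" "z \<noteq> 0" using \<kappa>'(1) lfanD(9)[OF S \<kappa>'S] by blast
        ultimately have "- z \<in> \<kappa>'" using k span_neg[OF span_base[of z \<kappa>']] unfolding core_def by force
        then have "z = 0" using lfan_lineality[OF S \<kappa>'S \<open>z \<in> \<kappa>'\<close>] by simp
        then show False using \<open>z \<noteq> 0\<close> by simp
      qed
      have k\<kappa>: "k \<in> \<kappa>'" using k by (simp add: core_def)
      then have kS: "k \<in> \<Union>?S - {0}" using \<kappa>'S k0 by blast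
      have kV: "k \<in> V" using kS fg_subset[OF lfanD(4)[OF S]] by blast
      have ik: "intpt (cells P') k" by (rule topin_imp_intpt[OF lfanD(1)[OF N'] lfanD(4)[OF N'] kV ipt[OF kS]])
      \<comment> \<open>A core point of the cell, interior to the support because \<open>k\<close>
        is. A full-dimensional cell through it has the whole of \<open>?\<sigma>\<close> as a
        face.\<close>
      let ?x = "k + (\<Sum>f\<in>F. f)"
      have "(\<Sum>f\<in>F. f) \<in> convex_cone hull F"
        using core_sum_hull[OF joincD(4)[OF P' \<kappa>'(2)]] by (simp add: core_def)
      then have sF: "(\<Sum>f\<in>F. f) \<in> ?\<sigma>"
        using jset_mono[of "{0}" \<kappa>' F F] lfanD(9)[OF S \<kappa>'S] join_hull_mem(2)[OF S P' \<kappa>'(2)] by auto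
      have "intpt (cells P') ?x"
        by (rule intpt_add[OF N' ik cellsI[OF \<kappa>'(2)] subsetD[OF jset_base k\<kappa>] sF])
      from intpt_full_dimensional[OF N' this] obtain \<rho> where \<rho>: "\<rho> \<in> cells P'" "?x \<in> \<rho>" "span \<rho> = V" by blast
      have cx: "core ?x ?\<sigma>" by (rule join_core[OF S P' \<kappa>'(2) k])
      have \<sigma>': "?\<sigma> \<in> cells P'" by (rule cellsI[OF \<kappa>'(2)])
      have "?\<sigma> \<subseteq> ?\<sigma> \<inter> \<rho>"
        by (rule cface_core_subset[OF lfanD(7)[OF N' \<sigma>' \<rho>(1)] cx _ order_refl lfanD(8)[OF N' \<sigma>']])
          (use cx \<rho>(2) in \<open>simp add: core_def\<close>)
      then have "cface ?\<sigma> \<rho>" using lfan_face_iff[OF N' \<sigma>' \<rho>(1)] by blast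
      moreover have "cface \<sigma> ?\<sigma>" unfolding F(2) by (rule joinc_face[OF S P' \<kappa>'(2,3)]) simp
      ultimately have "cface \<sigma> \<rho>" using cface_trans by blast
      moreover have "dim \<rho> = dim V" using \<rho>(3) by (metis dim_span)
      ultimately show ?thesis using \<rho>(1) by blast
    qed
    \<comment> \<open>A form exposing a full-dimensional face vanishes on the span of that face,
      which is \<open>V\<close>, and hence on the larger cell.\<close>
    have maxd: "\<rho>' = \<rho>" if \<rho>: "\<rho> \<in> cells P'" "dim \<rho> = dim V" "\<rho>' \<in> cells P'" "cone_face \<rho> \<rho>'" for \<rho> \<rho>'
    proof -
      obtain u :: "'a \<Rightarrow> real" where u: "linear u" "\<rho> = {x\<in>\<rho>'. u x = 0}" using \<rho>(4) unfolding cone_face_def by blast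
      have "\<rho> \<subseteq> V" "\<rho>' \<subseteq> V" using NV' \<rho>(1,3) by auto
      have "span \<rho> = span V" by (rule dim_eq_span[OF \<open>\<rho> \<subseteq> V\<close>]) (use \<rho>(2) in simp)
      then have "\<rho>' \<subseteq> span \<rho>" using \<open>\<rho>' \<subseteq> V\<close> span_superset[of V] by blast
      moreover have "u x = 0" if "x \<in> span \<rho>" for x
        by (rule linear_eq_0_on_span[OF u(1) _ that]) (use u(2) in blast)
      ultimately show ?thesis using u(2) by blast
    qed
    have "cones_of_dim (dim V) (cells P') = maximal_cones (cells P')"
    proof
      show "cones_of_dim (dim V) (cells P') \<subseteq> maximal_cones (cells P')"
        unfolding cones_of_dim_def maximal_cones_def using maxd by blast
      show "maximal_cones (cells P') \<subseteq> cones_of_dim (dim V) (cells P')"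
      proof
        fix \<sigma> assume "\<sigma> \<in> maximal_cones (cells P')"
        then have \<sigma>: "\<sigma> \<in> cells P'" "\<forall>\<tau>\<in>cells P'. cone_face \<sigma> \<tau> \<longrightarrow> \<tau> = \<sigma>" by (auto simp: maximal_cones_def)
        obtain \<rho> where \<rho>: "\<rho> \<in> cells P'" "cface \<sigma> \<rho>" "dim \<rho> = dim V" using full[OF \<sigma>(1)] by blast
        have "\<rho> = \<sigma>" using \<sigma>(2) \<rho>(1,2) cone_face_iff[OF lfanD(4)[OF N' \<rho>(1)]] by blast
        then show "\<sigma> \<in> cones_of_dim (dim V) (cells P')" using \<rho>(3) \<sigma>(1) by (simp add: cones_of_dim_def)
      qed
    qed
    moreover have "cones_of_dim (dim V) (cells P') \<noteq> {}"
      using full[OF lfanD(3)[OF N']] unfolding cones_of_dim_def by blast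
    ultimately show ?thesis unfolding equifulldimensional_def by simp
  qed
  then have pk: "packing V W \<Sigma> (cells P')"
    unfolding packing_def using qp tight' join_relatively_simplicial[OF S P'] by blast
  have "cells P' \<subseteq> cells Q" using P'Q by (rule image_mono)
  then have "fan_completion V W (cells P') (cells Q)"
    unfolding fan_completion_def fan_extension_def using lfan_imp_semifan[OF NQ] Qc by simp
  then have "strong_completion V W \<Sigma> (cells P', cells Q)"
    unfolding strong_completion_def using pk join_relatively_simplicial[OF S Q] by simp
  then show ?thesis by blast
qed

end

theorem mainTheorem2:
  fixes V W :: "'a::euclidean_space set" and K :: "real set" and \<Sigma> :: "'a set set"
  assumes "subspace V"
    and "real_subfield K"
    and "K_structure K V W"
    and "fan V W \<Sigma>"
  shows "\<exists>\<Sigma>_bar \<Sigma>_hat. strong_completion V W \<Sigma> (\<Sigma>_bar, \<Sigma>_hat)"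
proof -
  obtain B where B: "independent B" "V = span B" "W = {x\<in>span B. \<forall>b. representation B x b \<in> K}"
    using K_structure_basis[OF assms(1-3)] by blast
  interpret R: rational_space K B by unfold_locales (fact assms(2), fact B(1))
  have "V = R.V" "W = R.W" using B(2,3) by (simp_all add: R.V_def R.W_def)
  then show ?thesis using R.strong_completion_exists[of \<Sigma>] assms(4) by simp
qed

end
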